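(* Let $\omega$ be an open strict interval of $\mathbb T$ and let $T>0$. Then, for every $f_0\in L^2(\mathbb T)$, $$f_0 \in\mathcal{NC}_{L^2}(\omega,T) \iff \big(P_+ f_0 \in \mathcal{NC}_{H^2}(\omega,T)\ \text{ and }\ P_+ \overline{f_0} \in \mathcal{NC}_{H^2}(\omega,T)\big).$$
   Context: $\mathbb T$ is the complex unit circle, identified with $\mathbb R/2\pi\mathbb Z$ via $x\mapsto e^{ix}$. An open strict interval of $\mathbb T$ is an open arc $\{e^{ix}:a<x<b\}$ with $0<b-a<2\pi$. Functions are complex valued; $f\in L^2(\mathbb T)$ is written $f(e^{ix})=\sum_{n\in\mathbb Z}\widehat f(n)e^{inx}$, and $\overline f$ is its complex conjugate. The Riesz projector is $P_+f(e^{ix})=\sum_{n\ge 0}\widehat f(n)e^{inx}$, and $H^2=P_+L^2(\mathbb T)$. Let $S(t)f(e^{ix})=\sum_{n}\widehat f(n)e^{-|n|t}e^{inx}$ (the semigroup generated by $-|D|$, $|D|f=\sum_n|n|\widehat f(n)e^{inx}$). The $L^2$ control system is $(\partial_t+|D|)f=\mathbf 1_\omega u$, $f(0,\cdot)=f_0\in L^2(\mathbb T)$, and the $H^2$ control system is $(\partial_t+|D|)f=P_+\mathbf 1_\omega u$, $f(0,\cdot)=f_0\in H^2$, with control $u\in L^2([0,T]\times\omega)$ ($\mathbf 1_\omega u$ is the extension of $u$ by $0$ outside $\omega$). Solutions satisfy $f(T,\cdot)=S(T)f_0+\int_0^TS(T-s)(\mathbf 1_\omega u(s,\cdot))\,ds$,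 respectively $f(T,\cdot)=S(T)f_0+\int_0^TS(T-s)P_+(\mathbf 1_\omega u(s,\cdot))\,ds$. $\mathcal{NC}_{L^2}(\omega,T)$ (resp. $\mathcal{NC}_{H^2}(\omega,T)$) is the set of $f_0\in L^2(\mathbb T)$ (resp. $f_0\in H^2$) for which there is $u\in L^2([0,T]\times\omega)$ such that the solution of the $L^2$ (resp. $H^2$) control system satisfies $f(T,\cdot)=0$. (The set $\mathcal{NC}_{H^2}(\omega,T)$ does not depend on $T>0$.) *)

theory Defs
  imports "HOL-Analysis.Analysis"
begin

section \<open>Square-integrable functions on the unit circle\<close>

text \<open>Arc length normalised to total mass 1, which makes the functions \<open>\<lambda>z. z powi n\<close> orthonormal.\<close>

definition circle :: "complex measure"
  where "circle = distr (uniform_measure lborel {-pi<..pi}) borel cis"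

definition square_integrable :: "'a measure \<Rightarrow> ('a \<Rightarrow> complex) \<Rightarrow> bool"
  where "square_integrable M f \<longleftrightarrow>
    f \<in> borel_measurable M \<and> integrable M (\<lambda>z. (cmod (f z))\<^sup>2)"

lemma sets_circle [simp, measurable_cong]: "sets circle = sets borel"
  by (simp add: circle_def)

lemma space_circle [simp]: "space circle = UNIV"
  by (simp add: circle_def)

lemma cis_measurable: "cis \<in> uniform_measure lborel {-pi<..pi} \<rightarrow>\<^sub>M borel"
  by (simp cong: measurable_cong_sets
      add: borel_measurable_continuous_onI continuous_on_cis continuous_on_id)

lemma finite_measure_circle: "finite_measure circle"
proof -
  have "finite_measure (uniform_measure lborel {-pi<..pi})"
    by (intro finite_measureI)
      (simp add: ennreal_divide_eq_top_iff ennreal_divide_self)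
  then show ?thesis
    unfolding circle_def by (rule finite_measure.finite_measure_distr) (rule cis_measurable)
qed

interpretation circle: finite_measure circle
  by (rule finite_measure_circle)

lemma AE_circle:
  assumes "{z. P z} \<in> sets borel"
  shows "(AE z in circle. P z) \<longleftrightarrow> (AE x in lborel. x \<in> {-pi<..pi} \<longrightarrow> P (cis x))"
proof -
  have "(AE z in circle. P z) \<longleftrightarrow> (AE x in uniform_measure lborel {-pi<..pi}. P (cis x))"
    using assms unfolding circle_def by (intro AE_distr_iff cis_measurable) simp
  also have "\<dots> \<longleftrightarrow> (AE x in lborel. x \<in> {-pi<..pi} \<longrightarrow> P (cis x))"
    by (rule AE_uniform_measure) (auto simp: emeasure_lborel_Ioc)
  finally show ?thesis .
qed

lemma square_integrable_measurable:
  "square_integrable M f \<Longrightarrow> f \<in> borel_measurable M"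
  by (simp add: square_integrable_def)

lemma square_integrable_inner:
  assumes "square_integrable M f" "square_integrable M g"
  shows "integrable M (\<lambda>z. f z \<bullet> g z)"
proof (rule Bochner_Integration.integrable_bound)
  show "integrable M (\<lambda>z. (cmod (f z))\<^sup>2 + (cmod (g z))\<^sup>2)"
    using assms by (auto simp: square_integrable_def)
  show "(\<lambda>z. f z \<bullet> g z) \<in> borel_measurable M"
    using assms by (auto simp: square_integrable_def)
  have "norm (f z \<bullet> g z) \<le> norm ((cmod (f z))\<^sup>2 + (cmod (g z))\<^sup>2)" for z
  proof -
    have "norm (f z \<bullet> g z) \<le> cmod (f z) * cmod (g z)"
      using Cauchy_Schwarz_ineq2 by simp
    also have "\<dots> \<le> 2 * cmod (f z) * cmod (g z)"
      using zero_le_mult_iff[of "cmod (f z)" "cmod (g z)"] by simp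
    also have "\<dots> \<le> (cmod (f z))\<^sup>2 + (cmod (g z))\<^sup>2"
      by (rule sum_squares_bound)
    finally show ?thesis by simp
  qed
  then show "AE z in M. norm (f z \<bullet> g z) \<le> norm ((cmod (f z))\<^sup>2 + (cmod (g z))\<^sup>2)"
    by simp
qed

lemma square_integrable_add:
  assumes "square_integrable M f" "square_integrable M g"
  shows "square_integrable M (\<lambda>z. f z + g z)"
proof -
  have "integrable M (\<lambda>z. (cmod (f z))\<^sup>2 + 2 * (f z \<bullet> g z) + (cmod (g z))\<^sup>2)"
    using assms square_integrable_inner[OF assms] by (auto simp: square_integrable_def)
  moreover have "(cmod (f z + g z))\<^sup>2 = (cmod (f z))\<^sup>2 + 2 * (f z \<bullet> g z) + (cmod (g z))\<^sup>2" for z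
    by (simp add: power2_norm_eq_inner inner_add inner_commute)
  ultimately show ?thesis
    using assms by (auto simp: square_integrable_def)
qed

lemma square_integrable_scaleR:
  "square_integrable M f \<Longrightarrow> square_integrable M (\<lambda>z. c *\<^sub>R f z)"
  by (auto simp: square_integrable_def power_mult_distrib)

lemma square_integrable_uminus:
  "square_integrable M f \<Longrightarrow> square_integrable M (\<lambda>z. - f z)"
  by (auto simp: square_integrable_def)

lemma square_integrable_diff:
  "square_integrable M f \<Longrightarrow> square_integrable M g \<Longrightarrow> square_integrable M (\<lambda>z. f z - g z)"
  using square_integrable_add[OF _ square_integrable_uminus, of M f g] by simp

lemma square_integrable_cnj:
  "square_integrable M f \<Longrightarrow> square_integrable M (\<lambda>z. cnj (f z))"
  by (auto simp: square_integrable_def intro: borel_measurable_continuous_on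
      [OF continuous_on_cnj[OF continuous_on_id]])

lemma square_integrable_zero: "square_integrable M (\<lambda>_. 0)"
  by (simp add: square_integrable_def)

section \<open>The Hilbert space of classes of square-integrable functions\<close>

definition circle_eq :: "(complex \<Rightarrow> complex) \<Rightarrow> (complex \<Rightarrow> complex) \<Rightarrow> bool"
  where "circle_eq f g \<longleftrightarrow> square_integrable circle f \<and> square_integrable circle g \<and>
    (AE z in circle. f z = g z)"

quotient_type L2 = "complex \<Rightarrow> complex" / partial: circle_eq
proof (rule part_equivpI)
  show "\<exists>f. circle_eq f f"
    by (rule exI[of _ "\<lambda>_. 0"]) (simp add: circle_eq_def square_integrable_zero)
  show "symp circle_eq"
    by (auto simp: circle_eq_def symp_def elim: AE_mp)
  show "transp circle_eq"
    unfolding circle_eq_def transp_def by (auto elim!: AE_mp)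
qed

text \<open>The class of \<open>f\<close>; functions that are not square integrable are sent to 0.\<close>

lift_definition L2_class :: "(complex \<Rightarrow> complex) \<Rightarrow> L2"
  is "\<lambda>f. if square_integrable circle f then f else (\<lambda>_. 0)"
  by (auto simp: circle_eq_def square_integrable_zero)

instantiation L2 :: real_inner
begin

lift_definition zero_L2 :: L2 is "\<lambda>_. 0"
  by (simp add: circle_eq_def square_integrable_zero)

lift_definition plus_L2 :: "L2 \<Rightarrow> L2 \<Rightarrow> L2" is "\<lambda>f g z. f z + g z"
  unfolding circle_eq_def by (auto intro: square_integrable_add elim!: AE_mp)

lift_definition minus_L2 :: "L2 \<Rightarrow> L2 \<Rightarrow> L2" is "\<lambda>f g z. f z - g z"
  unfolding circle_eq_def by (auto intro: square_integrable_diff elim!: AE_mp)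

lift_definition uminus_L2 :: "L2 \<Rightarrow> L2" is "\<lambda>f z. - f z"
  unfolding circle_eq_def by (auto intro: square_integrable_uminus elim!: AE_mp)

lift_definition scaleR_L2 :: "real \<Rightarrow> L2 \<Rightarrow> L2" is "\<lambda>c f z. c *\<^sub>R f z"
  unfolding circle_eq_def by (auto intro: square_integrable_scaleR elim!: AE_mp)

text \<open>On \<open>complex\<close>, \<open>z \<bullet> w\<close> is the real part of \<open>z * cnj w\<close>.\<close>

lift_definition inner_L2 :: "L2 \<Rightarrow> L2 \<Rightarrow> real" is "\<lambda>f g. \<integral>z. f z \<bullet> g z \<partial>circle"
  unfolding circle_eq_def
  by (intro integral_cong_AE) (auto simp: square_integrable_def elim!: AE_mp)

definition norm_L2 :: "L2 \<Rightarrow> real" where "norm_L2 f = sqrt (f \<bullet> f)"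
definition sgn_L2 :: "L2 \<Rightarrow> L2" where "sgn_L2 f = inverse (norm f) *\<^sub>R f"
definition dist_L2 :: "L2 \<Rightarrow> L2 \<Rightarrow> real" where "dist_L2 f g = norm (f - g)"
definition uniformity_L2 :: "(L2 \<times> L2) filter"
  where "uniformity_L2 = (INF e\<in>{0<..}. principal {(f, g). dist f g < e})"
definition open_L2 :: "L2 set \<Rightarrow> bool"
  where "open_L2 U \<longleftrightarrow> (\<forall>f\<in>U. eventually (\<lambda>(f', g). f' = f \<longrightarrow> g \<in> U) uniformity)"

instance
proof
  fix f g h :: L2 and a b :: real
  show "f + g + h = f + (g + h)"
    by transfer (auto simp: circle_eq_def add.assoc intro: square_integrable_add)
  show "f + g = g + f"
    by transfer (auto simp: circle_eq_def add.commute intro: square_integrable_add)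
  show "0 + f = f"
    by transfer (auto simp: circle_eq_def)
  show "- f + f = 0"
    by transfer (auto simp: circle_eq_def square_integrable_zero)
  show "f - g = f + - g"
    by transfer (auto simp: circle_eq_def intro: square_integrable_diff)
  show "a *\<^sub>R (f + g) = a *\<^sub>R f + a *\<^sub>R g"
    by transfer (auto simp: circle_eq_def scaleR_right_distrib
        intro!: square_integrable_add square_integrable_scaleR)
  show "(a + b) *\<^sub>R f = a *\<^sub>R f + b *\<^sub>R f"
    by transfer (auto simp: circle_eq_def scaleR_left_distrib
        intro!: square_integrable_add square_integrable_scaleR)
  show "a *\<^sub>R b *\<^sub>R f = (a * b) *\<^sub>R f"
  proof transfer
    fix a b f assume "circle_eq f f"
    then show "circle_eq (\<lambda>z. a *\<^sub>R b *\<^sub>R f z) (\<lambda>z. (a * b) *\<^sub>R f z)"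
      using square_integrable_scaleR[of circle f "a * b"] by (simp add: circle_eq_def)
  qed
  show "1 *\<^sub>R f = f"
    by transfer (auto simp: circle_eq_def)
  show "sgn f = inverse (norm f) *\<^sub>R f" by (simp add: sgn_L2_def)
  show "dist f g = norm (f - g)" by (simp add: dist_L2_def)
  show "uniformity = (INF e\<in>{0<..}. principal {(f :: L2, g). dist f g < e})"
    by (rule uniformity_L2_def)
  show "open U \<longleftrightarrow> (\<forall>f\<in>U. eventually (\<lambda>(f', g). f' = f \<longrightarrow> g \<in> U) uniformity)" for U :: "L2 set"
    by (rule open_L2_def)
  show "f \<bullet> g = g \<bullet> f" by transfer (simp add: inner_commute)
  show "(f + g) \<bullet> h = f \<bullet> h + g \<bullet> h"
    by transfer (simp add: circle_eq_def inner_add_left square_integrable_inner)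
  show "(a *\<^sub>R f) \<bullet> g = a * (f \<bullet> g)" by transfer simp
  show "0 \<le> f \<bullet> f" by transfer (simp add: Bochner_Integration.integral_nonneg)
  show "f \<bullet> f = 0 \<longleftrightarrow> f = 0"
  proof transfer
    fix f assume f: "circle_eq f f"
    then have "(\<integral>z. f z \<bullet> f z \<partial>circle) = 0 \<longleftrightarrow> (AE z in circle. f z \<bullet> f z = 0)"
      by (intro integral_nonneg_eq_0_iff_AE)
        (auto simp: circle_eq_def intro: square_integrable_inner)
    then show "(\<integral>z. f z \<bullet> f z \<partial>circle) = 0 \<longleftrightarrow> circle_eq f (\<lambda>_. 0)"
      using f by (simp add: circle_eq_def square_integrable_zero)
  qed
  show "norm f = sqrt (f \<bullet> f)" by (rule norm_L2_def)
qed

end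

lemma L2_class_cases:
  obtains f where "square_integrable circle f" "F = L2_class f"
proof -
  have "\<exists>f. square_integrable circle f \<and> F = L2_class f"
    by transfer (auto simp: circle_eq_def)
  with that show ?thesis by blast
qed

lemma L2_class_eq_iff:
  assumes "square_integrable circle f" "square_integrable circle g"
  shows "L2_class f = L2_class g \<longleftrightarrow> (AE z in circle. f z = g z)"
  using assms by transfer (simp add: circle_eq_def)

lemma L2_class_diff:
  assumes "square_integrable circle f" "square_integrable circle g"
  shows "L2_class f - L2_class g = L2_class (\<lambda>z. f z - g z)"
  using assms by transfer (simp add: circle_eq_def square_integrable_diff)

lemma norm_L2_class:
  assumes "square_integrable circle f"
  shows "norm (L2_class f) = sqrt (\<integral>z. (cmod (f z))\<^sup>2 \<partial>circle)"
  unfolding norm_L2_def using assms by transfer (simp add: power2_norm_eq_inner)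

lemma nn_integral_L2_class:
  assumes "square_integrable circle f"
  shows "(\<integral>\<^sup>+z. ennreal ((cmod (f z))\<^sup>2) \<partial>circle) = ennreal ((norm (L2_class f))\<^sup>2)"
proof -
  have "0 \<le> (\<integral>z. (cmod (f z))\<^sup>2 \<partial>circle)" by simp
  then show ?thesis
    using assms by (simp add: norm_L2_class nn_integral_eq_integral square_integrable_def)
qed

lemma square_integrable_nn_integral:
  assumes "f \<in> borel_measurable circle" "(\<integral>\<^sup>+z. ennreal ((cmod (f z))\<^sup>2) \<partial>circle) < \<infinity>"
  shows "square_integrable circle f"
  using assms by (auto simp: square_integrable_def intro!: integrableI_bounded)

instance L2 :: complete_space
proof
  fix X :: "nat \<Rightarrow> L2" assume X: "Cauchy X"
  have "\<exists>M. \<forall>m\<ge>M. \<forall>n\<ge>M. dist (X m) (X n) < (1/2)^k" for k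
    using X by (simp add: Cauchy_def)
  then obtain M where M: "\<And>k m n. m \<ge> M k \<Longrightarrow> n \<ge> M k \<Longrightarrow> dist (X m) (X n) < (1/2)^k"
    by metis
  define r where "r k = k + (\<Sum>i\<le>k. M i)" for k
  have r_mono: "strict_mono r"
    by (rule strict_monoI_Suc) (simp add: r_def)
  have r_ge: "M k \<le> r k" for k
    by (simp add: r_def sum.remove[of "{..k}" k] trans_le_add2)
  have r_dist: "dist (X (r j)) (X (r k)) < (1/2)^j" if "j \<le> k" for j k
    using M[of j "r j" "r k"] r_ge[of j] strict_mono_leD[OF r_mono that] by simp
  have "\<exists>f. \<forall>k. square_integrable circle (f k) \<and> X (r k) = L2_class (f k)"
    using L2_class_cases by (intro choice) metis
  then obtain f where f: "\<And>k. square_integrable circle (f k)"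
    and Xf: "\<And>k. X (r k) = L2_class (f k)" by metis
  have [measurable]: "f k \<in> borel_measurable circle" for k
    using f by (rule square_integrable_measurable)
  have nn: "(\<integral>\<^sup>+z. ennreal ((cmod (f k z - f j z))\<^sup>2) \<partial>circle) \<le> ennreal (((1/2)^j)\<^sup>2)"
    if "j \<le> k" for j k
  proof -
    have "norm (L2_class (\<lambda>z. f k z - f j z)) \<le> (1/2)^j"
      using r_dist[OF that] by (subst (asm) dist_commute) (simp add: dist_norm Xf L2_class_diff[OF f f])
    then show ?thesis
      by (subst nn_integral_L2_class)
        (auto intro!: ennreal_leI power_mono square_integrable_diff f)
  qed
  have conv: "AE z in circle. convergent (\<lambda>k. f k z)"
  proof -
    define d where "d k z = 2^k * (cmod (f (Suc k) z - f k z))\<^sup>2" for k z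
    have [measurable]: "d k \<in> borel_measurable circle" for k
      unfolding d_def by measurable
    have d0: "0 \<le> d k z" for k z by (simp add: d_def)
    have "(\<integral>\<^sup>+z. ennreal (d k z) \<partial>circle) \<le> ennreal ((1/2)^k)" for k
    proof -
      have "(\<integral>\<^sup>+z. ennreal (d k z) \<partial>circle)
          = ennreal (2^k) * (\<integral>\<^sup>+z. ennreal ((cmod (f (Suc k) z - f k z))\<^sup>2) \<partial>circle)"
        unfolding d_def by (subst nn_integral_cmult[symmetric]) (auto simp: ennreal_mult)
      also have "\<dots> \<le> ennreal (2^k) * ennreal (((1/2)^k)\<^sup>2)"
        by (intro mult_left_mono nn) auto
      also have "\<dots> = ennreal ((1/2)^k)"
        by (simp add: ennreal_mult[symmetric] power2_eq_square power_one_over field_simps)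
      finally show ?thesis .
    qed
    then have "(\<Sum>k. \<integral>\<^sup>+z. ennreal (d k z) \<partial>circle) \<le> (\<Sum>k. ennreal ((1/2)^k))"
      by (intro suminf_le) auto
    also have "\<dots> = ennreal (\<Sum>k. (1/2)^k)"
      by (intro suminf_ennreal2) (auto intro: summable_geometric)
    finally have "(\<Sum>k. \<integral>\<^sup>+z. ennreal (d k z) \<partial>circle) < \<infinity>"
      by (simp add: le_less_trans)
    then have "(\<integral>\<^sup>+z. (\<Sum>k. ennreal (d k z)) \<partial>circle) \<noteq> \<infinity>"
      by (simp add: nn_integral_suminf)
    then have "AE z in circle. (\<Sum>k. ennreal (d k z)) \<noteq> \<infinity>"
      by (intro nn_integral_PInf_AE) auto
    then show ?thesis
    proof eventually_elim
      case (elim z)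
      then have "summable (\<lambda>k. d k z)"
        by (intro summable_suminf_not_top) (auto simp: d0)
      then have "summable (\<lambda>k. (1/2)^k + d k z)"
        by (intro summable_add summable_geometric) auto
      moreover have "norm (f (Suc k) z - f k z) \<le> (1/2)^k + d k z" for k
      proof -
        let ?a = "cmod (f (Suc k) z - f k z)"
        have "0 \<le> (2^k * ?a - 1)\<^sup>2 / 2^k" by simp
        also have "\<dots> = 2^k * ?a\<^sup>2 - 2 * ?a + (1/2)^k"
          by (simp add: power2_eq_square field_simps power_one_over)
        finally have "2 * ?a \<le> (1/2)^k + d k z" by (simp add: d_def)
        then show ?thesis using norm_ge_zero[of "f (Suc k) z - f k z"] by linarith
      qed
      ultimately have "summable (\<lambda>k. f (Suc k) z - f k z)"
        by (rule summable_comparison_test'[where N=0])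
      then have "convergent (\<lambda>n. \<Sum>k<n. f (Suc k) z - f k z)"
        by (simp add: summable_iff_convergent)
      then have "convergent (\<lambda>n. f n z - f 0 z)"
        by (simp add: sum_lessThan_telescope[of "\<lambda>k. f k z"])
      then show ?case
        using convergent_add[OF _ convergent_const[of "f 0 z"]] by fastforce
    qed
  qed
  define g where "g z = lim (\<lambda>k. f k z)" for z
  have [measurable]: "g \<in> borel_measurable circle"
    unfolding g_def by (rule borel_measurable_lim_metric) simp
  have g_nn: "(\<integral>\<^sup>+z. ennreal ((cmod (g z - f j z))\<^sup>2) \<partial>circle) \<le> ennreal (((1/2)^j)\<^sup>2)" for j
  proof -
    have "AE z in circle. ennreal ((cmod (g z - f j z))\<^sup>2)
        = liminf (\<lambda>k. ennreal ((cmod (f k z - f j z))\<^sup>2))"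
      using conv
    proof eventually_elim
      case (elim z)
      then have "(\<lambda>k. f k z) \<longlonglongrightarrow> g z"
        by (simp add: g_def convergent_LIMSEQ_iff)
      then have "(\<lambda>k. ennreal ((cmod (f k z - f j z))\<^sup>2)) \<longlonglongrightarrow> ennreal ((cmod (g z - f j z))\<^sup>2)"
        by (intro tendsto_intros)
      then show ?case
        by (rule lim_imp_Liminf[OF trivial_limit_sequentially, symmetric])
    qed
    then have "(\<integral>\<^sup>+z. ennreal ((cmod (g z - f j z))\<^sup>2) \<partial>circle)
        = (\<integral>\<^sup>+z. liminf (\<lambda>k. ennreal ((cmod (f k z - f j z))\<^sup>2)) \<partial>circle)"
      by (rule nn_integral_cong_AE)
    also have "\<dots> \<le> liminf (\<lambda>k. \<integral>\<^sup>+z. ennreal ((cmod (f k z - f j z))\<^sup>2) \<partial>circle)"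
      by (rule nn_integral_liminf) measurable
    also have "\<dots> \<le> liminf (\<lambda>k::nat. ennreal (((1/2)^j)\<^sup>2))"
      by (intro Liminf_mono eventually_sequentiallyI[of j] nn)
    also have "\<dots> = ennreal (((1/2)^j)\<^sup>2)"
      by (simp add: Liminf_const)
    finally show ?thesis .
  qed
  have gf: "square_integrable circle (\<lambda>z. g z - f j z)" for j
    using g_nn[of j] by (intro square_integrable_nn_integral) (auto simp: le_less_trans)
  have g: "square_integrable circle g"
    using square_integrable_add[OF gf[of 0] f[of 0]] by simp
  have "norm (L2_class g - X (r j)) \<le> (1/2)^j" for j
  proof -
    have "ennreal ((norm (L2_class g - X (r j)))\<^sup>2) \<le> ennreal (((1/2)^j)\<^sup>2)"
      using g_nn[of j] by (simp add: Xf L2_class_diff g f nn_integral_L2_class gf)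
    then have "(norm (L2_class g - X (r j)))\<^sup>2 \<le> ((1/2)^j)\<^sup>2"
      by (subst (asm) ennreal_le_iff) auto
    then show ?thesis
      by (rule power2_le_imp_le) simp
  qed
  moreover have "(\<lambda>j. (1/2)^j :: real) \<longlonglongrightarrow> 0"
    by (rule LIMSEQ_power_zero) simp
  ultimately have "(\<lambda>j. L2_class g - X (r j)) \<longlonglongrightarrow> 0"
    by (intro Lim_null_comparison[of "\<lambda>j. L2_class g - X (r j)"]) auto
  then have "(X \<circ> r) \<longlonglongrightarrow> L2_class g"
    using tendsto_diff[OF tendsto_const[of "L2_class g"], of "\<lambda>j. L2_class g - X (r j)" 0 sequentially]
    by (simp add: o_def)
  with X r_mono show "convergent X"
    using Cauchy_converges_subseq convergentI by blast
qed

instance L2 :: banach ..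

lemma L2_class_tendsto:
  assumes f: "square_integrable circle f" and g: "\<And>n::nat. square_integrable circle (g n)"
    and w: "integrable circle w" and b: "\<And>n z. (cmod (g n z - f z))\<^sup>2 \<le> w z"
    and l: "AE z in circle. (\<lambda>n. g n z) \<longlonglongrightarrow> f z"
  shows "(\<lambda>n. L2_class (g n)) \<longlonglongrightarrow> L2_class f"
proof -
  have [measurable]: "f \<in> borel_measurable circle" "g n \<in> borel_measurable circle" for n
    using f g square_integrable_measurable by blast+
  have "(\<lambda>n. \<integral>z. (cmod (g n z - f z))\<^sup>2 \<partial>circle) \<longlonglongrightarrow> (\<integral>z. 0 \<partial>circle)"
  proof (rule integral_dominated_convergence[OF _ _ w])
    show "AE z in circle. (\<lambda>n. (cmod (g n z - f z))\<^sup>2) \<longlonglongrightarrow> 0"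
      using l
    proof eventually_elim
      case (elim z)
      then have "(\<lambda>n. (cmod (g n z - f z))\<^sup>2) \<longlonglongrightarrow> (cmod (f z - f z))\<^sup>2"
        by (intro tendsto_intros)
      then show ?case by simp
    qed
  qed (use b in auto)
  then have "(\<lambda>n. sqrt (\<integral>z. (cmod (g n z - f z))\<^sup>2 \<partial>circle)) \<longlonglongrightarrow> sqrt 0"
    by (intro tendsto_real_sqrt) simp
  then have "(\<lambda>n. norm (L2_class (g n) - L2_class f)) \<longlonglongrightarrow> 0"
    by (simp add: L2_class_diff f g norm_L2_class square_integrable_diff)
  then show ?thesis
    by (simp add: LIM_zero_iff tendsto_norm_zero_iff)
qed

lemma square_integrable_bounded:
  assumes "f \<in> borel_measurable circle" "\<And>z. cmod (f z) \<le> B"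
  shows "square_integrable circle f"
proof -
  have "(cmod (f z))\<^sup>2 \<le> B\<^sup>2" for z
    using assms(2) by (simp add: power_mono)
  then have "integrable circle (\<lambda>z. (cmod (f z))\<^sup>2)"
    using assms(1) by (intro circle.integrable_const_bound[where B="B\<^sup>2"]) auto
  with assms(1) show ?thesis by (simp add: square_integrable_def)
qed

lemma Arg_measurable: "Arg \<in> borel_measurable borel"
proof -
  have "(\<lambda>z. if z \<in> - \<real>\<^sub>\<le>\<^sub>0 then Arg z else (if z = 0 then 0 else pi)) \<in> borel_measurable borel"
  proof (subst measurable_If_restrict_space_iff)
    have "open (- \<real>\<^sub>\<le>\<^sub>0 :: complex set)"
      by (simp add: open_Compl)
    then show "{z \<in> space borel. z \<in> - \<real>\<^sub>\<le>\<^sub>0} \<in> sets (borel :: complex measure)"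
      by (simp flip: Compl_eq)
    have "Arg \<in> borel_measurable (restrict_space borel {z. z \<in> - \<real>\<^sub>\<le>\<^sub>0})"
      by (intro borel_measurable_continuous_on_restrict continuous_at_imp_continuous_on)
        (auto intro: continuous_at_Arg)
    moreover have "(\<lambda>z::complex. if z = 0 then 0 else pi)
        \<in> borel_measurable (restrict_space borel {z. z \<notin> - \<real>\<^sub>\<le>\<^sub>0})"
      by (rule measurable_restrict_space1) simp
    ultimately show "Arg \<in> borel_measurable (restrict_space borel {z. z \<in> - \<real>\<^sub>\<le>\<^sub>0}) \<and>
        (\<lambda>z::complex. if z = 0 then 0 else pi)
          \<in> borel_measurable (restrict_space borel {z. z \<notin> - \<real>\<^sub>\<le>\<^sub>0})"
      by blast
  qed
  also have "(\<lambda>z. if z \<in> - \<real>\<^sub>\<le>\<^sub>0 then Arg z else (if z = 0 then 0 else pi)) = Arg"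
  proof
    fix z :: complex
    show "(if z \<in> - \<real>\<^sub>\<le>\<^sub>0 then Arg z else (if z = 0 then 0 else pi)) = Arg z"
      using Arg_eq_pi[of z]
      by (cases "z = 0")
        (simp_all add: Arg_zero complex_nonpos_Reals_iff, auto simp: complex_eq_iff)
  qed
  finally show ?thesis .
qed

text \<open>A countable family of step functions, used for separability.\<close>

definition step_fun :: "nat \<Rightarrow> complex list \<Rightarrow> complex \<Rightarrow> complex"
  where "step_fun N cs z =
    (let k = nat \<lfloor>real N * (Arg z + pi)\<rfloor> in if k < length cs then cs ! k else 0)"

lemma step_fun_measurable: "step_fun N cs \<in> borel_measurable circle"
proof -
  have "(\<lambda>z. \<lfloor>real N * (Arg z + pi)\<rfloor>) \<in> circle \<rightarrow>\<^sub>M count_space UNIV"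
    using Arg_measurable by simp
  then have "(\<lambda>k. if nat k < length cs then cs ! nat k else 0) \<circ> (\<lambda>z. \<lfloor>real N * (Arg z + pi)\<rfloor>)
      \<in> borel_measurable circle"
    by (rule measurable_comp) simp
  then show ?thesis by (simp add: step_fun_def[abs_def] o_def Let_def)
qed

lemma square_integrable_step_fun: "square_integrable circle (step_fun N cs)"
proof (rule square_integrable_bounded[OF step_fun_measurable])
  show "cmod (step_fun N cs z) \<le> (\<Sum>c\<leftarrow>cs. cmod c)" for z
    by (auto simp: step_fun_def Let_def intro!: member_le_sum_list sum_list_nonneg)
qed

lemma step_fun_dense:
  fixes g :: "real \<Rightarrow> complex"
  assumes g: "continuous_on UNIV g" and e: "0 < e"
    and D: "\<And>U. open U \<Longrightarrow> U \<noteq> {} \<Longrightarrow> \<exists>d\<in>D. d \<in> U"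
  shows "\<exists>N. \<exists>cs\<in>lists D. \<forall>x\<in>{-pi<..pi}. cmod (step_fun N cs (cis x) - g x) < e"
proof -
  have "uniformly_continuous_on {-pi..pi} g"
    using g by (intro compact_uniformly_continuous) (auto intro: continuous_on_subset)
  then obtain d where d: "d > 0"
    "\<And>x y. x \<in> {-pi..pi} \<Longrightarrow> y \<in> {-pi..pi} \<Longrightarrow> dist y x < d \<Longrightarrow> dist (g y) (g x) < e/2"
    using e by (metis half_gt_zero uniformly_continuous_on_def)
  obtain N where N: "N > 0" "1 / real N < d"
    using d(1) real_arch_inverse[of d] by (metis gr0I inverse_eq_divide)
  have "\<exists>c\<in>D. dist (g (real k / real N - pi)) c < e/2" for k
    using D[of "ball (g (real k / real N - pi)) (e/2)"] e by auto
  then obtain c where c: "\<And>k. c k \<in> D" "\<And>k. dist (g (real k / real N - pi)) (c k) < e/2"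
    by metis
  define K where "K = nat \<lfloor>real N * (2 * pi)\<rfloor> + 1"
  have "cmod (step_fun N (map c [0..<K]) (cis x) - g x) < e" if x: "x \<in> {-pi<..pi}" for x
  proof -
    define k where "k = nat \<lfloor>real N * (x + pi)\<rfloor>"
    have Arg: "Arg (cis x) = x"
      using x by (intro cis_Arg_unique) auto
    have k: "real k \<le> real N * (x + pi)" "real N * (x + pi) < real k + 1"
      using x by (auto simp: k_def of_nat_nat)
    have kK: "k < K"
    proof -
      have "real N * (x + pi) \<le> real N * (2 * pi)"
        using x by (intro mult_left_mono) auto
      then have "\<lfloor>real N * (x + pi)\<rfloor> \<le> \<lfloor>real N * (2 * pi)\<rfloor>" by (rule floor_mono)
      then show ?thesis by (simp add: k_def K_def)
    qed
    have y: "real k / real N \<le> x + pi" "x + pi < real k / real N + 1 / real N"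
      using k N by (auto simp: field_simps)
    have "dist (g (real k / real N - pi)) (g x) < e/2"
    proof (rule d(2))
      show "real k / real N - pi \<in> {-pi..pi}" using y x by auto
      show "dist (real k / real N - pi) x < d"
        using y N(2) by (auto simp: dist_real_def)
    qed (use x in auto)
    moreover have "step_fun N (map c [0..<K]) (cis x) = c k"
      using kK by (simp add: step_fun_def Arg Let_def flip: k_def)
    ultimately show ?thesis
      using c(2)[of k] dist_triangle_half_r[of "g (real k / real N - pi)" "c k" e "g x"]
      by (simp add: dist_norm)
  qed
  moreover have "map c [0..<K] \<in> lists D" using c(1) by auto
  ultimately show ?thesis by blast
qed

lemma L2_separable: "\<exists>D::L2 set. countable D \<and> closure D = UNIV"
proof -
  obtain C :: "complex set" where C: "countable C" "\<And>U. open U \<Longrightarrow> U \<noteq> {} \<Longrightarrow> \<exists>d\<in>C. d \<in> U"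
    by (rule countable_dense_setE) blast
  define D where "D = (\<lambda>(N, cs). L2_class (step_fun N cs)) ` (UNIV \<times> lists C)"
  have "countable D"
    using C(1) by (auto simp: D_def)
  moreover have bdd: "L2_class f \<in> closure D"
    if f [measurable]: "f \<in> borel_measurable circle" and B: "\<And>z. cmod (f z) \<le> B" for f B
  proof -
    have B0: "0 \<le> B" using B[of 0] norm_ge_zero order_trans by blast
    have fb: "f \<in> borel_measurable borel" using f by simp
    have "(\<lambda>x. f (cis x)) \<in> borel_measurable lborel"
      using measurable_compose[OF _ fb, of cis lborel]
      by (simp add: borel_measurable_continuous_onI continuous_on_cis continuous_on_id)
    then have "(\<lambda>x. f (cis x)) measurable_on UNIV"
      by (intro lebesgue_measurable_imp_measurable_on) (auto intro: measurable_completion)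
    then obtain Z g where Z: "negligible Z" and g: "\<And>n. continuous_on UNIV (g n)"
      and lim: "\<And>x. x \<notin> Z \<Longrightarrow> (\<lambda>n. g n x) \<longlonglongrightarrow> f (cis x)"
      by (auto simp: measurable_on_def)
    define p where "p = closest_point (cball (0::complex) B)"
    have p: "continuous_on UNIV p" "\<And>z. cmod (p z) \<le> B" "\<And>z. cmod z \<le> B \<Longrightarrow> p z = z"
      using B0 closest_point_in_set[of "cball (0::complex) B"]
      by (auto simp: p_def intro!: continuous_on_closest_point closest_point_self)
    have pg: "continuous_on UNIV (\<lambda>x. p (g n x))" for n
      using continuous_on_compose2[OF p(1) g] by simp
    have "\<exists>N. \<exists>cs\<in>lists C. \<forall>x\<in>{-pi<..pi}. cmod (step_fun N cs (cis x) - p (g n x)) < 1 / Suc n" for n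
      by (rule step_fun_dense[OF pg _ C(2)]) auto
    then obtain N cs where cs: "\<And>n. cs n \<in> lists C" and
      h: "\<And>n x. x \<in> {-pi<..pi} \<Longrightarrow> cmod (step_fun (N n) (cs n) (cis x) - p (g n x)) < 1 / Suc n"
      by metis
    define h where "h n z = (if z \<in> sphere 0 1 then step_fun (N n) (cs n) z else 0)" for n z
    have AE_sphere: "AE z in circle. z \<in> sphere 0 1"
      by (subst AE_circle) auto
    have hm [measurable]: "h n \<in> borel_measurable circle" for n
      using step_fun_measurable[of "N n" "cs n"] by (simp add: h_def[abs_def])
    have hb: "cmod (h n z) \<le> B + 1" for n z
    proof (cases "z \<in> sphere 0 1")
      case True
      then have z: "cis (Arg z) = z" "Arg z \<in> {-pi<..pi}"
        using Arg_bounded[of z] cis_Arg[of z] by (cases "z = 0"; auto simp: sgn_div_norm)+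
      have "cmod (h n z) \<le> cmod (p (g n (Arg z))) + 1 / Suc n"
        using h[OF z(2), of n] True norm_triangle_sub[of "h n z" "p (g n (Arg z))"]
        by (simp add: h_def z(1))
      also have "\<dots> \<le> B + 1" using p(2) by (intro add_mono) auto
      finally show ?thesis .
    qed (use B0 in \<open>auto simp: h_def\<close>)
    have hlim: "AE z in circle. (\<lambda>n. h n z) \<longlonglongrightarrow> f z"
    proof (subst AE_circle)
      show "{z. (\<lambda>n. h n z) \<longlonglongrightarrow> f z} \<in> sets borel"
      proof -
        have "(\<lambda>n. h n z) \<longlonglongrightarrow> f z \<longleftrightarrow> (\<forall>k. \<exists>M. \<forall>n\<ge>M. cmod (h n z - f z) < 1 / real (Suc k))" for z
        proof
          assume "(\<lambda>n. h n z) \<longlonglongrightarrow> f z"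
          then show "\<forall>k. \<exists>M. \<forall>n\<ge>M. cmod (h n z - f z) < 1 / real (Suc k)"
            unfolding LIMSEQ_def dist_norm by (auto simp del: of_nat_Suc)
        next
          assume *: "\<forall>k. \<exists>M. \<forall>n\<ge>M. cmod (h n z - f z) < 1 / real (Suc k)"
          show "(\<lambda>n. h n z) \<longlonglongrightarrow> f z"
          proof (rule LIMSEQ_I)
            fix e :: real assume "0 < e"
            then obtain k where k: "1 / real (Suc k) < e"
              using reals_Archimedean[of e] by (auto simp: inverse_eq_divide)
            from * obtain M where "\<forall>n\<ge>M. cmod (h n z - f z) < 1 / real (Suc k)" by blast
            with k show "\<exists>M. \<forall>n\<ge>M. cmod (h n z - f z) < e"
              using order.strict_trans by blast
          qed
        qed
        moreover have "{z \<in> space borel. \<forall>k. \<exists>M. \<forall>n\<ge>M. cmod (h n z - f z) < 1 / real (Suc k)} \<in> sets borel"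
          using hm fb by simp
        ultimately show ?thesis by simp
      qed
      have "AE x in lborel. x \<notin> Z"
        using Z AE_not_in[of Z lebesgue] by (simp add: negligible_iff_null_sets AE_completion_iff)
      then show "AE x in lborel. x \<in> {-pi<..pi} \<longrightarrow> (\<lambda>n. h n (cis x)) \<longlonglongrightarrow> f (cis x)"
      proof eventually_elim
        case (elim x)
        show ?case
        proof
          assume x: "x \<in> {-pi<..pi}"
          have "(\<lambda>n. p (g n x)) \<longlonglongrightarrow> p (f (cis x))"
            using continuous_on_tendsto_compose[OF p(1) lim[OF elim]] by simp
          then have "(\<lambda>n. p (g n x)) \<longlonglongrightarrow> f (cis x)"
            by (simp add: p(3) B)
          moreover have "(\<lambda>n. h n (cis x) - p (g n x)) \<longlonglongrightarrow> 0"
          proof (rule Lim_null_comparison)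
            show "\<forall>\<^sub>F n in sequentially. norm (h n (cis x) - p (g n x)) \<le> 1 / real (Suc n)"
              using h[OF x] by (simp add: h_def less_imp_le)
            show "(\<lambda>n. 1 / real (Suc n)) \<longlonglongrightarrow> 0"
              using LIMSEQ_inverse_real_of_nat by (simp add: inverse_eq_divide)
          qed
          ultimately show "(\<lambda>n. h n (cis x)) \<longlonglongrightarrow> f (cis x)"
            using tendsto_add by fastforce
        qed
      qed
    qed
    have fs: "square_integrable circle f" and hs: "square_integrable circle (h n)" for n
      using square_integrable_bounded f B hm hb by blast+
    have "(\<lambda>n. L2_class (h n)) \<longlonglongrightarrow> L2_class f"
    proof (rule L2_class_tendsto[OF fs hs _ _ hlim])
      show "integrable circle (\<lambda>_. (B + 1 + B)\<^sup>2)" by simp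
      show "(cmod (h n z - f z))\<^sup>2 \<le> (B + 1 + B)\<^sup>2" for n z
        by (intro power_mono order_trans[OF norm_triangle_ineq4] add_mono hb B) auto
    qed
    moreover have "L2_class (h n) \<in> D" for n
    proof -
      have "L2_class (h n) = L2_class (step_fun (N n) (cs n))"
        unfolding L2_class_eq_iff[OF hs square_integrable_step_fun]
        using AE_sphere by eventually_elim (simp add: h_def)
      then show ?thesis
        using cs unfolding D_def by (auto intro!: image_eqI[of _ _ "(N n, cs n)"])
    qed
    ultimately show ?thesis
      unfolding closure_sequential by (intro exI[of _ "\<lambda>n. L2_class (h n)"]) simp
  qed
  moreover have "F \<in> closure D" for F
  proof -
    obtain f where f: "square_integrable circle f" and F: "F = L2_class f"
      by (rule L2_class_cases)
    have [measurable]: "f \<in> borel_measurable circle" using f by (rule square_integrable_measurable)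
    define g where "g n z = (if cmod (f z) \<le> real n then f z else 0)" for n z
    have gm: "g n \<in> borel_measurable circle" and gb: "cmod (g n z) \<le> real n" for n z
      by (auto simp: g_def[abs_def])
    have "(\<lambda>n. L2_class (g n)) \<longlonglongrightarrow> F"
      unfolding F
    proof (rule L2_class_tendsto[OF f square_integrable_bounded[OF gm gb]])
      show "integrable circle (\<lambda>z. (cmod (f z))\<^sup>2)" using f by (simp add: square_integrable_def)
      show "(cmod (g n z - f z))\<^sup>2 \<le> (cmod (f z))\<^sup>2" for n z by (simp add: g_def)
      have "(\<lambda>n. g n z) \<longlonglongrightarrow> f z" for z
      proof (rule tendsto_eventually)
        obtain n where "cmod (f z) \<le> real n" using real_arch_simple by blast
        then show "\<forall>\<^sub>F n in sequentially. g n z = f z"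
          by (intro eventually_sequentiallyI[of n]) (simp add: g_def)
      qed
      then show "AE z in circle. (\<lambda>n. g n z) \<longlonglongrightarrow> f z" by simp
    qed
    moreover have "L2_class (g n) \<in> closure D" for n by (rule bdd[OF gm gb])
    ultimately show ?thesis
      using closed_sequentially[OF closed_closure, of "\<lambda>n. L2_class (g n)" D F] by simp
  qed
  ultimately show ?thesis by (intro exI[of _ D]) auto
qed

instance L2 :: second_countable_topology
proof
  obtain D :: "L2 set" where D: "countable D" "closure D = UNIV"
    using L2_separable by blast
  define B where "B = (\<lambda>(d, n). ball d (1 / real (Suc n))) ` (D \<times> UNIV)"
  have "topological_basis B"
  proof (rule topological_basisI)
    show "open U" if "U \<in> B" for U using that by (auto simp: B_def)
    fix U and f :: L2 assume "open U" "f \<in> U"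
    then obtain e where e: "e > 0" "ball f e \<subseteq> U" using open_contains_ball by blast
    obtain n where n: "1 / real (Suc n) < e / 2"
      using e(1) reals_Archimedean[of "e/2"] by (auto simp: inverse_eq_divide)
    have "\<forall>r>0. \<exists>d\<in>D. dist d f < r"
      using D(2) closure_approachable[of f D] by simp
    moreover have "1 / real (Suc n) > 0" by simp
    ultimately obtain d where d: "d \<in> D" "dist d f < 1 / real (Suc n)" by blast
    have "ball d (1 / real (Suc n)) \<subseteq> ball f e"
    proof
      fix g assume "g \<in> ball d (1 / real (Suc n))"
      then show "g \<in> ball f e"
        using d(2) n dist_triangle[of f g d] by (simp add: dist_commute[of f d])
    qed
    moreover have "ball d (1 / real (Suc n)) \<in> B"
      using d(1) unfolding B_def by (auto intro!: image_eqI[of _ _ "(d, n)"])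
    ultimately show "\<exists>V\<in>B. f \<in> V \<and> V \<subseteq> U"
      using d(2) e(2) by (intro bexI[of _ "ball d (1 / real (Suc n))"]) auto
  qed
  moreover have "countable B" using D(1) by (simp add: B_def)
  ultimately show "\<exists>B::L2 set set. countable B \<and> open = generate_topology B"
    by (intro exI[of _ B] conjI topological_basis_imp_subbasis)
qed

section \<open>Fourier series, the Riesz projector and the semigroup\<close>

lift_definition conj_L2 :: "L2 \<Rightarrow> L2" is "\<lambda>f z. cnj (f z)"
  unfolding circle_eq_def by (auto intro: square_integrable_cnj elim!: AE_mp)

lemma power_int_measurable: "(\<lambda>z::complex. z powi n) \<in> borel_measurable borel"
proof (cases "0 \<le> n")
  case True
  then show ?thesis by (simp add: power_int_def)
next
  case False
  then show ?thesis by (simp add: power_int_def)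
qed

lift_definition fourier_coeff :: "L2 \<Rightarrow> int \<Rightarrow> complex" is
  "\<lambda>f n. \<integral>z. f z * z powi (- n) \<partial>circle"
proof (rule ext)
  fix f g n assume fg: "circle_eq f g"
  then have [measurable]: "f \<in> borel_measurable circle" "g \<in> borel_measurable circle"
    by (auto simp: circle_eq_def square_integrable_def)
  have [measurable]: "(\<lambda>z. z powi (- n)) \<in> borel_measurable circle"
    using power_int_measurable by simp
  have "AE z in circle. f z = g z" using fg by (simp add: circle_eq_def)
  then show "(\<integral>z. f z * z powi (- n) \<partial>circle) = (\<integral>z. g z * z powi (- n) \<partial>circle)"
    by (intro integral_cong_AE) auto
qed

text \<open>Sums over \<open>int\<close> are unconditional sums in \<open>L2\<close>, with \<open>z powi n\<close> being \<open>cis (n * x)\<close>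
  at \<open>z = cis x\<close>.\<close>

definition riesz_proj :: "L2 \<Rightarrow> L2"
  where "riesz_proj f = (\<Sum>\<^sub>\<infinity>n\<in>{0..}. L2_class (\<lambda>z. fourier_coeff f n * z powi n))"

definition H2 :: "L2 set"
  where "H2 = range riesz_proj"

definition half_heat :: "real \<Rightarrow> L2 \<Rightarrow> L2"
  where "half_heat t f = (\<Sum>\<^sub>\<infinity>n. L2_class (\<lambda>z.
    fourier_coeff f n * of_real (exp (- \<bar>of_int n\<bar> * t)) * z powi n))"

section \<open>Null-controllable initial data\<close>

definition open_strict_interval :: "complex set \<Rightarrow> bool"
  where "open_strict_interval \<omega> \<longleftrightarrow>
    (\<exists>a b. 0 < b - a \<and> b - a < 2 * pi \<and> \<omega> = cis ` {a<..<b})"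

text \<open>Controls are functions on \<open>{0..T} \<times> \<omega>\<close>; their values elsewhere are irrelevant.\<close>

definition control :: "complex set \<Rightarrow> real \<Rightarrow> (real \<times> complex \<Rightarrow> complex) \<Rightarrow> bool"
  where "control \<omega> T u \<longleftrightarrow>
    square_integrable (restrict_space (lborel \<Otimes>\<^sub>M circle) ({0..T} \<times> \<omega>)) u"

text \<open>\<open>extend_zero \<omega> u s\<close> is the extension by 0 of \<open>u(s, \<cdot>)\<close>. For a control \<open>u\<close> it is
  square integrable for almost every \<open>s\<close>; at the other \<open>s\<close>, \<open>L2_class\<close> gives 0.\<close>

definition extend_zero :: "complex set \<Rightarrow> (real \<times> complex \<Rightarrow> complex) \<Rightarrow> real \<Rightarrow> L2"
  where "extend_zero \<omega> u s = L2_class (\<lambda>z. if z \<in> \<omega> then u (s, z) else 0)"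

text \<open>The solution at time \<open>t\<close> with initial datum \<open>f\<^sub>0\<close> and source term \<open>g\<close>; the integral is
  the Bochner integral in \<open>L2\<close>.\<close>

definition mild_solution :: "L2 \<Rightarrow> (real \<Rightarrow> L2) \<Rightarrow> real \<Rightarrow> L2"
  where "mild_solution f\<^sub>0 g t = half_heat t f\<^sub>0 + (LINT s:{0..t}|lborel. half_heat (t - s) (g s))"

definition NC_L2 :: "complex set \<Rightarrow> real \<Rightarrow> L2 set"
  where "NC_L2 \<omega> T =
    {f\<^sub>0. \<exists>u. control \<omega> T u \<and> mild_solution f\<^sub>0 (extend_zero \<omega> u) T = 0}"

definition NC_H2 :: "complex set \<Rightarrow> real \<Rightarrow> L2 set"
  where "NC_H2 \<omega> T =
    {f\<^sub>0 \<in> H2. \<exists>u. control \<omega> T u \<and>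
      mild_solution f\<^sub>0 (\<lambda>s. riesz_proj (extend_zero \<omega> u s)) T = 0}"

end

(* Both control problems are moment problems for u against exp (-|n| (T - s)) z^(-n) on [0,T] x omega:
   for all n in the L2 system, for n >= 0 in the H2 system. Conjugation exchanges n and -n, so one has
   to glue a control u1 with the right moments for n >= 0 and a control u2 with the right moments for
   n <= 0. In the coordinate zeta = s - T + i x the set [0,T] x omega is a rectangle, and the test
   functions are exp (n zeta) and their conjugates. Friedrichs' inequality on the rectangle,
   min_c |F - c| <= C |F + conj G| in L^2 for F and G holomorphic, says that the holomorphic and the
   antiholomorphic test functions are in direct sum up to constants. As u1 and u2 have the same moment
   of order 0, the functional F + conj G |-> <u1 - u2, F> is therefore bounded, and a function v
   representing it gives the control u2 + v. *)

theory Submission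
  imports Defs "HOL-Complex_Analysis.Cauchy_Integral_Formula"
begin

text \<open>Constants are at once holomorphic and antiholomorphic, so the two families of test
  functions always meet; the common moment of order 0 makes this overlap harmless. Modulo constants
  the families must form a positive angle, and on a rectangle this is Friedrichs' inequality. Its
  source is that \<open>((F z)^2 - (F 0)^2) / z\<close> has a removable singularity, so its integral
  over every rectangle around 0 vanishes. When \<open>F 0\<close> is real, each side yields a bound
  of (Im F)^2 by (Re F)^2, and integration over the dilation factor turns these into an inequality
  for areas. This is why the rectangle is centred at 0. The test functions are polynomials in exp
  zeta, hence entire, so regularity at the boundary never becomes an issue, and the constant depends
  only on T and the length of the arc. \<open>L2\<close> carries a real inner product only, so the
  functional to be represented is real linear; a complex moment is recovered by pairing it with
  every complex number.\<close>

section \<open>Friedrichs' inequality on a rectangle\<close>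

text \<open>This is the integrand of the contour integral at the point
  \<open>Complex \<alpha> y\<close> of a side, with \<open>F = u + i v\<close> there. Completing a
  square absorbs the cross term \<open>2 * u * v * y\<close> and still leaves a negative multiple of
  \<open>v\<^sup>2\<close> on the right. The number \<open>w\<close> stands for the real value
  \<open>F 0\<close>, whose square enters with the favourable sign.\<close>

lemma friedrichs_pointwise:
  fixes u v w \<alpha> \<beta> y :: real
  assumes "0 < \<alpha>" "\<bar>y\<bar> \<le> \<beta>"
  shows "Re ((Complex u v ^ 2 - of_real (w\<^sup>2)) / Complex \<alpha> y)
    \<le> (2 * u\<^sup>2 - \<alpha>\<^sup>2 / (2 * (\<alpha>\<^sup>2 + \<beta>\<^sup>2)) * v\<^sup>2) / \<alpha>"
proof -
  let ?d = "\<alpha>\<^sup>2 / (2 * (\<alpha>\<^sup>2 + \<beta>\<^sup>2))"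
  have pos: "0 < \<alpha>\<^sup>2 + y\<^sup>2" using assms(1) by (simp add: add_pos_nonneg)
  have posb: "0 < \<alpha>\<^sup>2 + \<beta>\<^sup>2" using assms(1) by (simp add: add_pos_nonneg)
  have "y\<^sup>2 \<le> \<beta>\<^sup>2" using assms(2) by (metis abs_ge_zero power2_abs power_mono)
  \<comment> \<open>The factor \<open>?d\<close> is chosen to spend at most half of the available
    \<open>v\<^sup>2 * \<alpha>\<^sup>2\<close>; the other half completes the square below.\<close>
  then have "?d * (\<alpha>\<^sup>2 + y\<^sup>2) \<le> ?d * (\<alpha>\<^sup>2 + \<beta>\<^sup>2)" by (intro mult_left_mono) auto
  also have "\<dots> = \<alpha>\<^sup>2 / 2" using posb by (simp add: divide_simps)
  finally have d: "v\<^sup>2 * (?d * (\<alpha>\<^sup>2 + y\<^sup>2)) \<le> v\<^sup>2 * (\<alpha>\<^sup>2 / 2)" by (intro mult_left_mono) auto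
  have "0 \<le> (2 * u * y - v * \<alpha>)\<^sup>2 / 2 + w\<^sup>2 * \<alpha>\<^sup>2 + u\<^sup>2 * \<alpha>\<^sup>2" by simp
  also have "\<dots> = 2 * u\<^sup>2 * (\<alpha>\<^sup>2 + y\<^sup>2) - v\<^sup>2 * (\<alpha>\<^sup>2 / 2)
      - ((u\<^sup>2 - v\<^sup>2 - w\<^sup>2) * \<alpha> + 2 * u * v * y) * \<alpha>"
    by (simp add: power2_eq_square field_simps)
  also have "\<dots> \<le> 2 * u\<^sup>2 * (\<alpha>\<^sup>2 + y\<^sup>2) - v\<^sup>2 * (?d * (\<alpha>\<^sup>2 + y\<^sup>2))
      - ((u\<^sup>2 - v\<^sup>2 - w\<^sup>2) * \<alpha> + 2 * u * v * y) * \<alpha>"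
    using d by linarith
  finally have "((u\<^sup>2 - v\<^sup>2 - w\<^sup>2) * \<alpha> + 2 * u * v * y) * \<alpha> \<le> (2 * u\<^sup>2 - ?d * v\<^sup>2) * (\<alpha>\<^sup>2 + y\<^sup>2)"
    by (simp add: algebra_simps)
  then have "((u\<^sup>2 - v\<^sup>2 - w\<^sup>2) * \<alpha> + 2 * u * v * y) / (\<alpha>\<^sup>2 + y\<^sup>2) \<le> (2 * u\<^sup>2 - ?d * v\<^sup>2) / \<alpha>"
    using assms(1) pos by (simp only: pos_divide_le_eq pos_le_divide_eq times_divide_eq_left)
  moreover have "Re ((Complex u v ^ 2 - of_real (w\<^sup>2)) / Complex \<alpha> y)
      = ((u\<^sup>2 - v\<^sup>2 - w\<^sup>2) * \<alpha> + 2 * u * v * y) / (\<alpha>\<^sup>2 + y\<^sup>2)"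
    by (simp add: Re_divide power2_eq_square complex_mult)
  ultimately show ?thesis by simp
qed

text \<open>Along the side \<open>z = e * r * Complex \<alpha> y\<close> the form dz / z equals i dy
  / (\<alpha> + i y): the rotation \<open>e\<close> and the dilation \<open>r\<close> cancel. So the
  increment of \<open>Im P\<close> is the integral of the real part estimated in
  \<open>friedrichs_pointwise\<close>.\<close>

lemma friedrichs_side:
  fixes F P :: "complex \<Rightarrow> complex" and e :: complex and \<alpha> \<beta> r w :: real
  assumes F: "continuous_on UNIV F"
    and P: "\<And>z. z \<noteq> 0 \<Longrightarrow> (P has_field_derivative ((F z)\<^sup>2 - of_real (w\<^sup>2)) / z) (at z)"
    and "e \<noteq> 0" "0 < \<alpha>" "0 < \<beta>" "0 < r"
  shows "Im (P (e * r * Complex \<alpha> \<beta>)) - Im (P (e * r * Complex \<alpha> (- \<beta>)))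
    \<le> (2 * integral {-\<beta>..\<beta>} (\<lambda>y. (Re (F (e * r * Complex \<alpha> y)))\<^sup>2)
      - \<alpha>\<^sup>2 / (2 * (\<alpha>\<^sup>2 + \<beta>\<^sup>2)) * integral {-\<beta>..\<beta>} (\<lambda>y. (Im (F (e * r * Complex \<alpha> y)))\<^sup>2)) / \<alpha>"
proof -
  define d where "d = \<alpha>\<^sup>2 / (2 * (\<alpha>\<^sup>2 + \<beta>\<^sup>2))"
  define z where "z y = e * r * Complex \<alpha> y" for y
  have z0: "z y \<noteq> 0" for y using assms by (simp add: z_def) (simp add: complex_eq_iff)
  have zc: "z = (\<lambda>y. e * r * (of_real \<alpha> + \<i> * of_real y))"
    by (auto simp: z_def complex_eq_iff)
  have dz: "(z has_vector_derivative e * r * \<i>) (at y within S)" for y S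
    unfolding zc by (auto intro!: derivative_eq_intros simp: has_vector_derivative_def scaleR_conv_of_real algebra_simps)
  have contz: "continuous_on S z" for S unfolding zc by (intro continuous_intros)
  have contF: "continuous_on S (\<lambda>y. F (z y))" for S
    using continuous_on_compose2[OF F contz] by auto
  have "((\<lambda>y. (e * r * \<i>) * (((F (z y))\<^sup>2 - of_real (w\<^sup>2)) / z y)) has_integral (P (z \<beta>) - P (z (-\<beta>)))) {-\<beta>..\<beta>}"
  proof (rule fundamental_theorem_of_calculus)
    fix y
    show "((\<lambda>y. P (z y)) has_vector_derivative (e * r * \<i>) * (((F (z y))\<^sup>2 - of_real (w\<^sup>2)) / z y)) (at y within {-\<beta>..\<beta>})"
      using field_vector_diff_chain_within[OF dz has_field_derivative_at_within[OF P[OF z0]], of y "{-\<beta>..\<beta>}"]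
      by (simp add: o_def)
  qed (use assms in auto)
  then have int1: "((\<lambda>y. Im ((e * r * \<i>) * (((F (z y))\<^sup>2 - of_real (w\<^sup>2)) / z y))) has_integral Im (P (z \<beta>) - P (z (-\<beta>)))) {-\<beta>..\<beta>}"
    by (rule has_integral_linear[OF _ bounded_linear_Im, unfolded o_def])
  have int2: "((\<lambda>y. (2 * (Re (F (z y)))\<^sup>2 - d * (Im (F (z y)))\<^sup>2) / \<alpha>) has_integral
     (2 * integral {-\<beta>..\<beta>} (\<lambda>y. (Re (F (z y)))\<^sup>2) - d * integral {-\<beta>..\<beta>} (\<lambda>y. (Im (F (z y)))\<^sup>2)) / \<alpha>) {-\<beta>..\<beta>}"
    by (intro has_integral_divide has_integral_diff has_integral_mult_right integrable_integral
        integrable_continuous_real continuous_intros contF)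
  have le: "Im ((e * r * \<i>) * (((F (z y))\<^sup>2 - of_real (w\<^sup>2)) / z y)) \<le> (2 * (Re (F (z y)))\<^sup>2 - d * (Im (F (z y)))\<^sup>2) / \<alpha>"
    if "y \<in> {-\<beta>..\<beta>}" for y
  proof -
    have "(e * r * \<i>) * (((F (z y))\<^sup>2 - of_real (w\<^sup>2)) / z y)
        = \<i> * ((Complex (Re (F (z y))) (Im (F (z y))) ^ 2 - of_real (w\<^sup>2)) / Complex \<alpha> y)"
    proof -
      have "(k * \<i>) * (x / (k * c)) = \<i> * (x / c)" if "k \<noteq> 0" for k x c :: complex
        using that by simp
      from this[of "e * r"] show ?thesis using assms by (simp add: z_def)
    qed
    then have "Im ((e * r * \<i>) * (((F (z y))\<^sup>2 - of_real (w\<^sup>2)) / z y))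
        = Re ((Complex (Re (F (z y))) (Im (F (z y))) ^ 2 - of_real (w\<^sup>2)) / Complex \<alpha> y)"
      by (simp only: Im_i_times)
    then show ?thesis
      using friedrichs_pointwise[of \<alpha> y \<beta> "Re (F (z y))" "Im (F (z y))" w] assms that by (simp add: d_def abs_le_iff)
  qed
  show ?thesis
    unfolding d_def[symmetric] z_def[symmetric] minus_complex.sel(2)[symmetric]
    using int1 int2 le by (rule has_integral_le)
qed

text \<open>The parameter \<open>y\<close> ranges over the same interval for every \<open>r\<close>,
  so \<open>r\<close> is missing from the arc length. It comes back in the Jacobian
  \<open>r * \<alpha>\<close> of \<open>plane_integral_sector\<close>.\<close>

definition side_integral :: "(complex \<Rightarrow> real) \<Rightarrow> real \<Rightarrow> real \<Rightarrow> complex \<Rightarrow> real \<Rightarrow> real"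
  where "side_integral h \<alpha> \<beta> e r = integral {-\<beta>..\<beta>} (\<lambda>y. h (e * r * Complex \<alpha> y))"

lemma side_integral_nonneg: "(\<And>z. 0 \<le> h z) \<Longrightarrow> 0 \<le> side_integral h \<alpha> \<beta> e r"
  unfolding side_integral_def
  by (cases "(\<lambda>y. h (e * r * Complex \<alpha> y)) integrable_on {-\<beta>..\<beta>}")
    (auto simp: not_integrable_integral intro: Henstock_Kurzweil_Integration.integral_nonneg)

text \<open>The identity of Horgan and Payne: the integral of \<open>((F z)\<^sup>2 - (F 0)\<^sup>2) / z\<close> around the
  rectangle of half-widths \<open>r * A\<close>, \<open>r * B\<close> vanishes, and on each side its imaginary part
  bounds \<open>(Im F)\<^sup>2\<close> by \<open>(Re F)\<^sup>2\<close>.\<close>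

lemma friedrichs_rectangle_boundary:
  fixes F :: "complex \<Rightarrow> complex" and A B r :: real
  assumes F: "F holomorphic_on UNIV" and F0: "Im (F 0) = 0" and "0 < A" "0 < B" "0 < r"
  defines "K \<equiv> 4 * (A\<^sup>2 + B\<^sup>2) * (1 / A\<^sup>2 + 1 / B\<^sup>2)"
  defines "U \<equiv> \<lambda>z. (Re (F z))\<^sup>2" and "V \<equiv> \<lambda>z. (Im (F z))\<^sup>2"
  shows "A * side_integral V A B 1 r + B * side_integral V B A \<i> r
      + A * side_integral V A B (-1) r + B * side_integral V B A (-\<i>) r
    \<le> K * (A * side_integral U A B 1 r + B * side_integral U B A \<i> r
      + A * side_integral U A B (-1) r + B * side_integral U B A (-\<i>) r)"
proof -
  define w where "w = Re (F 0)"
  have F0': "(F 0)\<^sup>2 = of_real (w\<^sup>2)" using F0 by (simp add: w_def complex_eq_iff power2_eq_square)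
  have "(\<lambda>z. (F z)\<^sup>2) holomorphic_on UNIV" using F by (intro holomorphic_intros)
  \<comment> \<open>The numerator vanishes at 0, so the quotient extends to an entire function,
    which has a primitive \<open>P\<close> on the whole plane.\<close>
  then have "(\<lambda>z. if z = 0 then deriv (\<lambda>z. (F z)\<^sup>2) 0 else ((F z)\<^sup>2 - (F 0)\<^sup>2) / (z - 0)) holomorphic_on UNIV"
    by (rule pole_lemma) auto
  then obtain P where P: "\<And>z. (P has_field_derivative (if z = 0 then deriv (\<lambda>z. (F z)\<^sup>2) 0 else ((F z)\<^sup>2 - (F 0)\<^sup>2) / (z - 0))) (at z)"
    using holomorphic_convex_primitive'[of UNIV] by auto
  have P': "(P has_field_derivative ((F z)\<^sup>2 - of_real (w\<^sup>2)) / z) (at z)" if "z \<noteq> 0" for z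
    using P[of z] that F0' by simp
  note side = friedrichs_side[OF holomorphic_on_imp_continuous_on[OF F] P', folded U_def V_def side_integral_def]
  define s where "s = A\<^sup>2 + B\<^sup>2"
  have s: "s > 0" "B\<^sup>2 + A\<^sup>2 = s" using assms by (auto simp: s_def add_pos_pos)
  have "Im (P (r * Complex A B)) - Im (P (r * Complex A (-B)))
      \<le> (2 * side_integral U A B 1 r - A\<^sup>2 / (2 * s) * side_integral V A B 1 r) / A"
    using side[of 1 A B r] assms(3-5) by (simp add: U_def V_def side_integral_def s_def)
  moreover have "Im (P (-(r * Complex A B))) - Im (P (-(r * Complex A (-B))))
      \<le> (2 * side_integral U A B (-1) r - A\<^sup>2 / (2 * s) * side_integral V A B (-1) r) / A"
    using side[of "-1" A B r] assms(3-5) by (simp add: U_def V_def side_integral_def s_def)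
  moreover have "Im (P (\<i> * r * Complex B A)) - Im (P (\<i> * r * Complex B (-A)))
      \<le> (2 * side_integral U B A \<i> r - B\<^sup>2 / (2 * s) * side_integral V B A \<i> r) / B"
    using side[of "\<i>" B A r] assms(3-5) by (simp add: U_def V_def side_integral_def s_def add.commute)
  moreover have "Im (P (-(\<i> * r * Complex B A))) - Im (P (-(\<i> * r * Complex B (-A))))
      \<le> (2 * side_integral U B A (-\<i>) r - B\<^sup>2 / (2 * s) * side_integral V B A (-\<i>) r) / B"
    using side[of "-\<i>" B A r] assms(3-5) by (simp add: U_def V_def side_integral_def s_def add.commute)
  \<comment> \<open>Each side ends at the corner where the next one begins, so with the corners
    identified the increments of \<open>P\<close> cancel in the sum of the four bounds.\<close>
  moreover have "\<i> * r * Complex B A = - (r * Complex A (-B))" "\<i> * r * Complex B (-A) = r * Complex A B"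
    by (auto simp: complex_eq_iff)
  ultimately have *: "0 \<le> (2 * side_integral U A B 1 r - A\<^sup>2 / (2 * s) * side_integral V A B 1 r) / A
     + (2 * side_integral U A B (-1) r - A\<^sup>2 / (2 * s) * side_integral V A B (-1) r) / A
     + (2 * side_integral U B A \<i> r - B\<^sup>2 / (2 * s) * side_integral V B A \<i> r) / B
     + (2 * side_integral U B A (-\<i>) r - B\<^sup>2 / (2 * s) * side_integral V B A (-\<i>) r) / B"
    by (simp only: minus_minus)
  \<comment> \<open>Multiplying by \<open>2 * s\<close> turns the coefficient of each
    \<open>V\<close> integral into the weight \<open>c\<close> that the area element assigns to its
    side.\<close>
  have resc: "(2 * u - c\<^sup>2 / (2 * s) * v) / c * (2 * s) = 4 * s * (u / c) - c * v" if "c > 0" for u v c :: real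
    using that s(1) by (simp add: field_simps power2_eq_square)
  from mult_right_mono[OF *, of "2 * s"] s(1)
  have 1: "A * side_integral V A B 1 r + B * side_integral V B A \<i> r
      + A * side_integral V A B (-1) r + B * side_integral V B A (-\<i>) r
    \<le> 4 * s * (side_integral U A B 1 r / A) + 4 * s * (side_integral U B A \<i> r / B)
      + 4 * s * (side_integral U A B (-1) r / A) + 4 * s * (side_integral U B A (-\<i>) r / B)"
    by (simp only: distrib_right resc[OF \<open>0 < A\<close>] resc[OF \<open>0 < B\<close>]) linarith
  \<comment> \<open>\<open>1 / c\<^sup>2\<close> is at most
    \<open>1 / A\<^sup>2 + 1 / B\<^sup>2\<close> for both kinds of side, which gives one constant
    \<open>K\<close> for all four.\<close>
  have bd: "4 * s * (u / c) \<le> K * (c * u)" if "c = A \<or> c = B" "0 \<le> u" for u c :: real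
  proof -
    have "c > 0" "1 / c\<^sup>2 \<le> 1 / A\<^sup>2 + 1 / B\<^sup>2" using that(1) assms(3,4) by auto
    then have "4 * s * (c * u) * (1 / c\<^sup>2) \<le> 4 * s * (c * u) * (1 / A\<^sup>2 + 1 / B\<^sup>2)"
      using that(2) s(1) by (intro mult_left_mono) auto
    moreover have "4 * s * (c * u) * (1 / c\<^sup>2) = 4 * s * (u / c)"
      using \<open>c > 0\<close> by (simp add: power2_eq_square)
    ultimately show ?thesis by (simp only: K_def s_def mult_ac)
  qed
  have U0: "0 \<le> side_integral U \<alpha> \<beta> e r" for \<alpha> \<beta> e
    by (rule side_integral_nonneg) (simp add: U_def)
  show ?thesis
    using 1 bd[OF _ U0[of A B 1], of A] bd[OF _ U0[of A B "-1"], of A] bd[OF _ U0[of B A "\<i>"], of B]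
      bd[OF _ U0[of B A "-\<i>"], of B]
    unfolding distrib_left by linarith
qed

section \<open>Area integrals: quarter turns and triangles with apex 0\<close>

definition plane_integral :: "(complex \<Rightarrow> ennreal) \<Rightarrow> ennreal"
  where "plane_integral f = (\<integral>\<^sup>+x. \<integral>\<^sup>+y. f (Complex x y) \<partial>lborel \<partial>lborel)"

lemma Complex_measurable [measurable]:
  assumes [measurable]: "f \<in> borel_measurable M" "g \<in> borel_measurable M"
  shows "(\<lambda>x. Complex (f x) (g x)) \<in> borel_measurable M"
proof -
  have "(\<lambda>x. complex_of_real (f x) + \<i> * complex_of_real (g x)) \<in> borel_measurable M"
    by measurable
  then show ?thesis by (simp add: Complex_eq)
qed

text \<open>A quarter turn is a reflection followed by an exchange of the coordinates: an affine
  substitution and Fubini.\<close>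

lemma plane_integral_rotate:
  assumes [measurable]: "f \<in> borel_measurable borel"
  shows "plane_integral (\<lambda>z. f (\<i> * z)) = plane_integral f"
proof -
  have "plane_integral (\<lambda>z. f (\<i> * z)) = (\<integral>\<^sup>+x. \<integral>\<^sup>+y. f (Complex (- y) x) \<partial>lborel \<partial>lborel)"
  proof -
    have "\<i> * Complex x y = Complex (- y) x" for x y by (simp add: complex_eq_iff)
    then show ?thesis by (simp add: plane_integral_def)
  qed
  also have "\<dots> = (\<integral>\<^sup>+x. \<integral>\<^sup>+y. f (Complex y x) \<partial>lborel \<partial>lborel)"
    by (subst nn_integral_real_affine[of "\<lambda>y. f (Complex y _)" "-1" 0]) auto
  also have "\<dots> = plane_integral f"
    unfolding plane_integral_def by (rule lborel_pair.Fubini') measurable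
  finally show ?thesis .
qed

text \<open>The set is the triangle with apex 0 over the side \<open>Re z = \<alpha>\<close>,
  without its apex. The coordinates \<open>z = r * Complex \<alpha> y\<close> straighten it to a
  rectangle, with Jacobian \<open>r * \<alpha>\<close>.\<close>

lemma plane_integral_sector:
  assumes [measurable]: "h \<in> borel_measurable borel" and "0 < \<alpha>" "0 < \<beta>"
  shows "plane_integral (\<lambda>z. indicator {z. 0 < Re z \<and> Re z \<le> \<alpha> \<and> \<bar>Im z\<bar> * \<alpha> \<le> \<beta> * Re z} z * h z)
    = (\<integral>\<^sup>+r. indicator {0<..1} r * (ennreal (r * \<alpha>) * (\<integral>\<^sup>+y. indicator {-\<beta>..\<beta>} y * h (of_real r * Complex \<alpha> y) \<partial>lborel)) \<partial>lborel)"
proof -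
  let ?S = "{z. 0 < Re z \<and> Re z \<le> \<alpha> \<and> \<bar>Im z\<bar> * \<alpha> \<le> \<beta> * Re z}"
  have [measurable]: "?S \<in> sets borel" by measurable
  have "plane_integral (\<lambda>z. indicator ?S z * h z)
      = \<bar>\<alpha>\<bar> * (\<integral>\<^sup>+r. \<integral>\<^sup>+y. indicator ?S (Complex (0 + \<alpha> * r) y) * h (Complex (0 + \<alpha> * r) y) \<partial>lborel \<partial>lborel)"
    unfolding plane_integral_def using assms(2)
    by (intro nn_integral_real_affine) auto
  also have "\<dots> = (\<integral>\<^sup>+r. \<alpha> * (\<integral>\<^sup>+y. indicator ?S (Complex (\<alpha> * r) y) * h (Complex (\<alpha> * r) y) \<partial>lborel) \<partial>lborel)"
    using assms(2) by (simp add: nn_integral_cmult)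
  also have "\<dots> = (\<integral>\<^sup>+r. indicator {0<..1} r * (ennreal (r * \<alpha>) * (\<integral>\<^sup>+y. indicator {-\<beta>..\<beta>} y * h (of_real r * Complex \<alpha> y) \<partial>lborel)) \<partial>lborel)"
  proof (rule nn_integral_cong)
    fix r :: real
    show "\<alpha> * (\<integral>\<^sup>+y. indicator ?S (Complex (\<alpha> * r) y) * h (Complex (\<alpha> * r) y) \<partial>lborel)
      = indicator {0<..1} r * (ennreal (r * \<alpha>) * (\<integral>\<^sup>+y. indicator {-\<beta>..\<beta>} y * h (of_real r * Complex \<alpha> y) \<partial>lborel))"
    proof (cases "r \<in> {0<..1}")
      case True
      have "(\<integral>\<^sup>+y. indicator ?S (Complex (\<alpha> * r) y) * h (Complex (\<alpha> * r) y) \<partial>lborel)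
        = ennreal r * (\<integral>\<^sup>+y. indicator ?S (Complex (\<alpha> * r) (0 + r * y)) * h (Complex (\<alpha> * r) (0 + r * y)) \<partial>lborel)"
        using True by (subst nn_integral_real_affine[where c=r and t=0]) auto
      also have "(\<lambda>y. indicator ?S (Complex (\<alpha> * r) (0 + r * y)) * h (Complex (\<alpha> * r) (0 + r * y)))
         = (\<lambda>y. indicator {-\<beta>..\<beta>} y * h (of_real r * Complex \<alpha> y))"
      proof
        fix y
        have "Complex (\<alpha> * r) (0 + r * y) = of_real r * Complex \<alpha> y" by (simp add: complex_eq_iff)
        moreover have "Complex (\<alpha> * r) (0 + r * y) \<in> ?S \<longleftrightarrow> y \<in> {-\<beta>..\<beta>}"
        proof -
          have "\<bar>r * y\<bar> * \<alpha> \<le> \<beta> * (\<alpha> * r) \<longleftrightarrow> (\<alpha> * r) * \<bar>y\<bar> \<le> (\<alpha> * r) * \<beta>"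
            using True by (simp add: abs_mult mult_ac)
          also have "\<dots> \<longleftrightarrow> \<bar>y\<bar> \<le> \<beta>" using True assms(2) by (subst mult_le_cancel_left_pos) auto
          finally show ?thesis using True assms(2) by (auto simp: abs_le_iff mult_le_cancel_left2)
        qed
        ultimately show "indicator ?S (Complex (\<alpha> * r) (0 + r * y)) * h (Complex (\<alpha> * r) (0 + r * y))
           = indicator {-\<beta>..\<beta>} y * h (of_real r * Complex \<alpha> y)"
          by (metis (no_types, lifting) indicator_simps)
      qed
      finally show ?thesis using True assms(2) by (simp add: ennreal_mult mult_ac)
    next
      case False
      then have "Complex (\<alpha> * r) y \<notin> ?S" for y
        using assms(2) by (auto simp: zero_less_mult_iff mult_le_cancel_left2)
      then show ?thesis using False by simp
    qed
  qed
  finally show ?thesis .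
qed


lemma plane_integral_unit:
  assumes f: "f \<in> borel_measurable borel" and "e \<in> {1, \<i>, -1, -\<i>}"
  shows "plane_integral (\<lambda>z. f (e * z)) = plane_integral f"
proof -
  have m: "(\<lambda>z. f (c * z)) \<in> borel_measurable borel" for c :: complex
    by (rule measurable_compose[OF _ f]) measurable
  have 1: "plane_integral (\<lambda>z. f (c * (\<i> * z))) = plane_integral (\<lambda>z. f (c * z))" for c
    using plane_integral_rotate[OF m] .
  have 2: "plane_integral (\<lambda>z. f (\<i> * z)) = plane_integral f"
    using 1[of 1] by simp
  have 3: "plane_integral (\<lambda>z. f (- z)) = plane_integral f"
    using 1[of "\<i>"] 2 by (simp add: mult.assoc[symmetric])
  have 4: "plane_integral (\<lambda>z. f (- (\<i> * z))) = plane_integral f"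
    using 1[of "-1"] 3 by simp
  show ?thesis using assms(2) 2 3 4 by auto
qed

text \<open>The triangle over the side rotated by \<open>e\<close> is swept out by the dilated
  sides. As \<open>e\<close> has modulus 1, multiplication by \<open>cnj e\<close> turns it back to
  the standard position.\<close>

lemma sector_integral:
  fixes h :: "complex \<Rightarrow> real"
  assumes h: "continuous_on UNIV h" "\<And>z. 0 \<le> h z" and e: "e \<in> {1, \<i>, -1, -\<i>}"
    and "0 < \<alpha>" "0 < \<beta>"
  shows "plane_integral (\<lambda>z. indicator {z. 0 < Re z \<and> Re z \<le> \<alpha> \<and> \<bar>Im z\<bar> * \<alpha> \<le> \<beta> * Re z} (cnj e * z) * ennreal (h z))
      = (\<integral>\<^sup>+r. indicator {0<..1} r * ennreal (r * (\<alpha> * side_integral h \<alpha> \<beta> e r)) \<partial>lborel)" (is "?L = _")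
    and "(\<lambda>r. ennreal (side_integral h \<alpha> \<beta> e r)) \<in> borel_measurable borel"
proof -
  let ?S = "{z. 0 < Re z \<and> Re z \<le> \<alpha> \<and> \<bar>Im z\<bar> * \<alpha> \<le> \<beta> * Re z}"
  have [measurable]: "h \<in> borel_measurable borel"
    using h(1) by (rule borel_measurable_continuous_onI)
  have [measurable]: "?S \<in> sets borel" by measurable
  have hc: "continuous_on S (\<lambda>y. h (e * (r * Complex \<alpha> y)))" for r :: real and S
    by (rule continuous_on_compose2[OF h(1)]) (auto simp: Complex_eq intro!: continuous_intros)
  have nn: "(\<integral>\<^sup>+y. indicator {-\<beta>..\<beta>} y * ennreal (h (e * (r * Complex \<alpha> y))) \<partial>lborel)
      = ennreal (side_integral h \<alpha> \<beta> e r)" for r :: real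
  proof -
    have "(\<integral>\<^sup>+y. ennreal (indicator {-\<beta>..\<beta>} y * h (e * (r * Complex \<alpha> y))) \<partial>lborel)
      = ennreal (side_integral h \<alpha> \<beta> e r)"
    proof (rule nn_integral_has_integral_lborel)
      have "((\<lambda>y. if y \<in> {-\<beta>..\<beta>} then h (e * (r * Complex \<alpha> y)) else 0) has_integral side_integral h \<alpha> \<beta> e r) UNIV"
        unfolding side_integral_def mult.assoc has_integral_restrict_UNIV
        by (intro integrable_integral integrable_continuous_real hc)
      moreover have "(\<lambda>y. if y \<in> {-\<beta>..\<beta>} then h (e * (r * Complex \<alpha> y)) else 0)
          = (\<lambda>y. indicator {-\<beta>..\<beta>} y * h (e * (r * Complex \<alpha> y)))"
        by (auto simp: fun_eq_iff)
      ultimately show "((\<lambda>y. indicator {-\<beta>..\<beta>} y * h (e * (r * Complex \<alpha> y))) has_integral side_integral h \<alpha> \<beta> e r) UNIV"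
        by (simp only:)
    qed (use h(2) in auto)
    then show ?thesis by (simp add: ennreal_mult' ennreal_indicator)
  qed
  have "?L = plane_integral (\<lambda>z. indicator ?S z * ennreal (h (e * z)))"
  proof -
    have "cnj e * (e * z) = z" for z using e by auto
    moreover have "plane_integral (\<lambda>z. indicator ?S (cnj e * (e * z)) * ennreal (h (e * z))) = ?L"
    proof (rule plane_integral_unit[OF _ e])
      have "(\<lambda>z. indicator ?S (cnj e * z) :: ennreal) \<in> borel_measurable borel"
        by (rule measurable_compose[of "\<lambda>z. cnj e * z" _ borel]) auto
      then show "(\<lambda>z. indicator ?S (cnj e * z) * ennreal (h z)) \<in> borel_measurable borel"
        by measurable
    qed
    ultimately show ?thesis by (simp only:)
  qed
  also have "\<dots> = (\<integral>\<^sup>+r. indicator {0<..1} r * (ennreal (r * \<alpha>) * ennreal (side_integral h \<alpha> \<beta> e r)) \<partial>lborel)"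
    using assms(4,5) by (subst plane_integral_sector) (auto simp: nn)
  also have "\<dots> = (\<integral>\<^sup>+r. indicator {0<..1} r * ennreal (r * (\<alpha> * side_integral h \<alpha> \<beta> e r)) \<partial>lborel)"
    using assms(4) side_integral_nonneg[OF h(2)]
    by (intro nn_integral_cong) (auto simp: ennreal_mult[symmetric] mult.assoc split: split_indicator)
  finally show "?L = (\<integral>\<^sup>+r. indicator {0<..1} r * ennreal (r * (\<alpha> * side_integral h \<alpha> \<beta> e r)) \<partial>lborel)" .
  show "(\<lambda>r. ennreal (side_integral h \<alpha> \<beta> e r)) \<in> borel_measurable borel"
    unfolding nn[symmetric] by measurable
qed

text \<open>The diagonals cut \<open>R\<close> into four triangles with apex 0, and each triangle is
  swept out by the corresponding sides of the rectangles r R for 0 < r \<le> 1. Integrating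
  \<open>friedrichs_rectangle_boundary\<close> against the weight \<open>r\<close> gives the
  inequality for areas. The 16 is the 4 of the boundary constant times a crude 4 that comes from
  bounding each triangle's share of (Re F)^2 by that of all of \<open>R\<close>.\<close>

theorem friedrichs_rectangle:
  fixes F :: "complex \<Rightarrow> complex" and A B :: real
  assumes F: "F holomorphic_on UNIV" and F0: "Im (F 0) = 0" and "0 < A" "0 < B"
  defines "R \<equiv> {z. \<bar>Re z\<bar> \<le> A \<and> \<bar>Im z\<bar> \<le> B}"
  shows "plane_integral (\<lambda>z. indicator R z * ennreal ((Im (F z))\<^sup>2))
    \<le> ennreal (16 * (A\<^sup>2 + B\<^sup>2) * (1 / A\<^sup>2 + 1 / B\<^sup>2)) * plane_integral (\<lambda>z. indicator R z * ennreal ((Re (F z))\<^sup>2))"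
proof -
  define K where "K = 4 * (A\<^sup>2 + B\<^sup>2) * (1 / A\<^sup>2 + 1 / B\<^sup>2)"
  have K: "0 \<le> K" by (simp add: K_def)
  define S where "S \<alpha> \<beta> = {z. 0 < Re z \<and> Re z \<le> \<alpha> \<and> \<bar>Im z\<bar> * \<alpha> \<le> \<beta> * Re z}" for \<alpha> \<beta> :: real
  have [measurable]: "S \<alpha> \<beta> \<in> sets borel" for \<alpha> \<beta> unfolding S_def by measurable
  have Rm [measurable]: "R \<in> sets borel" unfolding R_def by measurable
  have Sm [measurable]: "(\<lambda>z. indicator (S \<alpha> \<beta>) (c * z) :: ennreal) \<in> borel_measurable borel" for \<alpha> \<beta> c
    by (rule measurable_compose[of "\<lambda>z. c * z" _ borel]) auto
  define sec where "sec h \<alpha> \<beta> e = plane_integral (\<lambda>z. indicator (S \<alpha> \<beta>) (cnj e * z) * ennreal (h z))"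
    for h \<alpha> \<beta> e
  define Q where "Q h r = A * side_integral h A B 1 r + B * side_integral h B A \<i> r
      + A * side_integral h A B (-1) r + B * side_integral h B A (-\<i>) r" for h r
  define U where "U = (\<lambda>z. (Re (F z))\<^sup>2)"
  define V where "V = (\<lambda>z. (Im (F z))\<^sup>2)"
  have Fc: "continuous_on UNIV F" using F by (rule holomorphic_on_imp_continuous_on)
  have U: "continuous_on UNIV U" "\<And>z. 0 \<le> U z" unfolding U_def by (auto intro!: continuous_intros Fc)
  have V: "continuous_on UNIV V" "\<And>z. 0 \<le> V z" unfolding V_def by (auto intro!: continuous_intros Fc)
  have total: "sec h A B 1 + sec h B A \<i> + sec h A B (-1) + sec h B A (-\<i>)
      = (\<integral>\<^sup>+r. indicator {0<..1} r * ennreal (r * Q h r) \<partial>lborel)"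
    and meas: "(\<lambda>r. ennreal (r * Q h r)) \<in> borel_measurable borel"
    if h: "continuous_on UNIV h" "\<And>z. 0 \<le> h z" for h
  proof -
    note si = sector_integral[OF h, folded S_def, folded sec_def]
    note s0 = side_integral_nonneg[OF h(2)]
    have [measurable]: "(\<lambda>r. side_integral h A B 1 r) \<in> borel_measurable borel"
      "(\<lambda>r. side_integral h A B (-1) r) \<in> borel_measurable borel"
      "(\<lambda>r. side_integral h B A \<i> r) \<in> borel_measurable borel"
      "(\<lambda>r. side_integral h B A (-\<i>) r) \<in> borel_measurable borel"
      using measurable_compose[OF si(2) borel_measurable_enn2real[OF measurable_ident]] assms(3,4) s0
      by auto
    show "(\<lambda>r. ennreal (r * Q h r)) \<in> borel_measurable borel"
      unfolding Q_def by measurable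
    have "indicator {0<..1} r * ennreal (r * Q h r)
       = indicator {0<..1} r * ennreal (r * (A * side_integral h A B 1 r))
       + indicator {0<..1} r * ennreal (r * (B * side_integral h B A \<i> r))
       + indicator {0<..1} r * ennreal (r * (A * side_integral h A B (-1) r))
       + indicator {0<..1} r * ennreal (r * (B * side_integral h B A (-\<i>) r))" for r
      using assms(3,4) s0 by (auto simp: Q_def distrib_left ennreal_plus split: split_indicator)
    then show "sec h A B 1 + sec h B A \<i> + sec h A B (-1) + sec h B A (-\<i>)
      = (\<integral>\<^sup>+r. indicator {0<..1} r * ennreal (r * Q h r) \<partial>lborel)"
      using assms(3,4) by (simp add: si nn_integral_add)
  qed
  \<comment> \<open>The triangles omit 0, where \<open>V\<close> vanishes because \<open>F 0\<close>
    is real.\<close>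
  have "indicator R z * ennreal (V z)
     \<le> indicator (S A B) (cnj 1 * z) * ennreal (V z) + indicator (S B A) (cnj \<i> * z) * ennreal (V z)
      + indicator (S A B) (cnj (-1) * z) * ennreal (V z) + indicator (S B A) (cnj (-\<i>) * z) * ennreal (V z)" for z
  proof (cases "z \<in> R \<and> z \<noteq> 0")
    case True
    then have z: "\<bar>Re z\<bar> \<le> A" "\<bar>Im z\<bar> \<le> B" "z \<noteq> 0" by (auto simp: R_def)
    have "z \<in> S A B \<or> - z \<in> S A B \<or> - (\<i> * z) \<in> S B A \<or> \<i> * z \<in> S B A"
    proof (cases "\<bar>Im z\<bar> * A \<le> B * \<bar>Re z\<bar>")
      case True
      have "Re z \<noteq> 0"
      proof
        assume "Re z = 0"
        with True assms(3) have "Im z = 0" by (simp add: mult_le_0_iff)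
        with \<open>Re z = 0\<close> z(3) show False by (simp add: complex_eq_iff)
      qed
      with True z show ?thesis by (cases "Re z > 0") (auto simp: S_def)
    next
      case False
      then have "Im z \<noteq> 0" using assms by (auto simp: mult_less_0_iff)
      with False z show ?thesis by (cases "Im z > 0") (auto simp: S_def mult.commute)
    qed
    then show ?thesis by (auto split: split_indicator)
  next
    case False
    then show ?thesis using F0 by (auto simp: V_def)
  qed
  then have "plane_integral (\<lambda>z. indicator R z * ennreal (V z)) \<le>
     plane_integral (\<lambda>z. indicator (S A B) (cnj 1 * z) * ennreal (V z) + indicator (S B A) (cnj \<i> * z) * ennreal (V z)
      + indicator (S A B) (cnj (-1) * z) * ennreal (V z) + indicator (S B A) (cnj (-\<i>) * z) * ennreal (V z))"
    unfolding plane_integral_def by (intro nn_integral_mono) auto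
  also have "\<dots> = sec V A B 1 + sec V B A \<i> + sec V A B (-1) + sec V B A (-\<i>)"
  proof -
    have [measurable]: "V \<in> borel_measurable borel" using V(1) by (rule borel_measurable_continuous_onI)
    have add: "plane_integral (\<lambda>z. f z + g z) = plane_integral f + plane_integral g"
      if [measurable]: "f \<in> borel_measurable borel" "g \<in> borel_measurable borel" for f g
      unfolding plane_integral_def by (simp add: nn_integral_add)
    show ?thesis unfolding sec_def by (simp only: add Sm borel_measurable_add borel_measurable_times_ennreal measurable_compose[OF \<open>V \<in> borel_measurable borel\<close> measurable_ennreal])
  qed
  also have "\<dots> \<le> (\<integral>\<^sup>+r. ennreal K * (indicator {0<..1} r * ennreal (r * Q U r)) \<partial>lborel)"
    unfolding total[OF V]
  proof (rule nn_integral_mono)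
    fix r :: real
    show "indicator {0<..1} r * ennreal (r * Q V r) \<le> ennreal K * (indicator {0<..1} r * ennreal (r * Q U r))"
    proof (cases "r \<in> {0<..1}")
      case True
      then have "r * Q V r \<le> r * (K * Q U r)"
        using friedrichs_rectangle_boundary[OF F F0 assms(3,4), of r]
        by (intro mult_left_mono) (auto simp: Q_def K_def U_def V_def)
      then have "ennreal (r * Q V r) \<le> ennreal (K * (r * Q U r))"
        by (intro ennreal_leI) (simp add: mult_ac)
      then show ?thesis using True K by (simp add: ennreal_mult')
    qed simp
  qed
  also have "\<dots> = ennreal K * (sec U A B 1 + sec U B A \<i> + sec U A B (-1) + sec U B A (-\<i>))"
    unfolding total[OF U] using meas[OF U] by (intro nn_integral_cmult borel_measurable_times_ennreal) auto
  also have "\<dots> \<le> ennreal K * (4 * plane_integral (\<lambda>z. indicator R z * ennreal (U z)))"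
  proof -
    have le: "sec U \<alpha> \<beta> e \<le> plane_integral (\<lambda>z. indicator R z * ennreal (U z))"
      if *: "\<And>z. cnj e * z \<in> S \<alpha> \<beta> \<Longrightarrow> z \<in> R" for \<alpha> \<beta> e
      unfolding sec_def plane_integral_def
      by (intro nn_integral_mono) (auto split: split_indicator dest: *)
    have SD: "\<bar>Re z\<bar> \<le> \<alpha> \<and> \<bar>Im z\<bar> \<le> \<beta>" if "0 < \<alpha>" "0 < \<beta>" "z \<in> S \<alpha> \<beta>" for \<alpha> \<beta> z
    proof -
      have z: "0 < Re z" "Re z \<le> \<alpha>" "\<bar>Im z\<bar> * \<alpha> \<le> \<beta> * Re z" using that(3) by (auto simp: S_def)
      have "\<beta> * Re z \<le> \<beta> * \<alpha>" using z(2) that(2) by simp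
      with z(3) have "\<bar>Im z\<bar> * \<alpha> \<le> \<beta> * \<alpha>" by linarith
      then show ?thesis using z that(1) by simp
    qed
    have "sec U A B 1 + sec U B A \<i> + sec U A B (-1) + sec U B A (-\<i>)
       \<le> plane_integral (\<lambda>z. indicator R z * ennreal (U z)) + plane_integral (\<lambda>z. indicator R z * ennreal (U z))
         + plane_integral (\<lambda>z. indicator R z * ennreal (U z)) + plane_integral (\<lambda>z. indicator R z * ennreal (U z))"
      by (intro add_mono le) (auto simp: R_def dest!: SD[OF assms(3,4)] SD[OF assms(4,3)])
    also have "\<dots> = 4 * plane_integral (\<lambda>z. indicator R z * ennreal (U z))"
    proof -
      have "(4 :: ennreal) = 1 + 1 + 1 + 1" by simp
      then show ?thesis by (simp only: distrib_right mult_1)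
    qed
    finally show ?thesis by (rule mult_left_mono) simp
  qed
  also have "\<dots> = ennreal (16 * (A\<^sup>2 + B\<^sup>2) * (1 / A\<^sup>2 + 1 / B\<^sup>2)) * plane_integral (\<lambda>z. indicator R z * ennreal (U z))"
  proof -
    have "16 * (A\<^sup>2 + B\<^sup>2) * (1 / A\<^sup>2 + 1 / B\<^sup>2) = K * 4" by (simp add: K_def)
    then show ?thesis using K by (simp only: ennreal_mult' mult.assoc) simp
  qed
  finally show ?thesis unfolding U_def V_def .
qed

section \<open>Representation of bounded functionals\<close>

text \<open>Completeness for a general measure, since the type \<open>L2\<close> covers the circle
  alone. Fast decay of the squared distances yields convergence almost everywhere, and Fatou's lemma
  passes the bounds on to the limit.\<close>

lemma square_integrable_limit:
  fixes e :: "nat \<Rightarrow> 'a \<Rightarrow> complex"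
  assumes e: "\<And>k. square_integrable M (e k)"
    and cauchy: "\<And>j k. j \<le> k \<Longrightarrow> (\<integral>x. (cmod (e k x - e j x))\<^sup>2 \<partial>M) \<le> (1/4) ^ j"
  obtains u where "square_integrable M u"
    and "\<And>j. (\<integral>x. (cmod (u x - e j x))\<^sup>2 \<partial>M) \<le> (1/4) ^ j"
proof -
  have [measurable]: "e k \<in> borel_measurable M" for k
    using e by (rule square_integrable_measurable)
  have int: "integrable M (\<lambda>x. (cmod (e k x - e j x))\<^sup>2)" for j k
    using square_integrable_diff[OF e e] by (simp add: square_integrable_def)
  have nn: "(\<integral>\<^sup>+x. ennreal ((cmod (e k x - e j x))\<^sup>2) \<partial>M) \<le> ennreal ((1/4) ^ j)" if "j \<le> k" for j k
    using cauchy[OF that] by (subst nn_integral_eq_integral[OF int]) (auto intro: ennreal_leI)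
  \<comment> \<open>The weight \<open>2^k\<close> still leaves a geometric series against
    \<open>(1/4) ^ k\<close>, and it allows an increment a to be bounded by its square: 2 a \<le>
    (1/2)^k + 2^k a^2, by the inequality of arithmetic and geometric means.\<close>
  have "(\<integral>\<^sup>+x. (\<Sum>k. ennreal (2^k * (cmod (e (Suc k) x - e k x))\<^sup>2)) \<partial>M)
      = (\<Sum>k. ennreal (2^k) * (\<integral>\<^sup>+x. ennreal ((cmod (e (Suc k) x - e k x))\<^sup>2) \<partial>M))"
    by (simp add: nn_integral_suminf nn_integral_cmult ennreal_mult)
  also have "\<dots> \<le> (\<Sum>k. ennreal ((1/2) ^ k))"
  proof (rule suminf_le)
    fix k
    have "ennreal (2^k) * (\<integral>\<^sup>+x. ennreal ((cmod (e (Suc k) x - e k x))\<^sup>2) \<partial>M)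
        \<le> ennreal (2^k) * ennreal ((1/4) ^ k)"
      by (intro mult_left_mono nn) auto
    also have "\<dots> = ennreal ((1/2) ^ k)"
      by (simp add: ennreal_mult[symmetric] power_mult_distrib[symmetric])
    finally show "ennreal (2^k) * (\<integral>\<^sup>+x. ennreal ((cmod (e (Suc k) x - e k x))\<^sup>2) \<partial>M) \<le> ennreal ((1/2) ^ k)" .
  qed auto
  also have "\<dots> = ennreal (\<Sum>k. (1/2) ^ k)"
    by (intro suminf_ennreal2) (auto intro: summable_geometric)
  finally have "(\<integral>\<^sup>+x. (\<Sum>k. ennreal (2^k * (cmod (e (Suc k) x - e k x))\<^sup>2)) \<partial>M) \<noteq> \<infinity>"
    by (auto simp: top_unique)
  then have "AE x in M. (\<Sum>k. ennreal (2^k * (cmod (e (Suc k) x - e k x))\<^sup>2)) \<noteq> \<infinity>"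
    by (intro nn_integral_PInf_AE) auto
  then have conv: "AE x in M. convergent (\<lambda>k. e k x)"
  proof eventually_elim
    case (elim x)
    then have "summable (\<lambda>k. 2^k * (cmod (e (Suc k) x - e k x))\<^sup>2)"
      by (intro summable_suminf_not_top) auto
    then have "summable (\<lambda>k. (1/2)^k + 2^k * (cmod (e (Suc k) x - e k x))\<^sup>2)"
      by (intro summable_add summable_geometric) auto
    moreover have "norm (e (Suc k) x - e k x) \<le> (1/2)^k + 2^k * (cmod (e (Suc k) x - e k x))\<^sup>2" for k
    proof -
      let ?a = "cmod (e (Suc k) x - e k x)"
      have "0 \<le> (2^k * ?a - 1)\<^sup>2 / 2^k" by simp
      also have "\<dots> = 2^k * ?a\<^sup>2 - 2 * ?a + (1/2)^k"
        by (simp add: power2_eq_square field_simps power_one_over)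
      finally show ?thesis using norm_ge_zero[of "e (Suc k) x - e k x"] by linarith
    qed
    ultimately have "summable (\<lambda>k. e (Suc k) x - e k x)"
      by (rule summable_comparison_test'[where N=0])
    then have "convergent (\<lambda>n. e n x - e 0 x)"
      by (simp add: summable_iff_convergent sum_lessThan_telescope[of "\<lambda>k. e k x"])
    then show ?case
      using convergent_add[OF _ convergent_const[of "e 0 x"]] by fastforce
  qed
  define u where "u x = lim (\<lambda>k. e k x)" for x
  have [measurable]: "u \<in> borel_measurable M"
    unfolding u_def by (rule borel_measurable_lim_metric) simp
  have bound: "(\<integral>\<^sup>+x. ennreal ((cmod (u x - e j x))\<^sup>2) \<partial>M) \<le> ennreal ((1/4) ^ j)" for j
  proof -
    have "AE x in M. ennreal ((cmod (u x - e j x))\<^sup>2) = liminf (\<lambda>k. ennreal ((cmod (e k x - e j x))\<^sup>2))"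
      using conv
    proof eventually_elim
      case (elim x)
      then have "(\<lambda>k. e k x) \<longlonglongrightarrow> u x" by (simp add: u_def convergent_LIMSEQ_iff)
      then have "(\<lambda>k. ennreal ((cmod (e k x - e j x))\<^sup>2)) \<longlonglongrightarrow> ennreal ((cmod (u x - e j x))\<^sup>2)"
        by (intro tendsto_intros)
      then show ?case by (rule lim_imp_Liminf[OF trivial_limit_sequentially, symmetric])
    qed
    then have "(\<integral>\<^sup>+x. ennreal ((cmod (u x - e j x))\<^sup>2) \<partial>M)
        = (\<integral>\<^sup>+x. liminf (\<lambda>k. ennreal ((cmod (e k x - e j x))\<^sup>2)) \<partial>M)"
      by (rule nn_integral_cong_AE)
    also have "\<dots> \<le> liminf (\<lambda>k. \<integral>\<^sup>+x. ennreal ((cmod (e k x - e j x))\<^sup>2) \<partial>M)"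
      by (rule nn_integral_liminf) measurable
    also have "\<dots> \<le> liminf (\<lambda>k::nat. ennreal ((1/4) ^ j))"
      by (intro Liminf_mono eventually_sequentiallyI[of j] nn)
    finally show ?thesis by (simp add: Liminf_const)
  qed
  have diff: "square_integrable M (\<lambda>x. u x - e j x)" for j
    using bound[of j] by (auto simp: square_integrable_def le_less_trans intro!: integrableI_bounded)
  show thesis
  proof
    show "square_integrable M u"
      using square_integrable_add[OF diff[of 0] e[of 0]] by simp
    show "(\<integral>x. (cmod (u x - e j x))\<^sup>2 \<partial>M) \<le> (1/4) ^ j" for j
      using bound[of j] diff[of j]
      by (simp add: nn_integral_eq_integral square_integrable_def)
  qed
qed

lemma integral_cmod_add_scaleR:
  assumes f: "square_integrable M f" and g: "square_integrable M g"
  shows "(\<integral>x. (cmod (f x + t *\<^sub>R g x))\<^sup>2 \<partial>M)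
    = (\<integral>x. (cmod (f x))\<^sup>2 \<partial>M) + 2 * t * (\<integral>x. f x \<bullet> g x \<partial>M) + t\<^sup>2 * (\<integral>x. (cmod (g x))\<^sup>2 \<partial>M)"
proof -
  have "(cmod (f x + t *\<^sub>R g x))\<^sup>2 = (cmod (f x))\<^sup>2 + (2 * t) * (f x \<bullet> g x) + t\<^sup>2 * (cmod (g x))\<^sup>2" for x
    by (simp only: power2_norm_eq_inner) (simp add: inner_add inner_commute power2_eq_square algebra_simps)
  then show ?thesis
    using f g square_integrable_inner[OF f g] by (simp add: square_integrable_def)
qed

text \<open>Cauchy-Schwarz in the form of Young's inequality, from the nonnegativity of the
  quadratic at \<open>t = s\<close> and \<open>t = - s\<close>. The free parameter \<open>s\<close>
  is tuned at each use.\<close>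

lemma inner_integral_le:
  assumes f: "square_integrable M f" and g: "square_integrable M g" and "0 < s"
  shows "2 * \<bar>\<integral>x. f x \<bullet> g x \<partial>M\<bar> \<le> (\<integral>x. (cmod (f x))\<^sup>2 \<partial>M) / s + s * (\<integral>x. (cmod (g x))\<^sup>2 \<partial>M)"
proof -
  have "0 \<le> (\<integral>x. (cmod (f x + t *\<^sub>R g x))\<^sup>2 \<partial>M)" for t by simp
  then have "0 \<le> (\<integral>x. (cmod (f x))\<^sup>2 \<partial>M) + 2 * t * (\<integral>x. f x \<bullet> g x \<partial>M) + t\<^sup>2 * (\<integral>x. (cmod (g x))\<^sup>2 \<partial>M)" for t
    by (simp only: integral_cmod_add_scaleR[OF f g])
  from this[of s] this[of "-s"] have "2 * s * \<bar>\<integral>x. f x \<bullet> g x \<partial>M\<bar>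
      \<le> (\<integral>x. (cmod (f x))\<^sup>2 \<partial>M) + s\<^sup>2 * (\<integral>x. (cmod (g x))\<^sup>2 \<partial>M)"
    by (auto simp: abs_if)
  then show ?thesis using \<open>0 < s\<close> by (simp add: field_simps power2_eq_square)
qed

text \<open>\<open>E\<close> is the graph of a linear functional on a space of functions. It is given as a relation
  because boundedness alone makes it single-valued almost everywhere.\<close>

lemma bounded_functional_representation:
  fixes E :: "(('a \<Rightarrow> complex) \<times> real) set"
  assumes sq: "\<And>f l. (f, l) \<in> E \<Longrightarrow> square_integrable M f" and ne: "E \<noteq> {}"
    and add: "\<And>f l g m. (f, l) \<in> E \<Longrightarrow> (g, m) \<in> E \<Longrightarrow> (\<lambda>x. f x + g x, l + m) \<in> E"
    and scale: "\<And>f l c. (f, l) \<in> E \<Longrightarrow> (\<lambda>x. c *\<^sub>R f x, c * l) \<in> E"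
    and bounded: "\<And>f l. (f, l) \<in> E \<Longrightarrow> 2 * l \<le> (\<integral>x. (cmod (f x))\<^sup>2 \<partial>M) + K"
  obtains u where "square_integrable M u" "\<And>f l. (f, l) \<in> E \<Longrightarrow> (\<integral>x. u x \<bullet> f x \<partial>M) = l"
proof -
  define N where "N f = (\<integral>x. (cmod (f x))\<^sup>2 \<partial>M)" for f :: "'a \<Rightarrow> complex"
  \<comment> \<open>The representing function arises as a minimiser of this quadratic functional
    over the graph; the boundedness hypothesis says that \<open>J\<close> is at least
    \<open>- K\<close>.\<close>
  define J where "J = (\<lambda>(f, l). N f - 2 * l)"
  define m where "m = Inf (J ` E)"
  have bdd: "bdd_below (J ` E)"
    using bounded by (auto simp: J_def N_def intro!: bdd_belowI[of _ "-K"] split: prod.splits)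
      (smt (verit, best) bounded)
  have m_le: "m \<le> N f - 2 * l" if "(f, l) \<in> E" for f l
    using cInf_lower[OF imageI[OF that] bdd] by (simp add: m_def J_def)
  have "\<exists>p\<in>E. J p < m + (1/4) ^ Suc k" for k
  proof -
    have "Inf (J ` E) < m + (1/4) ^ Suc k" by (simp add: m_def)
    then show ?thesis using ne cInf_lessD[of "J ` E"] by auto
  qed
  then have "\<forall>k. \<exists>f l. (f, l) \<in> E \<and> N f - 2 * l < m + (1/4) ^ Suc k"
    by (fastforce simp: J_def)
  then obtain e l where el: "\<And>k. (e k, l k) \<in> E" "\<And>k. N (e k) - 2 * l k < m + (1/4) ^ Suc k"
    by metis
  have e: "square_integrable M (e k)" for k using sq[OF el(1)] .
  have cauchy: "N (\<lambda>x. e k x - e j x) \<le> (1/4) ^ j" if "j \<le> k" for j k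
  proof -
    \<comment> \<open>The midpoint of two almost minimisers stays in \<open>E\<close>, where
      \<open>J\<close> is at least \<open>m\<close>, so the parallelogram law forces them together.
      The exponent \<open>Suc k\<close> in the choice of \<open>e k\<close> absorbs the factor 4
      that this costs.\<close>
    have "(\<lambda>x. (1/2) *\<^sub>R (e k x + e j x), (1/2) * (l k + l j)) \<in> E"
      using scale[OF add[OF el(1) el(1)]] .
    from m_le[OF this] have "m \<le> N (\<lambda>x. e k x + e j x) / 4 - (l k + l j)"
      by (simp add: N_def power_mult_distrib power2_eq_square add_divide_distrib)
    moreover have "N (\<lambda>x. e k x - e j x) + N (\<lambda>x. e k x + e j x) = 2 * N (e k) + 2 * N (e j)"
      using integral_cmod_add_scaleR[OF e e, of k 1 j] integral_cmod_add_scaleR[OF e e, of k "-1" j]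
      by (simp add: N_def)
    moreover have "(1/4 :: real) ^ k \<le> (1/4) ^ j" using that by (intro power_decreasing) auto
    ultimately show ?thesis using el(2)[of k] el(2)[of j] unfolding power_Suc by linarith
  qed
  obtain u where u: "square_integrable M u" and lim: "\<And>j. N (\<lambda>x. u x - e j x) \<le> (1/4) ^ j"
    using square_integrable_limit[OF e cauchy[unfolded N_def]] unfolding N_def by metis
  show thesis
  proof
    show "square_integrable M u" by (fact u)
  next
    fix g n assume gn: "(g, n) \<in> E"
    have g: "square_integrable M g" using sq[OF gn] .
    have Ng: "0 \<le> N g" by (simp add: N_def)
    define x where "x = (\<integral>x. u x \<bullet> g x \<partial>M) - n"
    have conv: "(\<lambda>k. \<integral>x. e k x \<bullet> g x \<partial>M) \<longlonglongrightarrow> (\<integral>x. u x \<bullet> g x \<partial>M)"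
    proof (rule LIM_zero_cancel, rule Lim_null_comparison)
      show "\<forall>\<^sub>F k in sequentially. norm ((\<integral>x. e k x \<bullet> g x \<partial>M) - (\<integral>x. u x \<bullet> g x \<partial>M)) \<le> (1/2) ^ k * (1 + N g)"
      proof (rule always_eventually, rule allI)
        fix k
        have "(\<integral>x. u x \<bullet> g x \<partial>M) - (\<integral>x. e k x \<bullet> g x \<partial>M) = (\<integral>x. (u x - e k x) \<bullet> g x \<partial>M)"
          by (simp add: inner_diff_left square_integrable_inner u e g)
        moreover have "2 * \<bar>\<integral>x. (u x - e k x) \<bullet> g x \<partial>M\<bar> \<le> N (\<lambda>x. u x - e k x) / (1/2) ^ k + (1/2) ^ k * N g"
          unfolding N_def by (rule inner_integral_le[OF square_integrable_diff[OF u e] g]) simp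
        moreover have "N (\<lambda>x. u x - e k x) / (1/2) ^ k \<le> (1/4) ^ k / (1/2) ^ k"
          by (intro divide_right_mono lim) simp
        moreover have "(1/4 :: real) ^ k / (1/2) ^ k = (1/2) ^ k"
          by (simp add: power_divide[symmetric])
        moreover have "0 \<le> (1/2) ^ k * N g" using Ng by simp
        moreover have "0 \<le> (1/2 :: real) ^ k" by simp
        ultimately show "norm ((\<integral>x. e k x \<bullet> g x \<partial>M) - (\<integral>x. u x \<bullet> g x \<partial>M)) \<le> (1/2) ^ k * (1 + N g)"
          unfolding real_norm_def distrib_left by linarith
      qed
      have "(\<lambda>k. (1/2) ^ k * (1 + N g)) \<longlonglongrightarrow> 0 * (1 + N g)"
        by (intro tendsto_mult LIMSEQ_power_zero tendsto_const) simp
      then show "(\<lambda>k. (1/2) ^ k * (1 + N g)) \<longlonglongrightarrow> 0" by simp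
    qed
    \<comment> \<open>First variation: moving from \<open>e k\<close> by \<open>t\<close> times
      \<open>g\<close> cannot push \<open>J\<close> below \<open>m\<close>. In the limit a quadratic
      in \<open>t\<close> without constant term is nonnegative, so its linear coefficient
      \<open>x\<close> must vanish.\<close>
    have quad: "0 \<le> 2 * t * x + t\<^sup>2 * N g" for t
    proof (rule LIMSEQ_le)
      show "(\<lambda>k. - ((1/4) ^ Suc k)) \<longlonglongrightarrow> (0::real)"
        using tendsto_minus[OF LIMSEQ_Suc[OF LIMSEQ_power_zero[of "1/4 :: real"]]] by simp
      show "(\<lambda>k. 2 * t * ((\<integral>x. e k x \<bullet> g x \<partial>M) - n) + t\<^sup>2 * N g) \<longlonglongrightarrow> 2 * t * x + t\<^sup>2 * N g"
        unfolding x_def by (intro tendsto_intros conv)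
      have "- ((1/4) ^ Suc k) \<le> 2 * t * ((\<integral>x. e k x \<bullet> g x \<partial>M) - n) + t\<^sup>2 * N g" for k
      proof -
        have "m \<le> N (\<lambda>x. e k x + t *\<^sub>R g x) - 2 * (l k + t * n)"
          by (rule m_le[OF add[OF el(1) scale[OF gn]]])
        then show ?thesis
          using el(2)[of k] integral_cmod_add_scaleR[OF e g, of k t] unfolding N_def
          by (simp add: algebra_simps)
      qed
      then show "\<exists>N'. \<forall>k\<ge>N'. - ((1/4) ^ Suc k) \<le> 2 * t * ((\<integral>x. e k x \<bullet> g x \<partial>M) - n) + t\<^sup>2 * N g" by blast
    qed
    have "x = 0"
    proof -
      \<comment> \<open>The added 1 keeps the test value \<open>t = - x / y\<close> meaningful when
        \<open>N g = 0\<close>.\<close>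
      define y where "y = N g + 1"
      have y: "y > 0" using Ng by (simp add: y_def)
      have "0 \<le> (2 * (- x / y) * x + (- x / y)\<^sup>2 * N g) * y\<^sup>2"
        by (intro mult_nonneg_nonneg quad) simp
      also have "\<dots> = - 2 * x\<^sup>2 * y + x\<^sup>2 * N g"
        using y by (simp add: power2_eq_square field_simps)
      also have "\<dots> = - (x\<^sup>2 * (N g + 2))" by (simp add: y_def algebra_simps)
      finally show ?thesis using Ng by (simp add: mult_le_0_iff)
    qed
    then show "(\<integral>x. u x \<bullet> g x \<partial>M) = n" by (simp add: x_def)
  qed
qed

section \<open>Completeness of the trigonometric system\<close>

lemma power_int_borel [measurable]: "(\<lambda>z::complex. z powi n) \<in> borel_measurable circle"
  using power_int_measurable by simp

lemma cis_borel [measurable]: "cis \<in> borel_measurable borel"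
  by (intro borel_measurable_continuous_onI continuous_intros)

lemma nn_integral_circle:
  assumes [measurable]: "f \<in> borel_measurable borel"
  shows "(\<integral>\<^sup>+z. f z \<partial>circle) = (\<integral>\<^sup>+x. indicator {-pi<..pi} x * f (cis x) \<partial>lborel) / ennreal (2 * pi)"
proof -
  have "(\<integral>\<^sup>+z. f z \<partial>circle) = (\<integral>\<^sup>+x. f (cis x) \<partial>uniform_measure lborel {-pi<..pi})"
    unfolding circle_def by (rule nn_integral_distr[OF cis_measurable]) simp
  also have "\<dots> = (\<integral>\<^sup>+x. f (cis x) * indicator {-pi<..pi} x \<partial>lborel) / emeasure lborel {-pi<..pi}"
    by (rule nn_integral_uniform_measure) auto
  finally show ?thesis by (simp add: mult.commute)
qed

lemma integral_circle:
  fixes f :: "complex \<Rightarrow> complex"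
  assumes [measurable]: "f \<in> borel_measurable borel"
  shows "(\<integral>z. f z \<partial>circle) = (\<integral>x. indicator {-pi<..pi} x *\<^sub>R f (cis x) \<partial>lborel) / (2 * pi)"
proof -
  have "(\<integral>z. f z \<partial>circle) = (\<integral>x. f (cis x) \<partial>uniform_measure lborel {-pi<..pi})"
    unfolding circle_def by (rule integral_distr[OF cis_measurable]) simp
  also have "uniform_measure lborel {-pi<..pi} = density lborel (\<lambda>x. ennreal (indicator {-pi<..pi} x / (2 * pi)))"
    unfolding uniform_measure_def
    by (intro density_cong) (auto simp: divide_ennreal[symmetric] split: split_indicator)
  also have "(\<integral>x. f (cis x) \<partial>\<dots>) = (\<integral>x. (indicator {-pi<..pi} x / (2 * pi)) *\<^sub>R f (cis x) \<partial>lborel)"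
    by (rule integral_density) auto
  also have "\<dots> = (\<integral>x. (1 / (2 * pi)) *\<^sub>R (indicator {-pi<..pi} x *\<^sub>R f (cis x)) \<partial>lborel)"
    by (intro Bochner_Integration.integral_cong) auto
  finally show ?thesis by (simp add: scaleR_conv_of_real del: scaleR_scaleR)
qed

lemma AE_circle_norm: "AE z in circle. cmod z = 1"
  by (subst AE_circle) auto

lemma measure_circle: "measure circle UNIV = 1"
proof -
  have "(\<integral>\<^sup>+z. 1 \<partial>circle) = 1"
    by (subst nn_integral_circle) (auto simp: ennreal_divide_self)
  then show ?thesis by (simp add: measure_def)
qed

lemma integral_circle_power_int: "(\<integral>z. z powi n \<partial>circle) = (if n = 0 then 1 else 0)"
proof (cases "n = 0")
  case True
  then show ?thesis using measure_circle by simp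
next
  case False
  have "(\<integral>x. indicator {-pi..pi} x *\<^sub>R cis (of_int n * x) \<partial>lborel)
      = cis (of_int n * pi) / (\<i> * of_int n) - cis (of_int n * (-pi)) / (\<i> * of_int n)"
  proof (rule integral_FTC_Icc)
    fix x
    have "((\<lambda>x. cis (of_int n * x)) has_vector_derivative (\<i> * of_int n * cis (of_int n * x))) (at x within {-pi..pi})"
    proof -
      have "((\<lambda>w. exp (\<i> * of_int n * w)) has_field_derivative \<i> * of_int n * exp (\<i> * of_int n * of_real x)) (at (of_real x))"
        by (auto intro!: derivative_eq_intros)
      then show ?thesis
        using has_vector_derivative_real_field by (fastforce simp: cis_conv_exp mult.assoc)
    qed
    then have "((\<lambda>x. cis (of_int n * x) / (\<i> * of_int n)) has_vector_derivative (\<i> * of_int n * cis (of_int n * x)) / (\<i> * of_int n)) (at x within {-pi..pi})"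
      by (rule has_vector_derivative_divide)
    then show "((\<lambda>x. cis (of_int n * x) / (\<i> * of_int n)) has_vector_derivative cis (of_int n * x)) (at x within {-pi..pi})"
      using False by simp
  qed (auto intro!: continuous_intros)
  also have "\<dots> = 0"
  proof -
    have "cis (of_int n * pi) = cis (of_int n * (-pi))"
      using sin_npi_int[of n] by (simp add: complex_eq_iff mult.commute)
    then show ?thesis by simp
  qed
  also have "(\<integral>x. indicator {-pi..pi} x *\<^sub>R cis (of_int n * x) \<partial>lborel)
      = (\<integral>x. indicator {-pi<..pi} x *\<^sub>R cis (of_int n * x) \<partial>lborel)"
  proof (rule integral_cong_AE)
    have "AE x in lborel. x \<noteq> -pi" by (rule AE_lborel_singleton)
    then show "AE x in lborel. indicator {-pi..pi} x *\<^sub>R cis (of_int n * x) = indicator {-pi<..pi} x *\<^sub>R cis (of_int n * x)"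
      by eventually_elim (auto split: split_indicator)
  qed measurable
  finally have *: "(\<integral>x. indicator {-pi<..pi} x *\<^sub>R cis (of_int n * x) \<partial>lborel) = 0" .
  have "(\<integral>z. z powi n \<partial>circle) = (\<integral>x. indicator {-pi<..pi} x *\<^sub>R (cis x powi n) \<partial>lborel) / (2 * pi)"
    by (rule integral_circle[OF power_int_measurable])
  then show ?thesis using False * by (simp add: cis_power_int)
qed

lemma square_integrable_imp_integrable:
  assumes "finite_measure M" "square_integrable M f"
  shows "integrable M f"
proof (rule Bochner_Integration.integrable_bound)
  show "integrable M (\<lambda>z. 1 + (cmod (f z))\<^sup>2)"
    using assms by (auto simp: square_integrable_def finite_measure.integrable_const)
  have "cmod (f z) \<le> 1 + (cmod (f z))\<^sup>2" for z
    using sum_squares_bound[of 1 "cmod (f z)"] by simp (smt (verit) zero_le_power2)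
  then show "AE z in M. norm (f z) \<le> norm (1 + (cmod (f z))\<^sup>2)" by simp
qed (use assms in \<open>auto simp: square_integrable_def\<close>)

lemma integrable_circle_bounded_mult:
  fixes f g :: "complex \<Rightarrow> complex"
  assumes "integrable circle f" "g \<in> borel_measurable circle" "AE z in circle. cmod (g z) \<le> c"
  shows "integrable circle (\<lambda>z. f z * g z)"
proof (rule Bochner_Integration.integrable_bound)
  show "integrable circle (\<lambda>z. c * cmod (f z))" using assms(1) by auto
  show "AE z in circle. norm (f z * g z) \<le> norm (c * cmod (f z))"
    using assms(3)
  proof eventually_elim
    case (elim z)
    have "cmod (f z * g z) \<le> c * cmod (f z)"
      unfolding norm_mult using mult_right_mono[OF elim norm_ge_zero] by (simp add: mult.commute)
    then show ?case by (simp only: real_norm_def abs_ge_self order.trans[OF _ abs_ge_self])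
  qed
qed (use assms in auto)

text \<open>Multiplying by a polynomial in \<open>Re z\<close>, \<open>Im z\<close> preserves the vanishing of all Fourier
  coefficients, since \<open>Re z\<close> and \<open>Im z\<close> are trigonometric polynomials on the circle.\<close>

lemma fourier_vanish_polynomial:
  assumes "real_polynomial_function (g :: complex \<Rightarrow> real)"
  shows "integrable circle h \<Longrightarrow> (\<And>n::int. (\<integral>z. h z * z powi n \<partial>circle) = 0) \<Longrightarrow>
    integrable circle (\<lambda>z. h z * of_real (g z)) \<and> (\<forall>n::int. (\<integral>z. h z * of_real (g z) * z powi n \<partial>circle) = 0)"
  using assms
\<comment> \<open>\<open>h\<close> varies because the product case applies the hypothesis for the
  second factor to \<open>h\<close> times the first factor.\<close>
proof (induction g arbitrary: h rule: real_polynomial_function.induct)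
  have pint: "integrable circle (\<lambda>z. h z * z powi k)" if "integrable circle h" for h k
    using AE_circle_norm by (intro integrable_circle_bounded_mult[OF that, of _ 1]) (auto simp: norm_power_int)
  {
    case (linear f)
    \<comment> \<open>A real linear \<open>f\<close> has the form \<open>a * z + b * cnj z\<close>,
      and on the circle \<open>cnj z\<close> is \<open>z powi (-1)\<close>. So multiplication by
      \<open>f\<close> only shifts the order of a coefficient by 1 in either direction.\<close>
    define a where "a = (of_real (f 1) - \<i> * of_real (f \<i>)) / 2"
    define b where "b = (of_real (f 1) + \<i> * of_real (f \<i>)) / 2"
    have fz: "f z = Re z * f 1 + Im z * f \<i>" for z
    proof -
      interpret bounded_linear f by fact
      have "z = Re z *\<^sub>R 1 + Im z *\<^sub>R \<i>" by (simp add: complex_eq_iff)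
      then have "f z = f (Re z *\<^sub>R 1 + Im z *\<^sub>R \<i>)" by simp
      then show ?thesis by (simp add: add scaleR)
    qed
    have eq: "of_real (f z) = a * z + b * z powi (-1)" if "cmod z = 1" for z
    proof -
      have "z powi (-1) = cnj z"
        using that by (simp add: power_int_minus inverse_complex_def complex_eq_iff cmod_def)
      show ?thesis unfolding \<open>z powi (-1) = cnj z\<close> by (simp add: a_def b_def fz[of z] complex_eq_iff field_simps)
    qed
    have [measurable]: "f \<in> borel_measurable borel"
      using linear(1) by (intro borel_measurable_continuous_onI linear_continuous_on)
    have [measurable]: "h \<in> borel_measurable circle" using linear by auto
    have ae: "AE z in circle. h z * of_real (f z) * z powi n = a * (h z * z powi (1 + n)) + b * (h z * z powi (-1 + n))" for n
      using AE_circle_norm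
    proof eventually_elim
      case (elim z)
      then have "z \<noteq> 0" by auto
      then show ?case
        by (simp only: eq[OF elim] power_int_add simp_thms power_int_1_right) (simp add: algebra_simps)
    qed
    have int2: "integrable circle (\<lambda>z. a * (h z * z powi (1 + n)) + b * (h z * z powi (-1 + n)))" for n
      by (intro Bochner_Integration.integrable_add integrable_mult_right pint linear)
    show ?case
    proof (intro conjI allI)
      show "integrable circle (\<lambda>z. h z * of_real (f z))"
        using ae[of 0] int2[of 0] by (subst integrable_cong_AE[of _ _ "\<lambda>z. a * (h z * z powi (1 + 0)) + b * (h z * z powi (-1 + 0))"]) auto
      fix n
      have "(\<integral>z. h z * of_real (f z) * z powi n \<partial>circle) = (\<integral>z. a * (h z * z powi (1 + n)) + b * (h z * z powi (-1 + n)) \<partial>circle)"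
        using ae[of n] by (intro integral_cong_AE) auto
      also have "\<dots> = 0"
        by (subst Bochner_Integration.integral_add) (auto simp only: integral_mult_right_zero linear mult_zero_right add_0 intro!: integrable_mult_right pint linear)
      finally show "(\<integral>z. h z * of_real (f z) * z powi n \<partial>circle) = 0" .
    qed
  next
    case (const c)
    have "(\<integral>z. h z * of_real c * z powi n \<partial>circle) = of_real c * (\<integral>z. h z * z powi n \<partial>circle)" for n :: int
      by (subst integral_mult_right_zero[symmetric]) (simp add: mult_ac)
    then show ?case using const by auto
  next
    case (add f g)
    have 1: "integrable circle (\<lambda>z. h z * of_real (f z))" "integrable circle (\<lambda>z. h z * of_real (g z))"
      "\<And>n::int. (\<integral>z. h z * of_real (f z) * z powi n \<partial>circle) = 0"
      "\<And>n::int. (\<integral>z. h z * of_real (g z) * z powi n \<partial>circle) = 0"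
      using add by blast+
    show ?case
      using 1 Bochner_Integration.integral_add[OF pint[OF 1(1)] pint[OF 1(2)]]
      by (simp add: distrib_left distrib_right)
  next
    case (mult f g)
    have 1: "integrable circle (\<lambda>z. h z * of_real (f z))"
      "\<And>n::int. (\<integral>z. h z * of_real (f z) * z powi n \<partial>circle) = 0"
      using mult by blast+
    show ?case using mult.IH(2)[OF 1] by (simp add: mult.assoc)
  }
qed

text \<open>By Stone-Weierstrass a polynomial lies uniformly within \<open>e\<close> of
  \<open>g\<close> on the circle, and the error costs at most \<open>e\<close> times the L1 norm of
  \<open>h\<close>.\<close>

lemma fourier_vanish_continuous:
  fixes g :: "complex \<Rightarrow> real"
  assumes h: "integrable circle h" and van: "\<And>n::int. (\<integral>z. h z * z powi n \<partial>circle) = 0"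
    and g: "continuous_on UNIV g"
  shows "(\<integral>z. h z * of_real (g z) \<partial>circle) = 0"
proof -
  have [measurable]: "h \<in> borel_measurable borel" using h by auto
  have [measurable]: "g \<in> borel_measurable borel" using g by (rule borel_measurable_continuous_onI)
  have "cmod (\<integral>z. h z * of_real (g z) \<partial>circle) \<le> e * (\<integral>z. cmod (h z) \<partial>circle)" if "e > 0" for e
  proof -
    obtain p where p: "real_polynomial_function p" "\<And>z. z \<in> sphere 0 1 \<Longrightarrow> \<bar>g z - p z\<bar> < e"
      using Stone_Weierstrass_real_polynomial_function[OF compact_sphere continuous_on_subset[OF g subset_UNIV] \<open>e > 0\<close>, of 0 1]
      by blast
    have [measurable]: "p \<in> borel_measurable borel"
      using p(1) continuous_on_polymonial_function[of p UNIV]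
      by (intro borel_measurable_continuous_onI) (simp only: real_polynomial_function_eq)
    have int_p: "integrable circle (\<lambda>z. h z * of_real (p z))"
      and van_p: "(\<integral>z. h z * of_real (p z) * z powi 0 \<partial>circle) = 0"
      using fourier_vanish_polynomial[OF p(1) h van] by blast+
    have bd: "AE z in circle. cmod (h z * of_real (g z - p z)) \<le> e * cmod (h z)"
      using AE_circle_norm
    proof eventually_elim
      case (elim z)
      then have "cmod (of_real (g z - p z)) \<le> e" using p(2)[of z] by (simp flip: of_real_diff)
      then show ?case unfolding norm_mult by (metis mult.commute mult_right_mono norm_ge_zero)
    qed
    have int: "integrable circle (\<lambda>z. h z * of_real (g z - p z))"
    proof (rule Bochner_Integration.integrable_bound)
      show "integrable circle (\<lambda>z. e * cmod (h z))" using h by auto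
      show "AE z in circle. norm (h z * of_real (g z - p z)) \<le> norm (e * cmod (h z))"
        using bd
      proof eventually_elim
        case (elim z)
        then show ?case by (simp only: real_norm_def order.trans[OF _ abs_ge_self])
      qed
    qed measurable
    have "(\<integral>z. h z * of_real (g z) \<partial>circle) = (\<integral>z. h z * of_real (g z - p z) + h z * of_real (p z) \<partial>circle)"
      by (simp add: algebra_simps)
    also have "\<dots> = (\<integral>z. h z * of_real (g z - p z) \<partial>circle)"
      using van_p unfolding Bochner_Integration.integral_add[OF int int_p] by simp
    also have "cmod \<dots> \<le> (\<integral>z. e * cmod (h z) \<partial>circle)"
      using h bd by (intro order.trans[OF integral_norm_bound integral_mono_AE] integrable_norm int) auto
    finally show ?thesis by simp
  qed note bd = this
  have "(\<lambda>n. inverse (real (Suc n)) * (\<integral>z. cmod (h z) \<partial>circle)) \<longlonglongrightarrow> 0 * (\<integral>z. cmod (h z) \<partial>circle)"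
    by (intro tendsto_intros LIMSEQ_inverse_real_of_nat)
  then have "cmod (\<integral>z. h z * of_real (g z) \<partial>circle) \<le> 0 * (\<integral>z. cmod (h z) \<partial>circle)"
    by (rule LIMSEQ_le_const) (metis bd inverse_positive_iff_positive of_nat_0_less_iff zero_less_Suc)
  then show ?thesis by simp
qed

text \<open>The continuous functions \<open>max 0 (1 - real k * infdist z C)\<close> tend to the
  indicator of a closed set \<open>C\<close>. Closed sets are stable under intersection and generate
  the Borel sets, so \<open>h\<close> integrates to 0 over every Borel set.\<close>

lemma fourier_vanish_AE_zero:
  assumes h: "integrable circle h" and van: "\<And>n::int. (\<integral>z. h z * z powi n \<partial>circle) = 0"
  shows "AE z in circle. h z = 0"
proof -
  have [measurable]: "h \<in> borel_measurable borel" using h by auto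
  have closed: "(LINT z:C|circle. h z) = 0" if "closed C" for C
  proof (cases "C = {}")
    case False
    define g where "g k z = max 0 (1 - real k * infdist z C)" for k and z :: complex
    have g: "continuous_on UNIV (g k)" for k
      unfolding g_def by (intro continuous_intros)
    have [measurable]: "g k \<in> borel_measurable borel" for k using g by (rule borel_measurable_continuous_onI)
    have [measurable]: "C \<in> sets borel" using that by simp
    have "(\<lambda>k. \<integral>z. h z * of_real (g k z) \<partial>circle) \<longlonglongrightarrow> (\<integral>z. indicator C z *\<^sub>R h z \<partial>circle)"
    proof (rule integral_dominated_convergence[where w="\<lambda>z. cmod (h z)"])
      have "g k z \<le> 1" "0 \<le> g k z" for k z by (auto simp: g_def infdist_nonneg)
      then show "AE z in circle. norm (h z * of_real (g k z)) \<le> cmod (h z)" for k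
        by (auto simp: norm_mult mult_left_le)
      have "(\<lambda>k. g k z) \<longlonglongrightarrow> indicator C z" for z
      proof (cases "z \<in> C")
        case True
        then show ?thesis by (simp add: g_def)
      next
        case no: False
        then have pos: "infdist z C > 0"
          using that False in_closed_iff_infdist_zero infdist_nonneg[of z C] by (metis order_less_le)
        obtain K where K: "1 < real K * infdist z C" using pos reals_Archimedean3 by blast
        have "\<forall>\<^sub>F k in sequentially. g k z = indicator C z"
          using eventually_ge_at_top[of K]
        proof eventually_elim
          case (elim k)
          then have "real K * infdist z C \<le> real k * infdist z C" using pos by (intro mult_right_mono) auto
          then show ?case using K no by (simp add: g_def)
        qed
        then show ?thesis by (rule tendsto_eventually)
      qed
      then have "(\<lambda>k. h z * of_real (g k z)) \<longlonglongrightarrow> h z * of_real (indicator C z)" for z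
        by (intro tendsto_intros)
      then show "AE z in circle. (\<lambda>k. h z * of_real (g k z)) \<longlonglongrightarrow> indicator C z *\<^sub>R h z"
        by (simp add: scaleR_conv_of_real mult.commute)
    qed (use h in auto)
    then show ?thesis
      using fourier_vanish_continuous[OF h van g] by (simp add: set_lebesgue_integral_def LIMSEQ_const_iff)
  qed (simp add: set_lebesgue_integral_def)
  have int: "set_integrable circle A h" if "A \<in> sets borel" for A
    using that h unfolding set_integrable_def by (intro integrable_mult_indicator) auto
  have van_set: "(LINT z:A|circle. h z) = 0" if "A \<in> sets borel" for A
  proof -
    have "Int_stable (Collect closed :: complex set set)" by (auto simp: Int_stable_def)
    moreover have "Collect closed \<subseteq> Pow (UNIV :: complex set)" by auto
    moreover have "A \<in> sigma_sets UNIV (Collect closed)"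
      using that by (simp add: borel_eq_closed)
    ultimately show ?thesis
    proof (induction A rule: sigma_sets_induct_disjoint[where G="Collect closed" and \<Omega>=UNIV])
      case (basic A)
      then show ?case using closed by simp
    next
      case empty
      show ?case by (simp add: set_lebesgue_integral_def)
    next
      case (compl A)
      then have A: "A \<in> sets borel" by (simp add: borel_eq_closed)
      have "(LINT z:A \<union> (UNIV - A)|circle. h z) = (LINT z:A|circle. h z) + (LINT z:(UNIV - A)|circle. h z)"
        using A by (intro set_integral_Un int) auto
      then show ?case using compl closed[of UNIV] by (simp add: Un_Diff_cancel)
    next
      case (union A)
      then have A: "A i \<in> sets borel" for i by (auto simp: borel_eq_closed)
      have "(LINT z:(\<Union>i. A i)|circle. h z) = (\<Sum>i. (LINT z:(A i)|circle. h z))"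
        using A union(1) by (intro lebesgue_integral_countable_add int) (auto simp: disjoint_family_on_def)
      then show ?case using union by simp
    qed
  qed
  have part: "AE z in circle. f (h z) = 0" if "bounded_linear f" for f :: "complex \<Rightarrow> real"
  proof (rule density_unique_real)
    show "integrable circle (\<lambda>z. f (h z))" using that h by (rule integrable_bounded_linear)
    fix A assume A: "A \<in> sets circle"
    interpret bounded_linear f by fact
    have "(LINT z:A|circle. f (h z)) = (\<integral>z. f (indicator A z *\<^sub>R h z) \<partial>circle)"
      by (simp add: set_lebesgue_integral_def scaleR)
    also have "\<dots> = f (LINT z:A|circle. h z)"
      unfolding set_lebesgue_integral_def
      using int[of A] A by (intro integral_bounded_linear that) (simp add: set_integrable_def)
    finally show "(LINT z:A|circle. f (h z)) = (LINT z:A|circle. 0)"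
      using van_set[of A] A by (simp add: set_lebesgue_integral_def)
  qed auto
  show ?thesis
    using part[OF bounded_linear_Re] part[OF bounded_linear_Im]
    by eventually_elim (simp add: complex_eq_iff)
qed

section \<open>Fourier multipliers\<close>

lemma AE_circle_power_int_norm: "AE z in circle. cmod (z powi n) = 1"
  using AE_circle_norm by eventually_elim (simp add: norm_power_int)

lemma square_integrable_monomial: "square_integrable circle (\<lambda>z. c * z powi n)"
  unfolding square_integrable_def
proof
  have "AE z in circle. (cmod c)\<^sup>2 = (cmod (c * z powi n))\<^sup>2"
    using AE_circle_power_int_norm[of n] by eventually_elim (simp add: norm_mult)
  then show "integrable circle (\<lambda>z. (cmod (c * z powi n))\<^sup>2)"
    by (subst integrable_cong_AE[of _ _ "\<lambda>z. (cmod c)\<^sup>2"]) auto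
qed measurable

definition monomial :: "complex \<Rightarrow> int \<Rightarrow> L2"
  where "monomial c n = L2_class (\<lambda>z. c * z powi n)"

lemma fourier_coeff_L2_class:
  "square_integrable circle f \<Longrightarrow> fourier_coeff (L2_class f) n = (\<integral>z. f z * z powi (- n) \<partial>circle)"
  by (transfer fixing: f n) simp

lemma inner_L2_class:
  "square_integrable circle f \<Longrightarrow> square_integrable circle g \<Longrightarrow>
    L2_class f \<bullet> L2_class g = (\<integral>z. f z \<bullet> g z \<partial>circle)"
  by (transfer fixing: f g) simp

lemma integrable_circle_times_power_int:
  "square_integrable circle f \<Longrightarrow> integrable circle (\<lambda>z. f z * z powi n)"
  using AE_circle_power_int_norm[of n] square_integrable_imp_integrable[OF finite_measure_circle]
  by (intro integrable_circle_bounded_mult[of _ _ 1]) auto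

lemma inner_monomial: "F \<bullet> monomial c n = fourier_coeff F n \<bullet> c"
proof -
  obtain f where f: "square_integrable circle f" and F: "F = L2_class f"
    by (rule L2_class_cases)
  have [measurable]: "f \<in> borel_measurable circle" using f by (rule square_integrable_measurable)
  have "F \<bullet> monomial c n = (\<integral>z. f z \<bullet> (c * z powi n) \<partial>circle)"
    by (simp add: F monomial_def inner_L2_class[OF f square_integrable_monomial])
  also have "\<dots> = (\<integral>z. (f z * z powi (- n)) \<bullet> c \<partial>circle)"
  proof (rule integral_cong_AE)
    show "AE z in circle. f z \<bullet> (c * z powi n) = (f z * z powi (- n)) \<bullet> c"
      using AE_circle_norm
    proof eventually_elim
      case (elim z)
      then have "cnj z = inverse z" by (simp add: inverse_complex_def complex_eq_iff cmod_def)
      then have "z powi (- n) = cnj (z powi n)" by (simp add: power_int_minus power_int_inverse)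
      moreover have "f z \<bullet> (c * w) = (f z * cnj w) \<bullet> c" for w
        by (simp add: inner_complex_def algebra_simps)
      ultimately show ?case by (simp only:)
    qed
  qed measurable
  also have "\<dots> = (\<integral>z. f z * z powi (- n) \<partial>circle) \<bullet> c"
    by (intro integral_bounded_linear[OF bounded_linear_inner_left] integrable_circle_times_power_int f)
  finally show ?thesis by (simp add: F fourier_coeff_L2_class[OF f])
qed

text \<open>The inner product of \<open>L2\<close> is real, so a complex coefficient takes two
  pairings, in the directions 1 and \<i>. Continuity of the coefficient follows from this
  form.\<close>

lemma fourier_coeff_eq_inner:
  "fourier_coeff F n = of_real (F \<bullet> monomial 1 n) + \<i> * of_real (F \<bullet> monomial \<i> n)"
  by (simp add: inner_monomial complex_eq_iff inner_complex_def)

lemma bounded_linear_fourier_coeff: "bounded_linear (\<lambda>F. fourier_coeff F n)"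
  unfolding fourier_coeff_eq_inner
  by (intro bounded_linear_add bounded_linear_const_mult bounded_linear_compose[OF bounded_linear_of_real] bounded_linear_inner_left)

lemma fourier_coeff_linear:
  "fourier_coeff (F + G) n = fourier_coeff F n + fourier_coeff G n"
  "fourier_coeff (F - G) n = fourier_coeff F n - fourier_coeff G n"
  "fourier_coeff 0 n = 0"
  "fourier_coeff (r *\<^sub>R F) n = r *\<^sub>R fourier_coeff F n"
proof -
  interpret bounded_linear "\<lambda>F. fourier_coeff F n" by (rule bounded_linear_fourier_coeff)
  show "fourier_coeff (F + G) n = fourier_coeff F n + fourier_coeff G n"
    "fourier_coeff (F - G) n = fourier_coeff F n - fourier_coeff G n"
    "fourier_coeff 0 n = 0"
    "fourier_coeff (r *\<^sub>R F) n = r *\<^sub>R fourier_coeff F n"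
    by (rule add, rule diff, rule zero, rule scaleR)
qed

lemma fourier_coeff_monomial: "fourier_coeff (monomial c m) n = (if m = n then c else 0)"
proof -
  have "AE z in circle. c * z powi m * z powi (- n) = c * z powi (m - n)"
    using AE_circle_norm
  proof eventually_elim
    case (elim z)
    then have "z \<noteq> 0" by auto
    then show ?case by (simp add: power_int_diff power_int_minus field_simps)
  qed
  then have "(\<integral>z. c * z powi m * z powi (- n) \<partial>circle) = (\<integral>z. c * z powi (m - n) \<partial>circle)"
    by (intro integral_cong_AE) auto
  then show ?thesis
    by (simp add: monomial_def fourier_coeff_L2_class square_integrable_monomial integral_circle_power_int)
qed

text \<open>Completeness of the trigonometric system, in the form that lets a state vanish exactly
  when all its coefficients do. This is what makes null-controllability equivalent to a moment
  problem.\<close>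

lemma fourier_coeff_eq_imp_eq:
  assumes "\<And>n. fourier_coeff F n = fourier_coeff G n"
  shows "F = G"
proof -
  obtain h where h: "square_integrable circle h" and FG: "F - G = L2_class h"
    by (rule L2_class_cases)
  have van: "(\<integral>z. h z * z powi n \<partial>circle) = 0" for n
    using fourier_coeff_linear(2)[of F G "- n"] assms[of "- n"]
    by (simp add: FG fourier_coeff_L2_class[OF h])
  have "AE z in circle. h z = 0"
    by (rule fourier_vanish_AE_zero[OF square_integrable_imp_integrable[OF finite_measure_circle h] van])
  then have "L2_class h = L2_class (\<lambda>_. 0)"
    by (simp add: L2_class_eq_iff h square_integrable_zero)
  moreover have "L2_class (\<lambda>_. 0) = 0"
    by transfer (simp add: circle_eq_def square_integrable_zero)
  ultimately show ?thesis using FG by simp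
qed

lemma bounded_linear_monomial: "bounded_linear (\<lambda>c. monomial c n)"
proof (rule bounded_linear_intro[where K=1])
  show "monomial (c + d) n = monomial c n + monomial d n" for c d
    by (rule fourier_coeff_eq_imp_eq) (simp add: fourier_coeff_linear fourier_coeff_monomial)
  show "monomial (r *\<^sub>R c) n = r *\<^sub>R monomial c n" for r c
    by (rule fourier_coeff_eq_imp_eq) (simp add: fourier_coeff_linear fourier_coeff_monomial)
  show "norm (monomial c n) \<le> norm c * 1" for c
    by (simp add: norm_eq_sqrt_inner inner_monomial fourier_coeff_monomial)
qed

lemma monomial_zero: "monomial 0 n = 0"
  by (rule fourier_coeff_eq_imp_eq) (simp add: fourier_coeff_linear fourier_coeff_monomial)

lemma norm_monomial: "norm (monomial c n) = cmod c"
  by (simp add: norm_eq_sqrt_inner inner_monomial fourier_coeff_monomial)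

lemma norm_sum_monomial:
  assumes "finite I"
  shows "(norm (\<Sum>n\<in>I. monomial (c n) n))\<^sup>2 = (\<Sum>n\<in>I. (cmod (c n))\<^sup>2)"
  using assms
  by (subst norm_sum_Pythagorean)
    (auto simp: pairwise_def orthogonal_def inner_monomial fourier_coeff_monomial norm_monomial)

lemma bessel_inequality:
  assumes "finite I"
  shows "(\<Sum>n\<in>I. (cmod (fourier_coeff F n))\<^sup>2) \<le> (norm F)\<^sup>2"
proof -
  let ?S = "\<Sum>n\<in>I. monomial (fourier_coeff F n) n"
  have "0 \<le> (norm (F - ?S))\<^sup>2" by simp
  also have "\<dots> = (norm F)\<^sup>2 - 2 * (F \<bullet> ?S) + (norm ?S)\<^sup>2"
    by (simp add: power2_norm_eq_inner inner_diff inner_commute)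
  also have "F \<bullet> ?S = (\<Sum>n\<in>I. (cmod (fourier_coeff F n))\<^sup>2)"
    by (simp add: inner_sum_right inner_monomial power2_norm_eq_inner)
  finally show ?thesis using norm_sum_monomial[OF assms, of "fourier_coeff F"] by simp
qed

lemma summable_fourier_coeff: "(\<lambda>n. (cmod (fourier_coeff F n))\<^sup>2) summable_on UNIV"
  by (rule nonneg_bdd_above_summable_on)
    (auto simp: bdd_above_def intro: bessel_inequality)

text \<open>Riesz-Fischer. Monomials of distinct orders are orthogonal, so distances between finite
  partial sums are read off from the numerical series; the sums are unconditional, hence the Cauchy
  filter on finite sets.\<close>

lemma summable_monomials:
  assumes "(\<lambda>n. (cmod (c n))\<^sup>2) summable_on UNIV"
  shows "(\<lambda>n. monomial (c n) n) summable_on UNIV"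
proof -
  let ?S = "sum (\<lambda>n. monomial (c n) n)"
  let ?a = "sum (\<lambda>n. (cmod (c n))\<^sup>2)"
  obtain s where s: "(?a \<longlongrightarrow> s) (finite_subsets_at_top UNIV)"
    using assms by (auto simp: summable_on_def has_sum_def)
  have "cauchy_filter (filtermap ?S (finite_subsets_at_top UNIV))"
    unfolding cauchy_filter_metric
  proof (intro allI impI)
    fix e :: real assume e: "0 < e"
    \<comment> \<open>Two numerical sums within \<open>d\<close> of \<open>s\<close> differ by less
      than \<open>2 * d = (e / 2)\<^sup>2\<close>, and that difference is a squared distance in
      \<open>L2\<close>.\<close>
    define d where "d = (e / 2)\<^sup>2 / 2"
    have "d > 0" using e by (simp add: d_def)
    then have "\<exists>I. finite I \<and> (\<forall>J. finite J \<and> I \<subseteq> J \<longrightarrow> dist (?a J) s < d)"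
      using tendstoD[OF s \<open>d > 0\<close>] unfolding eventually_finite_subsets_at_top by simp
    then obtain I where I: "finite I" "\<And>J. finite J \<Longrightarrow> I \<subseteq> J \<Longrightarrow> dist (?a J) s < d" by blast
    have close: "dist (?S J) (?S I) < e / 2" if J: "finite J" "I \<subseteq> J" for J
    proof -
      have "(norm (?S J - ?S I))\<^sup>2 = ?a J - ?a I"
        using J by (simp add: sum_diff[symmetric] I(1) norm_sum_monomial)
      also have "\<dots> < 2 * d"
        using I(2)[OF J] I(2)[OF I(1)] by (simp add: dist_real_def)
      also have "\<dots> = (e / 2)\<^sup>2" by (simp add: d_def)
      finally show ?thesis
        unfolding dist_norm by (rule power_less_imp_less_base) (use e in simp)
    qed
    have "eventually (\<lambda>J. finite J \<and> I \<subseteq> J) (finite_subsets_at_top UNIV)"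
      using I(1) unfolding eventually_finite_subsets_at_top by auto
    then have "eventually (\<lambda>x. dist x (?S I) < e / 2) (filtermap ?S (finite_subsets_at_top UNIV))"
      unfolding eventually_filtermap by eventually_elim (use close in auto)
    then show "\<exists>P. eventually P (filtermap ?S (finite_subsets_at_top UNIV)) \<and> (\<forall>x y. P x \<and> P y \<longrightarrow> dist x y < e)"
      by (intro exI[of _ "\<lambda>x. dist x (?S I) < e / 2"] conjI) (auto intro: dist_triangle_half_l)
  qed
  moreover have "filtermap ?S (finite_subsets_at_top UNIV) \<noteq> bot"
    by (simp add: filtermap_bot_iff)
  ultimately obtain x where "filtermap ?S (finite_subsets_at_top UNIV) \<le> nhds x"
    using cauchy_filter_complete_converges[OF _ complete_UNIV] by auto
  then show ?thesis
    by (auto simp: summable_on_def has_sum_def filterlim_def)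
qed

lemma fourier_coeff_infsum_monomials:
  assumes "(\<lambda>n. (cmod (c n))\<^sup>2) summable_on UNIV"
  shows "fourier_coeff (\<Sum>\<^sub>\<infinity>n. monomial (c n) n) m = c m"
proof -
  have "fourier_coeff (\<Sum>\<^sub>\<infinity>n. monomial (c n) n) m = (\<Sum>\<^sub>\<infinity>n. fourier_coeff (monomial (c n) n) m)"
    using has_sum_bounded_linear[OF bounded_linear_fourier_coeff has_sum_infsum[OF summable_monomials[OF assms]]]
    by (metis infsumI)
  also have "\<dots> = (\<Sum>\<^sub>\<infinity>n\<in>{m}. c n)"
    by (rule infsum_cong_neutral) (auto simp: fourier_coeff_monomial)
  finally show ?thesis by simp
qed

lemma fourier_series: "((\<lambda>n. monomial (fourier_coeff F n) n) has_sum F) UNIV"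
proof -
  have "(\<Sum>\<^sub>\<infinity>n. monomial (fourier_coeff F n) n) = F"
    by (rule fourier_coeff_eq_imp_eq) (rule fourier_coeff_infsum_monomials[OF summable_fourier_coeff])
  then show ?thesis
    using summable_monomials[OF summable_fourier_coeff, of F] by (simp add: has_sum_iff)
qed

lemma norm_le_if_fourier_coeff_le:
  assumes "\<And>n. cmod (fourier_coeff F n) \<le> cmod (fourier_coeff G n)"
  shows "norm F \<le> norm G"
proof -
  have "(sum (\<lambda>n. monomial (fourier_coeff F n) n) \<longlongrightarrow> F) (finite_subsets_at_top UNIV)"
    using fourier_series[of F] by (simp add: has_sum_def)
  then have "((\<lambda>I. norm (\<Sum>n\<in>I. monomial (fourier_coeff F n) n)) \<longlongrightarrow> norm F) (finite_subsets_at_top UNIV)"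
    by (rule tendsto_norm)
  moreover have "norm (\<Sum>n\<in>I. monomial (fourier_coeff F n) n) \<le> norm G" if "finite I" for I
  proof (rule power2_le_imp_le)
    have "(\<Sum>n\<in>I. (cmod (fourier_coeff F n))\<^sup>2) \<le> (\<Sum>n\<in>I. (cmod (fourier_coeff G n))\<^sup>2)"
      by (intro sum_mono power_mono assms) auto
    then show "(norm (\<Sum>n\<in>I. monomial (fourier_coeff F n) n))\<^sup>2 \<le> (norm G)\<^sup>2"
      using bessel_inequality[OF that, of G] by (simp add: norm_sum_monomial[OF that])
  qed simp
  then have "eventually (\<lambda>I. norm (\<Sum>n\<in>I. monomial (fourier_coeff F n) n) \<le> norm G) (finite_subsets_at_top UNIV)"
    by (intro eventually_finite_subsets_at_top_weakI) auto
  ultimately show ?thesis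
    by (intro tendsto_upperbound) auto
qed

text \<open>The symmetric partial sums of the Fourier series are measurable and converge pointwise.
  This provides the measurability of the integrand in the Bochner integral of
  \<open>mild_solution\<close>.\<close>

lemma L2_measurable_if_fourier_coeff_measurable:
  assumes [measurable]: "\<And>n. (\<lambda>s. fourier_coeff (H s) n) \<in> borel_measurable M"
  shows "H \<in> borel_measurable M"
proof (rule borel_measurable_LIMSEQ_metric)
  have [measurable]: "(\<lambda>c. monomial c n) \<in> borel_measurable borel" for n
    by (intro borel_measurable_continuous_onI linear_continuous_on bounded_linear_monomial)
  show "(\<lambda>s. \<Sum>n\<in>{- int N..int N}. monomial (fourier_coeff (H s) n) n) \<in> borel_measurable M" for N
    by measurable
  fix s
  have "filterlim (\<lambda>N. {- int N..int N}) (finite_subsets_at_top UNIV) sequentially"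
    unfolding filterlim_finite_subsets_at_top
  proof (intro allI impI)
    fix I :: "int set" assume I: "finite I \<and> I \<subseteq> UNIV"
    then obtain B where B: "\<And>n. n \<in> I \<Longrightarrow> \<bar>n\<bar> \<le> B"
      by (metis finite_imageI finite_nat_set_iff_bounded_le Max_ge image_eqI finite_imageI)
    show "\<forall>\<^sub>F N in sequentially. finite {- int N..int N} \<and> I \<subseteq> {- int N..int N} \<and> {- int N..int N} \<subseteq> UNIV"
      using eventually_ge_at_top[of "nat B"]
    proof eventually_elim
      case (elim N)
      then have "B \<le> int N" by simp
      then show ?case using B by (auto simp: abs_le_iff) (smt (verit))+
    qed
  qed
  then show "(\<lambda>N. \<Sum>n\<in>{- int N..int N}. monomial (fourier_coeff (H s) n) n) \<longlonglongrightarrow> H s"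
    using fourier_series[of "H s"] unfolding has_sum_def by (auto intro: filterlim_compose)
qed

text \<open>The semigroup and the Riesz projector are both contractive multipliers, with
  \<open>m n\<close> equal to exp (-|n| t) and to the indicator of n \<ge> 0.\<close>

lemma fourier_multiplier:
  assumes "\<And>n. cmod (m n) \<le> 1"
  shows "fourier_coeff (\<Sum>\<^sub>\<infinity>n. monomial (fourier_coeff F n * m n) n) k = fourier_coeff F k * m k"
    and "norm (\<Sum>\<^sub>\<infinity>n. monomial (fourier_coeff F n * m n) n) \<le> norm F"
proof -
  have le: "cmod (fourier_coeff F n * m n) \<le> cmod (fourier_coeff F n)" for n
    using assms[of n] by (simp add: norm_mult mult_left_le)
  have "(\<lambda>n. (cmod (fourier_coeff F n * m n))\<^sup>2) summable_on UNIV"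
    by (rule summable_on_comparison_test[OF summable_fourier_coeff[of F]])
      (auto intro!: power_mono le)
  note coeff = fourier_coeff_infsum_monomials[OF this]
  show "fourier_coeff (\<Sum>\<^sub>\<infinity>n. monomial (fourier_coeff F n * m n) n) k = fourier_coeff F k * m k"
    by (rule coeff)
  show "norm (\<Sum>\<^sub>\<infinity>n. monomial (fourier_coeff F n * m n) n) \<le> norm F"
    by (rule norm_le_if_fourier_coeff_le) (simp only: coeff le)
qed

lemma fourier_coeff_half_heat:
  assumes "0 \<le> t"
  shows "fourier_coeff (half_heat t F) n = fourier_coeff F n * of_real (exp (- \<bar>of_int n\<bar> * t))"
    and norm_half_heat: "norm (half_heat t F) \<le> norm F"
proof -
  have "cmod (of_real (exp (- \<bar>of_int n\<bar> * t))) \<le> 1" for n :: int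
    using assms by simp
  note fourier_multiplier[of "\<lambda>n. of_real (exp (- \<bar>of_int n\<bar> * t))", OF this, of F]
  then show "fourier_coeff (half_heat t F) n = fourier_coeff F n * of_real (exp (- \<bar>of_int n\<bar> * t))"
    "norm (half_heat t F) \<le> norm F"
    by (auto simp: half_heat_def monomial_def)
qed

lemma fourier_coeff_riesz_proj:
  "fourier_coeff (riesz_proj F) n = (if 0 \<le> n then fourier_coeff F n else 0)"
proof -
  let ?m = "\<lambda>n::int. if 0 \<le> n then 1 else 0 :: complex"
  have "riesz_proj F = (\<Sum>\<^sub>\<infinity>n. monomial (fourier_coeff F n * ?m n) n)"
    unfolding riesz_proj_def monomial_def[symmetric]
    by (rule infsum_cong_neutral) (auto simp: monomial_zero)
  moreover have "cmod (?m n) \<le> 1" for n by simp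
  ultimately show ?thesis
    using fourier_multiplier(1)[of ?m F n] by auto
qed

lemma fourier_coeff_conj: "fourier_coeff (conj_L2 F) n = cnj (fourier_coeff F (- n))"
proof -
  obtain f where f: "square_integrable circle f" and F: "F = L2_class f"
    by (rule L2_class_cases)
  have [measurable]: "f \<in> borel_measurable circle" using f by (rule square_integrable_measurable)
  have cf: "square_integrable circle (\<lambda>z. cnj (f z))" using f by (rule square_integrable_cnj)
  have [measurable]: "(\<lambda>z. cnj (f z)) \<in> borel_measurable circle"
    using cf by (rule square_integrable_measurable)
  have "conj_L2 F = L2_class (\<lambda>z. cnj (f z))"
    unfolding F using f cf by (transfer fixing: f) (simp add: circle_eq_def)
  then have "fourier_coeff (conj_L2 F) n = (\<integral>z. cnj (f z) * z powi (- n) \<partial>circle)"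
    by (simp add: fourier_coeff_L2_class[OF cf])
  also have "\<dots> = (\<integral>z. cnj (f z * z powi n) \<partial>circle)"
  proof (rule integral_cong_AE)
    show "AE z in circle. cnj (f z) * z powi (- n) = cnj (f z * z powi n)"
      using AE_circle_norm
    proof eventually_elim
      case (elim z)
      then have "cnj z = inverse z"
        by (simp add: inverse_complex_def complex_eq_iff cmod_def)
      then show ?case by (simp add: power_int_minus power_int_inverse)
    qed
    show "(\<lambda>z. cnj (f z * z powi n)) \<in> borel_measurable circle"
      by (intro borel_measurable_continuous_on[OF continuous_on_cnj[OF continuous_on_id]]) measurable
  qed measurable
  also have "\<dots> = cnj (fourier_coeff F (- n))"
    unfolding F fourier_coeff_L2_class[OF f] minus_minus
    by (intro integral_bounded_linear[OF bounded_linear_cnj] integrable_circle_times_power_int f)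
  finally show ?thesis .
qed

section \<open>Controls and moments\<close>

interpretation lborel_circle: pair_sigma_finite lborel circle
  by (intro pair_sigma_finite.intro lborel.sigma_finite_measure_axioms circle.sigma_finite_measure_axioms)

text \<open>An arc is not open in the plane, so it is written as a countable union of compact
  arcs.\<close>

lemma open_strict_interval_borel:
  assumes "open_strict_interval \<omega>"
  shows "\<omega> \<in> sets borel"
proof -
  obtain a b where ab: "0 < b - a" "b - a < 2 * pi" and \<omega>: "\<omega> = cis ` {a<..<b}"
    using assms by (auto simp: open_strict_interval_def)
  have "cis ` {a<..<b} = (\<Union>k. cis ` {a + 1 / real (Suc k)..b - 1 / real (Suc k)})" (is "_ = (\<Union>k. ?K k)")
  proof
    show "cis ` {a<..<b} \<subseteq> (\<Union>k. ?K k)"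
    proof
      fix z assume "z \<in> cis ` {a<..<b}"
      then obtain x where x: "a < x" "x < b" "z = cis x" by auto
      then obtain k where "1 / real (Suc k) < min (x - a) (b - x)"
        using reals_Archimedean[of "min (x - a) (b - x)"] by (auto simp: inverse_eq_divide)
      then show "z \<in> (\<Union>k. ?K k)" using x(3) by (auto intro!: bexI[of _ k] exI[of _ k])
    qed
    show "(\<Union>k. ?K k) \<subseteq> cis ` {a<..<b}"
    proof (intro UN_least image_mono subsetI)
      fix k x assume "x \<in> {a + 1 / real (Suc k)..b - 1 / real (Suc k)}"
      moreover have "0 < 1 / real (Suc k)" by simp
      ultimately show "x \<in> {a<..<b}" unfolding atLeastAtMost_iff greaterThanLessThan_iff by linarith
    qed
  qed
  moreover have "?K k \<in> sets borel" for k
    by (intro borel_closed compact_imp_closed compact_continuous_image continuous_intros) auto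
  ultimately show ?thesis unfolding \<omega> by auto
qed

definition control_space :: "complex set \<Rightarrow> real \<Rightarrow> (real \<times> complex) measure"
  where "control_space \<omega> T = restrict_space (lborel \<Otimes>\<^sub>M circle) ({0..T} \<times> \<omega>)"

lemma control_iff: "control \<omega> T u \<longleftrightarrow> square_integrable (control_space \<omega> T) u"
  by (simp add: control_def control_space_def)

lemma control_domain_measurable:
  "\<omega> \<in> sets borel \<Longrightarrow> {0..T::real} \<times> \<omega> \<in> sets (lborel \<Otimes>\<^sub>M circle)"
  by (intro pair_measureI) auto

lemma finite_measure_control_space:
  assumes "\<omega> \<in> sets borel"
  shows "finite_measure (control_space \<omega> T)"
  unfolding control_space_def
proof (rule finite_measureI)
  have "emeasure (lborel \<Otimes>\<^sub>M circle) ({0..T} \<times> \<omega>) = emeasure lborel {0..T} * emeasure circle \<omega>"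
    using assms by (intro circle.emeasure_pair_measure_Times) auto
  also have "\<dots> \<noteq> \<infinity>"
    using circle.emeasure_finite[of \<omega>] by (auto simp: ennreal_mult_eq_top_iff emeasure_lborel_Icc_eq)
  finally show "emeasure (restrict_space (lborel \<Otimes>\<^sub>M circle) ({0..T} \<times> \<omega>))
      (space (restrict_space (lborel \<Otimes>\<^sub>M circle) ({0..T} \<times> \<omega>))) \<noteq> \<infinity>"
    using control_domain_measurable[OF assms] by (simp add: emeasure_restrict_space)
qed

lemma AE_control_space:
  assumes "\<omega> \<in> sets borel"
  shows "AE p in control_space \<omega> T. p \<in> {0..T} \<times> \<omega> \<and> cmod (snd p) = 1"
proof -
  have "AE p in lborel \<Otimes>\<^sub>M circle. cmod (snd p) = 1"
  proof (rule lborel_circle.AE_pair_measure)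
    show "{p \<in> space (lborel \<Otimes>\<^sub>M circle). cmod (snd p) = 1} \<in> sets (lborel \<Otimes>\<^sub>M circle)"
      by measurable
    show "AE s in lborel. AE z in circle. cmod (snd (s, z)) = 1"
      using AE_circle_norm by simp
  qed
  then have "AE p in lborel \<Otimes>\<^sub>M circle. p \<in> {0..T} \<times> \<omega> \<longrightarrow> p \<in> {0..T} \<times> \<omega> \<and> cmod (snd p) = 1"
    by eventually_elim auto
  then show ?thesis
    unfolding control_space_def
    by (subst AE_restrict_space_iff) (use control_domain_measurable[OF assms] in \<open>auto simp: space_pair_measure\<close>)
qed

lemma control_space_measurable:
  "f \<in> borel_measurable (lborel \<Otimes>\<^sub>M circle) \<Longrightarrow> f \<in> borel_measurable (control_space \<omega> T)"
  unfolding control_space_def by (rule measurable_restrict_space1)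

text \<open>The exponential of order \<open>- n\<close>, evolved backwards from time
  \<open>T\<close>. Pairing a control with it gives the coefficient of order \<open>n\<close> of the
  control's contribution to the state at time \<open>T\<close>.\<close>

definition dual_mode :: "real \<Rightarrow> int \<Rightarrow> real \<times> complex \<Rightarrow> complex"
  where "dual_mode T n p = of_real (exp (- \<bar>of_int n\<bar> * (T - fst p))) * snd p powi (- n)"

definition moment :: "complex set \<Rightarrow> real \<Rightarrow> (real \<times> complex \<Rightarrow> complex) \<Rightarrow> int \<Rightarrow> complex"
  where "moment \<omega> T u n = (\<integral>p. u p * dual_mode T n p \<partial>control_space \<omega> T)"

lemma dual_mode_measurable [measurable]: "dual_mode T n \<in> borel_measurable (lborel \<Otimes>\<^sub>M circle)"
proof -
  have [measurable]: "(\<lambda>p. snd p powi (- n)) \<in> borel_measurable (lborel \<Otimes>\<^sub>M circle)"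
    by (rule measurable_compose[OF measurable_snd power_int_borel])
  show ?thesis unfolding dual_mode_def[abs_def] by measurable
qed

lemma norm_dual_mode_le:
  assumes "p \<in> {0..T} \<times> \<omega>" "cmod (snd p) = 1"
  shows "cmod (dual_mode T n p) \<le> 1"
  using assms by (auto simp: dual_mode_def norm_mult norm_power_int)

lemma integrable_control_times_bounded:
  assumes \<omega>: "\<omega> \<in> sets borel" and u: "square_integrable (control_space \<omega> T) u"
    and g: "g \<in> borel_measurable (control_space \<omega> T)" "AE p in control_space \<omega> T. cmod (g p) \<le> c"
  shows "integrable (control_space \<omega> T) (\<lambda>p. u p * g p)"
proof (rule Bochner_Integration.integrable_bound)
  show "integrable (control_space \<omega> T) (\<lambda>p. c * cmod (u p))"
    using square_integrable_imp_integrable[OF finite_measure_control_space[OF \<omega>] u] by auto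
  show "AE p in control_space \<omega> T. norm (u p * g p) \<le> norm (c * cmod (u p))"
    using g(2)
  proof eventually_elim
    case (elim p)
    have "cmod (u p * g p) \<le> c * cmod (u p)"
      unfolding norm_mult using mult_right_mono[OF elim norm_ge_zero[of "u p"]] by (simp add: mult.commute)
    then show ?case by (simp only: real_norm_def order.trans[OF _ abs_ge_self])
  qed
qed (use u g in \<open>auto simp: square_integrable_def\<close>)

lemma integrable_moment:
  assumes "\<omega> \<in> sets borel" "square_integrable (control_space \<omega> T) u"
  shows "integrable (control_space \<omega> T) (\<lambda>p. u p * dual_mode T n p)"
proof (rule integrable_control_times_bounded[OF assms])
  show "AE p in control_space \<omega> T. cmod (dual_mode T n p) \<le> 1"
    using AE_control_space[OF assms(1)] by eventually_elim (auto intro: norm_dual_mode_le)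
qed (intro control_space_measurable dual_mode_measurable)

text \<open>Extension by 0 to the full product, where Fubini for \<open>lborel\<close> and
  \<open>circle\<close> applies.\<close>

definition control_extension :: "complex set \<Rightarrow> real \<Rightarrow> (real \<times> complex \<Rightarrow> complex) \<Rightarrow> real \<times> complex \<Rightarrow> complex"
  where "control_extension \<omega> T u p = indicator ({0..T} \<times> \<omega>) p *\<^sub>R u p"

lemma control_extension:
  assumes \<omega>: "\<omega> \<in> sets borel" and u: "square_integrable (control_space \<omega> T) u"
  shows "control_extension \<omega> T u \<in> borel_measurable (lborel \<Otimes>\<^sub>M circle)"
    and "integrable (lborel \<Otimes>\<^sub>M circle) (\<lambda>p. (cmod (control_extension \<omega> T u p))\<^sup>2)"
    and "integrable (lborel \<Otimes>\<^sub>M circle) (\<lambda>p. control_extension \<omega> T u p * dual_mode T n p)"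
    and "moment \<omega> T u n = (\<integral>p. control_extension \<omega> T u p * dual_mode T n p \<partial>(lborel \<Otimes>\<^sub>M circle))"
proof -
  have D: "{0..T} \<times> \<omega> \<inter> space (lborel \<Otimes>\<^sub>M circle) \<in> sets (lborel \<Otimes>\<^sub>M circle)"
    using control_domain_measurable[OF \<omega>] by (simp add: space_pair_measure)
  show "control_extension \<omega> T u \<in> borel_measurable (lborel \<Otimes>\<^sub>M circle)"
    using square_integrable_measurable[OF u]
    unfolding control_extension_def[abs_def] control_space_def borel_measurable_restrict_space_iff[OF D] .
  have "integrable (lborel \<Otimes>\<^sub>M circle) (\<lambda>p. indicator ({0..T} \<times> \<omega>) p *\<^sub>R (cmod (u p))\<^sup>2)"
    using u unfolding square_integrable_def control_space_def integrable_restrict_space[OF D] by simp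
  also have "(\<lambda>p. indicator ({0..T} \<times> \<omega>) p *\<^sub>R (cmod (u p))\<^sup>2) = (\<lambda>p. (cmod (control_extension \<omega> T u p))\<^sup>2)"
    by (auto simp: control_extension_def fun_eq_iff split: split_indicator)
  finally show "integrable (lborel \<Otimes>\<^sub>M circle) (\<lambda>p. (cmod (control_extension \<omega> T u p))\<^sup>2)" .
  show "integrable (lborel \<Otimes>\<^sub>M circle) (\<lambda>p. control_extension \<omega> T u p * dual_mode T n p)"
    using integrable_moment[OF assms, of n]
    unfolding control_space_def integrable_restrict_space[OF D] by (simp add: control_extension_def)
  show "moment \<omega> T u n = (\<integral>p. control_extension \<omega> T u p * dual_mode T n p \<partial>(lborel \<Otimes>\<^sub>M circle))"
    unfolding moment_def control_space_def integral_restrict_space[OF D] by (simp add: control_extension_def)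
qed

lemma L2_class_not_square_integrable: "\<not> square_integrable circle f \<Longrightarrow> L2_class f = 0"
  by (transfer fixing: f) (simp add: circle_eq_def square_integrable_zero)

text \<open>The multiplier \<open>m\<close> handles both systems at once: it is 1 for the
  \<open>L2\<close> system and the indicator of n \<ge> 0 for the \<open>H2\<close> system. A
  coefficient is a bounded functional, so it passes under the Bochner integral, and Fubini
  identifies the result with the moment.\<close>

lemma fourier_coeff_mild_solution:
  assumes \<omega>: "\<omega> \<in> sets borel" and T: "0 \<le> T" and u: "control \<omega> T u"
    and K: "\<And>s n. fourier_coeff (K s) n = fourier_coeff (extend_zero \<omega> u s) n * m n"
    and m: "\<And>n. cmod (m n) \<le> 1"
  shows "fourier_coeff (mild_solution f\<^sub>0 K T) n
    = fourier_coeff f\<^sub>0 n * of_real (exp (- \<bar>of_int n\<bar> * T)) + m n * moment \<omega> T u n"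
proof -
  define U where "U = control_extension \<omega> T u"
  note ext = control_extension[OF \<omega> u[unfolded control_iff], folded U_def]
  note [measurable] = ext(1)
  define I where "I s \<longleftrightarrow> integrable circle (\<lambda>z. (cmod (U (s, z)))\<^sup>2)" for s
  have [measurable]: "Measurable.pred lborel I"
    unfolding I_def by measurable
  have slice [measurable]: "(\<lambda>z. U (s, z)) \<in> borel_measurable circle" for s by measurable
  have I_sq: "I s \<longleftrightarrow> square_integrable circle (\<lambda>z. U (s, z))" for s
    by (simp add: I_def square_integrable_def slice)
  \<comment> \<open>On a slice that is not square integrable \<open>L2_class\<close> returns 0, and
    \<open>c\<close> follows this convention. By Fubini such slices occur only for a null set of
    times.\<close>
  define c where "c s k = (if I s then (\<integral>z. U (s, z) * z powi (- k) \<partial>circle) else 0)" for s k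
  have c_meas [measurable]: "(\<lambda>s. c s k) \<in> borel_measurable lborel" for k
    unfolding c_def by measurable
  have slice_eq: "(\<lambda>z. if z \<in> \<omega> then u (s, z) else 0) = (\<lambda>z. U (s, z))" if "s \<in> {0..T}" for s
    using that by (auto simp: U_def control_extension_def fun_eq_iff)
  have coeff: "fourier_coeff (extend_zero \<omega> u s) k = c s k" if "s \<in> {0..T}" for s k
    unfolding extend_zero_def slice_eq[OF that] c_def
    by (auto simp: I_sq fourier_coeff_L2_class L2_class_not_square_integrable fourier_coeff_linear)
  have norm: "norm (extend_zero \<omega> u s) \<le> 1 + (\<integral>z. (cmod (U (s, z)))\<^sup>2 \<partial>circle)" if "s \<in> {0..T}" for s
  proof (cases "I s")
    case True
    \<comment> \<open>Fubini yields integrability in time of the squared norms; this elementary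
      bound passes to the norms, the 1 being integrable over \<open>{0..T}\<close>.\<close>
    have "sqrt x \<le> 1 + x" if "0 \<le> x" for x :: real
      using that by (intro real_le_lsqrt) (auto simp: power2_eq_square algebra_simps)
    then show ?thesis
      using True by (simp add: extend_zero_def slice_eq[OF that] I_sq norm_L2_class)
  qed (simp add: extend_zero_def slice_eq[OF that] I_sq L2_class_not_square_integrable)
  define G where "G s = indicator {0..T} s *\<^sub>R half_heat (T - s) (K s)" for s
  have coeff_G: "fourier_coeff (G s) k
      = indicator {0..T} s *\<^sub>R (c s k * m k * of_real (exp (- \<bar>of_int k\<bar> * (T - s))))" for s k
    by (auto simp: G_def fourier_coeff_linear fourier_coeff_half_heat K coeff split: split_indicator)
  have [measurable]: "G \<in> borel_measurable lborel"
    by (rule L2_measurable_if_fourier_coeff_measurable) (simp only: coeff_G, measurable)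
  have int_sq: "integrable lborel (\<lambda>s. \<integral>z. (cmod (U (s, z)))\<^sup>2 \<partial>circle)"
    using lborel_circle.integrable_fst'[OF ext(2)] .
  have int_G: "integrable lborel G"
  proof (rule Bochner_Integration.integrable_bound)
    show "integrable lborel (\<lambda>s. indicator {0..T} s + (\<integral>z. (cmod (U (s, z)))\<^sup>2 \<partial>circle) :: real)"
      using T by (intro Bochner_Integration.integrable_add int_sq) (auto simp: emeasure_lborel_Icc_eq)
    have "norm (G s) \<le> indicator {0..T} s + (\<integral>z. (cmod (U (s, z)))\<^sup>2 \<partial>circle)" for s
    proof (cases "s \<in> {0..T}")
      case True
      have "norm (K s) \<le> norm (extend_zero \<omega> u s)"
        using m by (intro norm_le_if_fourier_coeff_le) (simp add: K norm_mult mult_left_le)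
      then show ?thesis
        using True norm[OF True] norm_half_heat[of "T - s" "K s"] by (simp add: G_def)
    qed (simp add: G_def)
    then show "AE s in lborel. norm (G s) \<le> norm (indicator {0..T} s + (\<integral>z. (cmod (U (s, z)))\<^sup>2 \<partial>circle))"
      by (intro always_eventually allI order.trans[OF _ abs_ge_self]) simp
  qed simp
  have AE_I: "AE s in lborel. I s"
    unfolding I_def using lborel_circle.AE_integrable_fst'[OF ext(2)] .
  have "fourier_coeff (\<integral>s. G s \<partial>lborel) n = (\<integral>s. fourier_coeff (G s) n \<partial>lborel)"
    by (rule integral_bounded_linear[OF bounded_linear_fourier_coeff int_G, symmetric])
  also have "\<dots> = (\<integral>s. m n * (\<integral>z. U (s, z) * dual_mode T n (s, z) \<partial>circle) \<partial>lborel)"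
  proof (rule integral_cong_AE)
    show "AE s in lborel. fourier_coeff (G s) n = m n * (\<integral>z. U (s, z) * dual_mode T n (s, z) \<partial>circle)"
      using AE_I
    proof eventually_elim
      case (elim s)
      have "U (s, z) = 0" if "s \<notin> {0..T}" for z using that by (auto simp: U_def control_extension_def)
      moreover have "(\<integral>z. U (s, z) * dual_mode T n (s, z) \<partial>circle)
          = of_real (exp (- \<bar>of_int n\<bar> * (T - s))) * (\<integral>z. U (s, z) * z powi (- n) \<partial>circle)"
        by (subst integral_mult_right_zero[symmetric]) (simp add: dual_mode_def mult_ac)
      ultimately show ?case
        using elim by (auto simp: coeff_G c_def split: split_indicator)
    qed
    show "(\<lambda>s. fourier_coeff (G s) n) \<in> borel_measurable lborel"
      unfolding coeff_G by measurable
    show "(\<lambda>s. m n * (\<integral>z. U (s, z) * dual_mode T n (s, z) \<partial>circle)) \<in> borel_measurable lborel"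
      using lborel_circle.integrable_fst'[OF ext(3)] by auto
  qed
  also have "\<dots> = m n * moment \<omega> T u n"
    using lborel_circle.integral_fst'[OF ext(3), of n] by (simp add: ext(4))
  finally show ?thesis
    using T by (simp add: mild_solution_def fourier_coeff_linear fourier_coeff_half_heat
        set_lebesgue_integral_def G_def)
qed

lemma NC_L2_iff_moments:
  assumes \<omega>: "\<omega> \<in> sets borel" and T: "0 \<le> T"
  shows "f\<^sub>0 \<in> NC_L2 \<omega> T \<longleftrightarrow> (\<exists>u. control \<omega> T u \<and>
    (\<forall>n. moment \<omega> T u n = - fourier_coeff f\<^sub>0 n * of_real (exp (- \<bar>of_int n\<bar> * T))))"
proof -
  have "mild_solution f\<^sub>0 (extend_zero \<omega> u) T = 0 \<longleftrightarrow>
      (\<forall>n. moment \<omega> T u n = - fourier_coeff f\<^sub>0 n * of_real (exp (- \<bar>of_int n\<bar> * T)))"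
    if "control \<omega> T u" for u
  proof -
    have "mild_solution f\<^sub>0 (extend_zero \<omega> u) T = 0 \<longleftrightarrow>
        (\<forall>n. fourier_coeff (mild_solution f\<^sub>0 (extend_zero \<omega> u) T) n = 0)"
      using fourier_coeff_eq_imp_eq[of _ 0] by (auto simp: fourier_coeff_linear)
    also have "\<dots> \<longleftrightarrow> (\<forall>n. moment \<omega> T u n = - fourier_coeff f\<^sub>0 n * of_real (exp (- \<bar>of_int n\<bar> * T)))"
      by (subst fourier_coeff_mild_solution[OF \<omega> T that, where m="\<lambda>_. 1"])
        (auto simp: add_eq_0_iff)
    finally show ?thesis .
  qed
  then show ?thesis by (auto simp: NC_L2_def)
qed

lemma NC_H2_iff_moments:
  assumes \<omega>: "\<omega> \<in> sets borel" and T: "0 \<le> T"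
  shows "riesz_proj f\<^sub>0 \<in> NC_H2 \<omega> T \<longleftrightarrow> (\<exists>u. control \<omega> T u \<and>
    (\<forall>n\<ge>0. moment \<omega> T u n = - fourier_coeff f\<^sub>0 n * of_real (exp (- \<bar>of_int n\<bar> * T))))"
proof -
  have "mild_solution (riesz_proj f\<^sub>0) (\<lambda>s. riesz_proj (extend_zero \<omega> u s)) T = 0 \<longleftrightarrow>
      (\<forall>n\<ge>0. moment \<omega> T u n = - fourier_coeff f\<^sub>0 n * of_real (exp (- \<bar>of_int n\<bar> * T)))"
    if "control \<omega> T u" for u
  proof -
    let ?f = "mild_solution (riesz_proj f\<^sub>0) (\<lambda>s. riesz_proj (extend_zero \<omega> u s)) T"
    have "?f = 0 \<longleftrightarrow> (\<forall>n. fourier_coeff ?f n = 0)"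
      using fourier_coeff_eq_imp_eq[of _ 0] by (auto simp: fourier_coeff_linear)
    also have "\<dots> \<longleftrightarrow> (\<forall>n\<ge>0. moment \<omega> T u n = - fourier_coeff f\<^sub>0 n * of_real (exp (- \<bar>of_int n\<bar> * T)))"
      by (subst fourier_coeff_mild_solution[OF \<omega> T that, where m="\<lambda>n. if 0 \<le> n then 1 else 0"])
        (auto simp: add_eq_0_iff fourier_coeff_riesz_proj)
    finally show ?thesis .
  qed
  then show ?thesis by (auto simp: NC_H2_def H2_def)
qed

section \<open>The control domain as a rectangle\<close>

text \<open>The squared modulus of F + cnj G is the sum of the squares of Re (F + G) and Im (F - G).
  By Friedrichs' inequality the first controls Im (F + G) and the second Re (F - G), each up to a
  constant, and these four parts determine F.\<close>

lemma friedrichs_conjugate: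
  fixes F G :: "complex \<Rightarrow> complex" and A B :: real
  assumes F: "F holomorphic_on UNIV" and G: "G holomorphic_on UNIV" and "0 < A" "0 < B"
  defines "R \<equiv> {z. \<bar>Re z\<bar> \<le> A \<and> \<bar>Im z\<bar> \<le> B}"
    and "K \<equiv> 16 * (A\<^sup>2 + B\<^sup>2) * (1 / A\<^sup>2 + 1 / B\<^sup>2)"
  obtains c where "plane_integral (\<lambda>z. indicator R z * ennreal ((cmod (F z - c))\<^sup>2))
    \<le> ennreal (1 + K) * plane_integral (\<lambda>z. indicator R z * ennreal ((cmod (F z + cnj (G z)))\<^sup>2))"
proof -
  define D where "D f = plane_integral (\<lambda>z. indicator R z * ennreal (f z))" for f :: "complex \<Rightarrow> real"
  have [measurable]: "R \<in> sets borel" unfolding R_def by measurable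
  have [measurable]: "F \<in> borel_measurable borel" "G \<in> borel_measurable borel"
    using F G by (auto intro!: borel_measurable_continuous_onI holomorphic_on_imp_continuous_on)
  have D_mono: "D f \<le> D g" if "\<And>z. f z \<le> g z" for f g
    unfolding D_def plane_integral_def using that by (intro nn_integral_mono mult_left_mono ennreal_leI) auto
  have D_add: "D (\<lambda>z. f z + g z) = D f + D g"
    if [measurable]: "f \<in> borel_measurable borel" "g \<in> borel_measurable borel"
      and "\<And>z. 0 \<le> f z" "\<And>z. 0 \<le> g z" for f g
    unfolding D_def plane_integral_def
    by (simp add: that(3,4) ennreal_plus distrib_left nn_integral_add)
  have K: "0 \<le> K" by (simp add: K_def)
  define c1 where "c1 = Im (F 0 + G 0)"
  define c2 where "c2 = Re (F 0 - G 0)"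
  define a where "a z = (Re (F z + G z))\<^sup>2" for z
  define b where "b z = (Im (F z - G z))\<^sup>2" for z
  define a' where "a' z = (Im (F z + G z) - c1)\<^sup>2" for z
  define b' where "b' z = (Re (F z - G z) - c2)\<^sup>2" for z
  have [measurable]: "a \<in> borel_measurable borel" "b \<in> borel_measurable borel"
    "a' \<in> borel_measurable borel" "b' \<in> borel_measurable borel"
    unfolding a_def[abs_def] b_def[abs_def] a'_def[abs_def] b'_def[abs_def] by measurable
  have nonneg: "0 \<le> a z" "0 \<le> b z" "0 \<le> a' z" "0 \<le> b' z" for z
    by (simp_all add: a_def b_def a'_def b'_def)
  have "D (\<lambda>z. (Im (F z + G z - \<i> * of_real c1))\<^sup>2)
      \<le> ennreal K * D (\<lambda>z. (Re (F z + G z - \<i> * of_real c1))\<^sup>2)"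
    unfolding D_def R_def K_def
    by (intro friedrichs_rectangle holomorphic_intros F G assms(3,4)) (simp add: c1_def)
  then have 1: "D a' \<le> ennreal K * D a"
    by (simp add: a_def[abs_def] a'_def[abs_def])
  \<comment> \<open>Multiplication by \<i> exchanges the roles of real and imaginary part: here Im
    (F - G) is the known part. Subtracting \<open>c2\<close> makes the value at 0 real.\<close>
  have "D (\<lambda>z. (Im (\<i> * (F z - G z - of_real c2)))\<^sup>2)
      \<le> ennreal K * D (\<lambda>z. (Re (\<i> * (F z - G z - of_real c2)))\<^sup>2)"
    unfolding D_def R_def K_def
    by (intro friedrichs_rectangle holomorphic_intros F G assms(3,4)) (simp add: c2_def)
  then have 2: "D b' \<le> ennreal K * D b"
    by (simp add: b_def[abs_def] b'_def[abs_def] power2_commute[of "Im (G z)" "Im (F z)" for z])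
  have ab: "D (\<lambda>z. (cmod (F z + cnj (G z)))\<^sup>2) = D a + D b"
    by (subst D_add[symmetric]) (auto simp: nonneg a_def b_def cmod_power2)
  \<comment> \<open>\<open>F z - ?c\<close> is half the sum of \<open>F z + G z - \<i> * c1\<close>
    and \<open>F z - G z - c2\<close>.\<close>
  let ?c = "(of_real c2 + \<i> * of_real c1) / 2"
  have "(cmod (F z - ?c))\<^sup>2 \<le> (a z + b z) + (a' z + b' z)" for z
  proof -
    have re: "Re (F z - ?c) = (Re (F z + G z) + (Re (F z - G z) - c2)) / 2"
      and im: "Im (F z - ?c) = (Im (F z - G z) + (Im (F z + G z) - c1)) / 2"
      by (simp_all add: field_simps)
    have sq: "((x + y) / 2)\<^sup>2 \<le> x\<^sup>2 + y\<^sup>2" for x y :: real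
    proof -
      have "x\<^sup>2 + y\<^sup>2 - ((x + y) / 2)\<^sup>2 = ((x - y)\<^sup>2 + 2 * x\<^sup>2 + 2 * y\<^sup>2) / 4"
        by (simp add: power2_eq_square field_simps)
      moreover have "0 \<le> ((x - y)\<^sup>2 + 2 * x\<^sup>2 + 2 * y\<^sup>2) / 4" by simp
      ultimately show ?thesis by (metis diff_ge_0_iff_ge)
    qed
    show ?thesis
      unfolding cmod_power2 re im a_def b_def a'_def b'_def
      using sq[of "Re (F z + G z)" "Re (F z - G z) - c2"] sq[of "Im (F z - G z)" "Im (F z + G z) - c1"]
      by linarith
  qed
  then have "D (\<lambda>z. (cmod (F z - ?c))\<^sup>2) \<le> D (\<lambda>z. (a z + b z) + (a' z + b' z))"
    by (rule D_mono)
  also have "\<dots> = (D a + D b) + (D a' + D b')"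
    by (subst D_add; (subst D_add)?; (subst D_add)?) (auto simp: nonneg add_nonneg_nonneg)
  also have "\<dots> \<le> (D a + D b) + (ennreal K * D a + ennreal K * D b)"
    by (intro add_mono order.refl 1 2)
  also have "\<dots> = ennreal (1 + K) * (D a + D b)"
    using K by (simp add: ennreal_plus distrib_right distrib_left)
  finally show thesis
    unfolding ab[symmetric] using that by (simp add: D_def)
qed

section \<open>The arc as an interval of angles\<close>

lemma cis_image_shift:
  "cis ` {a + 2 * pi * of_int k<..<b + 2 * pi * of_int k} = cis ` {a<..<b}"
proof -
  have "{a + 2 * pi * of_int k<..<b + 2 * pi * of_int k} = (\<lambda>x. x + 2 * pi * of_int k) ` {a<..<b}"
    by (auto intro!: image_eqI[of x _ "x - 2 * pi * of_int k" for x])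
  moreover have "cis (x + 2 * pi * of_int k) = cis x" for x
    by (simp add: cis_mult[symmetric] cis_multiple_2pi)
  ultimately show ?thesis by (simp add: image_image)
qed

text \<open>\<open>circle\<close> is parametrised by the angles in (-pi, pi]. A multiple of 2 pi
  moves \<open>a\<close> into [-pi, pi), while \<open>b\<close> may still exceed pi.\<close>

lemma open_strict_interval_normalized:
  assumes "open_strict_interval \<omega>"
  obtains a b where "-pi \<le> a" "a < pi" "a < b" "b < a + 2 * pi" "\<omega> = cis ` {a<..<b}"
proof -
  obtain a b where ab: "0 < b - a" "b - a < 2 * pi" and \<omega>: "\<omega> = cis ` {a<..<b}"
    using assms by (auto simp: open_strict_interval_def)
  define k where "k = - \<lfloor>(a + pi) / (2 * pi)\<rfloor>"
  have "of_int \<lfloor>(a + pi) / (2 * pi)\<rfloor> \<le> (a + pi) / (2 * pi)" "(a + pi) / (2 * pi) < of_int \<lfloor>(a + pi) / (2 * pi)\<rfloor> + 1"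
    by linarith+
  then have "of_int \<lfloor>(a + pi) / (2 * pi)\<rfloor> * (2 * pi) \<le> a + pi" "a + pi < (of_int \<lfloor>(a + pi) / (2 * pi)\<rfloor> + 1) * (2 * pi)"
    by (simp_all only: pos_le_divide_eq pos_divide_less_eq pi_gt_zero zero_less_mult_iff zero_less_numeral simp_thms)
  then have "-pi \<le> a + 2 * pi * of_int k" "a + 2 * pi * of_int k < pi"
    unfolding k_def by (simp_all add: algebra_simps)
  then show thesis
    using ab by (intro that[of "a + 2 * pi * of_int k" "b + 2 * pi * of_int k"]) (auto simp: \<omega> cis_image_shift)
qed

text \<open>The arc may cross the cut at the angle pi. Moving the angles in (-pi, a] up by 2 pi
  produces the period (a, a + 2 pi], in which the arc consists exactly of the angles below
  \<open>b\<close>.\<close>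

lemma nn_integral_arc:
  assumes [measurable]: "g \<in> borel_measurable borel" and a: "-pi \<le> a" "a < pi" and b: "a < b" "b < a + 2 * pi"
    and \<omega>: "\<omega> = cis ` {a<..<b}" "\<omega> \<in> sets borel"
  shows "(\<integral>\<^sup>+z. indicator \<omega> z * g z \<partial>circle)
    = (\<integral>\<^sup>+x. indicator {a..b} x * g (cis x) \<partial>lborel) / ennreal (2 * pi)"
proof -
  note [measurable] = \<omega>(2)
  define h where "h x = indicator \<omega> (cis x) * g (cis x)" for x
  have ind_cis [measurable]: "(\<lambda>x. indicator \<omega> (cis x) :: ennreal) \<in> borel_measurable borel"
    by (rule measurable_compose[OF cis_borel]) simp
  have [measurable]: "h \<in> borel_measurable borel" unfolding h_def by measurable
  have cis_period: "cis (x - 2 * pi) = cis x" for x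
    by (simp add: complex_eq_iff cos_diff sin_diff)
  have "(\<integral>\<^sup>+x. indicator {-pi<..pi} x * h x \<partial>lborel)
      = (\<integral>\<^sup>+x. indicator {-pi<..a} x * h x + indicator {a<..pi} x * h x \<partial>lborel)"
    using a by (intro nn_integral_cong) (auto split: split_indicator)
  also have "\<dots> = (\<integral>\<^sup>+x. indicator {-pi<..a} x * h x \<partial>lborel) + (\<integral>\<^sup>+x. indicator {a<..pi} x * h x \<partial>lborel)"
    by (rule nn_integral_add) auto
  also have "(\<integral>\<^sup>+x. indicator {-pi<..a} x * h x \<partial>lborel)
      = (\<integral>\<^sup>+x. indicator {-pi<..a} (- 2 * pi + 1 * x) * h (- 2 * pi + 1 * x) \<partial>lborel)"
    by (subst nn_integral_real_affine[where c=1 and t="- 2 * pi"]) auto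
  also have "\<dots> = (\<integral>\<^sup>+x. indicator {pi<..a + 2 * pi} x * h x \<partial>lborel)"
  proof (rule nn_integral_cong)
    fix x
    have "cis (- 2 * pi + 1 * x) = cis x" using cis_period[of x] by (simp add: algebra_simps)
    moreover have "- 2 * pi + 1 * x \<in> {-pi<..a} \<longleftrightarrow> x \<in> {pi<..a + 2 * pi}" by auto
    ultimately show "indicator {-pi<..a} (- 2 * pi + 1 * x) * h (- 2 * pi + 1 * x) = indicator {pi<..a + 2 * pi} x * h x"
      unfolding h_def by (metis (no_types, lifting) indicator_simps)
  qed
  also have "(\<integral>\<^sup>+x. indicator {pi<..a + 2 * pi} x * h x \<partial>lborel) + (\<integral>\<^sup>+x. indicator {a<..pi} x * h x \<partial>lborel)
      = (\<integral>\<^sup>+x. indicator {pi<..a + 2 * pi} x * h x + indicator {a<..pi} x * h x \<partial>lborel)"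
    by (rule nn_integral_add[symmetric]) auto
  also have "\<dots> = (\<integral>\<^sup>+x. indicator {a..b} x * g (cis x) \<partial>lborel)"
  proof (rule nn_integral_cong_AE)
    have mem: "cis x \<in> \<omega> \<longleftrightarrow> x < b" if x: "a < x" "x \<le> a + 2 * pi" for x
    proof
      assume "cis x \<in> \<omega>"
      then obtain y where y: "a < y" "y < b" "cis x = cis y" by (auto simp: \<omega>(1))
      then obtain n :: int where n: "x = y + 2 * pi * n"
        using sin_cos_eq_iff[of x y] by (auto simp: complex_eq_iff mult.commute)
      have "2 * pi * n < 2 * pi * 1" "2 * pi * (-1) < 2 * pi * n" using x y(1,2) b n by linarith+
      then have "real_of_int n < 1" "-1 < real_of_int n"
        by (simp_all only: mult_less_cancel_left_pos[of "2 * pi"] pi_gt_zero zero_less_mult_iff zero_less_numeral simp_thms)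
      then have "n = 0" by linarith
      then show "x < b" using n y by simp
    qed (use x in \<open>auto simp: \<omega>(1)\<close>)
    have "AE x in lborel. x \<noteq> a" "AE x in lborel. x \<noteq> b" by (rule AE_lborel_singleton)+
    then show "AE x in lborel. indicator {pi<..a + 2 * pi} x * h x + indicator {a<..pi} x * h x
        = indicator {a..b} x * g (cis x)"
    proof eventually_elim
      case (elim x)
      show ?case
        using elim a b mem[of x] by (auto simp: h_def split: split_indicator)
    qed
  qed
  finally show ?thesis
    by (subst nn_integral_circle) (auto simp: h_def)
qed

text \<open>Here \<open>exp (s - T) * cis x\<close> is the exponential of s - T + i x. Subtracting
  the centre \<open>Complex (- T / 2) ((a + b) / 2)\<close> makes the rectangle symmetric about 0,
  the form of \<open>friedrichs_rectangle\<close>; the divisor 2 pi is the normalisation of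
  \<open>circle\<close>.\<close>

lemma nn_integral_control_space:
  assumes [measurable]: "g \<in> borel_measurable borel" and a: "-pi \<le> a" "a < pi" and b: "a < b" "b < a + 2 * pi"
    and \<omega>: "\<omega> = cis ` {a<..<b}" "\<omega> \<in> sets borel"
  shows "(\<integral>\<^sup>+p. g (of_real (exp (fst p - T)) * snd p) \<partial>control_space \<omega> T)
    = plane_integral (\<lambda>z. indicator {z. \<bar>Re z\<bar> \<le> T / 2 \<and> \<bar>Im z\<bar> \<le> (b - a) / 2} z
        * g (exp (Complex (- T / 2) ((a + b) / 2) + z))) / ennreal (2 * pi)"
proof -
  let ?R = "{z. \<bar>Re z\<bar> \<le> T / 2 \<and> \<bar>Im z\<bar> \<le> (b - a) / 2}"
  note [measurable] = \<omega>(2)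
  have D: "{0..T} \<times> \<omega> \<inter> space (lborel \<Otimes>\<^sub>M circle) \<in> sets (lborel \<Otimes>\<^sub>M circle)"
    using control_domain_measurable[OF \<omega>(2)] by (simp add: space_pair_measure)
  have [measurable]: "exp \<in> borel_measurable (borel :: complex measure)"
    by (intro borel_measurable_continuous_onI continuous_intros)
  have "(\<integral>\<^sup>+p. g (of_real (exp (fst p - T)) * snd p) \<partial>control_space \<omega> T)
      = (\<integral>\<^sup>+p. g (of_real (exp (fst p - T)) * snd p) * indicator ({0..T} \<times> \<omega>) p \<partial>(lborel \<Otimes>\<^sub>M circle))"
    unfolding control_space_def by (rule nn_integral_restrict_space[OF D])
  also have "\<dots> = (\<integral>\<^sup>+s. \<integral>\<^sup>+z. g (of_real (exp (s - T)) * z) * indicator ({0..T} \<times> \<omega>) (s, z) \<partial>circle \<partial>lborel)"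
    by (subst circle.nn_integral_fst[symmetric]) (auto simp: control_domain_measurable \<omega>(2))
  also have "\<dots> = (\<integral>\<^sup>+s. (\<integral>\<^sup>+x. indicator {0..T} s * (indicator {a..b} x * g (exp (Complex (s - T) x))) \<partial>lborel) / ennreal (2 * pi) \<partial>lborel)"
  proof (rule nn_integral_cong)
    fix s
    have [measurable]: "(\<lambda>z. g (of_real (exp (s - T)) * z)) \<in> borel_measurable borel" by measurable
    have "(\<integral>\<^sup>+z. g (of_real (exp (s - T)) * z) * indicator ({0..T} \<times> \<omega>) (s, z) \<partial>circle)
        = indicator {0..T} s * (\<integral>\<^sup>+z. indicator \<omega> z * g (of_real (exp (s - T)) * z) \<partial>circle)"
      by (subst nn_integral_cmult[symmetric]) (auto simp: indicator_times mult_ac intro!: nn_integral_cong)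
    also have "\<dots> = indicator {0..T} s * ((\<integral>\<^sup>+x. indicator {a..b} x * g (of_real (exp (s - T)) * cis x) \<partial>lborel) / ennreal (2 * pi))"
      by (subst nn_integral_arc[OF _ a b \<omega>]) auto
    also have "\<dots> = (\<integral>\<^sup>+x. indicator {0..T} s * (indicator {a..b} x * g (of_real (exp (s - T)) * cis x)) \<partial>lborel) / ennreal (2 * pi)"
      by (subst nn_integral_cmult) (auto simp: divide_ennreal_def mult.assoc)
    finally show "(\<integral>\<^sup>+z. g (of_real (exp (s - T)) * z) * indicator ({0..T} \<times> \<omega>) (s, z) \<partial>circle)
        = (\<integral>\<^sup>+x. indicator {0..T} s * (indicator {a..b} x * g (exp (Complex (s - T) x))) \<partial>lborel) / ennreal (2 * pi)"
      by (simp add: exp_eq_polar exp_of_real)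
  qed
  also have "\<dots> = (\<integral>\<^sup>+s. \<integral>\<^sup>+x. indicator {0..T} s * (indicator {a..b} x * g (exp (Complex (s - T) x))) \<partial>lborel \<partial>lborel) / ennreal (2 * pi)"
    by (rule nn_integral_divide) measurable
  also have "(\<integral>\<^sup>+s. \<integral>\<^sup>+x. indicator {0..T} s * (indicator {a..b} x * g (exp (Complex (s - T) x))) \<partial>lborel \<partial>lborel)
      = (\<integral>\<^sup>+s. \<integral>\<^sup>+x. indicator {0..T} (T / 2 + 1 * s) * (indicator {a..b} x * g (exp (Complex (T / 2 + 1 * s - T) x))) \<partial>lborel \<partial>lborel)"
    by (subst nn_integral_real_affine[where c=1 and t="T / 2"]) auto
  also have "\<dots> = (\<integral>\<^sup>+s. \<integral>\<^sup>+x. indicator {0..T} (T / 2 + 1 * s) * (indicator {a..b} ((a + b) / 2 + 1 * x)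
      * g (exp (Complex (T / 2 + 1 * s - T) ((a + b) / 2 + 1 * x)))) \<partial>lborel \<partial>lborel)"
    by (subst nn_integral_real_affine[where c=1 and t="(a + b) / 2"]) auto
  also have "\<dots> = plane_integral (\<lambda>z. indicator ?R z * g (exp (Complex (- T / 2) ((a + b) / 2) + z)))"
    unfolding plane_integral_def
  proof (intro nn_integral_cong)
    fix s x
    have "Complex (T / 2 + 1 * s - T) ((a + b) / 2 + 1 * x) = Complex (- T / 2) ((a + b) / 2) + Complex s x"
      by (simp add: complex_eq_iff)
    moreover have "T / 2 + 1 * s \<in> {0..T} \<longleftrightarrow> \<bar>s\<bar> \<le> T / 2" by (auto simp: abs_le_iff)
    moreover have "(a + b) / 2 + 1 * x \<in> {a..b} \<longleftrightarrow> \<bar>x\<bar> \<le> (b - a) / 2" by (auto simp: abs_le_iff field_simps)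
    ultimately show "indicator {0..T} (T / 2 + 1 * s) * (indicator {a..b} ((a + b) / 2 + 1 * x)
        * g (exp (Complex (T / 2 + 1 * s - T) ((a + b) / 2 + 1 * x))))
      = indicator ?R (Complex s x) * g (exp (Complex (- T / 2) ((a + b) / 2) + Complex s x))"
      by (auto simp: indicator_def)
  qed
  finally show ?thesis .
qed

section \<open>Gluing controls\<close>

text \<open>In the coordinate \<open>\<zeta> = s - T + \<i> * x\<close> at \<open>(s, cis x)\<close>, the function \<open>poly_mode T q\<close> is
  \<open>q (exp \<zeta>)\<close>, hence entire, and \<open>cnj (dual_mode T n)\<close> is \<open>exp (n * \<zeta>)\<close> for \<open>n \<ge> 0\<close> and
  \<open>cnj (exp (\<bar>n\<bar> * \<zeta>))\<close> for \<open>n \<le> 0\<close>.\<close>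

definition poly_mode :: "real \<Rightarrow> complex poly \<Rightarrow> real \<times> complex \<Rightarrow> complex"
  where "poly_mode T q p = poly q (of_real (exp (fst p - T)) * snd p)"

lemma poly_mode_measurable [measurable]: "poly_mode T q \<in> borel_measurable (lborel \<Otimes>\<^sub>M circle)"
proof -
  have [measurable]: "poly q \<in> borel_measurable borel"
    by (intro borel_measurable_continuous_onI continuous_intros)
  show ?thesis unfolding poly_mode_def[abs_def] by measurable
qed

lemma square_integrable_AE_bounded:
  assumes "finite_measure M" "f \<in> borel_measurable M" "AE x in M. cmod (f x) \<le> B"
  shows "square_integrable M f"
  unfolding square_integrable_def
proof
  have "AE x in M. norm ((cmod (f x))\<^sup>2) \<le> B\<^sup>2"
    using assms(3) by eventually_elim (simp add: power_mono)
  then show "integrable M (\<lambda>x. (cmod (f x))\<^sup>2)"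
    using assms(2) by (intro finite_measure.integrable_const_bound[OF assms(1)]) auto
qed fact

text \<open>Times do not exceed \<open>T\<close>, so the argument of \<open>q\<close> stays in the
  closed unit disk, where \<open>q\<close> is bounded.\<close>

lemma square_integrable_poly_mode:
  assumes "\<omega> \<in> sets borel"
  shows "square_integrable (control_space \<omega> T) (poly_mode T q)"
proof -
  have "compact (poly q ` cball 0 1)"
    by (intro compact_continuous_image continuous_intros) auto
  then obtain B where "\<forall>z\<in>cball 0 1. cmod (poly q z) \<le> B"
    by (auto dest!: compact_imp_bounded simp: bounded_iff)
  then have B: "cmod z \<le> 1 \<Longrightarrow> cmod (poly q z) \<le> B" for z by simp
  show ?thesis
  proof (rule square_integrable_AE_bounded[OF finite_measure_control_space[OF assms] control_space_measurable[OF poly_mode_measurable]])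
    show "AE p in control_space \<omega> T. cmod (poly_mode T q p) \<le> B"
      using AE_control_space[OF assms]
    proof eventually_elim
      case (elim p)
      then have "cmod (of_real (exp (fst p - T)) * snd p) \<le> 1"
        by (auto simp: norm_mult)
      then show ?case unfolding poly_mode_def by (rule B)
    qed
  qed
qed

text \<open>Composition with the exponential turns polynomials into entire functions on the centred
  rectangle. \<open>C\<close> is fixed before \<open>q\<close> and \<open>r\<close>, and this
  uniformity is what will make the functional bounded.\<close>

lemma friedrichs_control_space:
  assumes \<omega>: "open_strict_interval \<omega>" and T: "0 < T"
  obtains C where "0 < C" and "\<And>q r. \<exists>c. (\<integral>p. (cmod (poly_mode T q p - c))\<^sup>2 \<partial>control_space \<omega> T)
    \<le> C * (\<integral>p. (cmod (poly_mode T q p + cnj (poly_mode T r p)))\<^sup>2 \<partial>control_space \<omega> T)"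
proof -
  note \<omega>_borel = open_strict_interval_borel[OF \<omega>]
  obtain a b where ab: "-pi \<le> a" "a < pi" "a < b" "b < a + 2 * pi" and \<omega>_eq: "\<omega> = cis ` {a<..<b}"
    by (rule open_strict_interval_normalized[OF \<omega>])
  define A where "A = T / 2"
  define B where "B = (b - a) / 2"
  have AB: "0 < A" "0 < B" using T ab by (simp_all add: A_def B_def)
  define K where "K = 16 * (A\<^sup>2 + B\<^sup>2) * (1 / A\<^sup>2 + 1 / B\<^sup>2)"
  have K: "0 \<le> K" by (simp add: K_def)
  define w where "w = Complex (- T / 2) ((a + b) / 2)"
  note transfer = nn_integral_control_space[OF _ ab \<omega>_eq \<omega>_borel, of _ T, folded w_def A_def B_def]
  have nn: "(\<integral>\<^sup>+p. ennreal ((cmod (f p))\<^sup>2) \<partial>control_space \<omega> T) = ennreal (\<integral>p. (cmod (f p))\<^sup>2 \<partial>control_space \<omega> T)"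
    if "square_integrable (control_space \<omega> T) f" for f
    using that by (intro nn_integral_eq_integral) (auto simp: square_integrable_def)
  have sq: "square_integrable (control_space \<omega> T) (poly_mode T q)" for q
    by (rule square_integrable_poly_mode[OF \<omega>_borel])
  have "\<exists>c. (\<integral>p. (cmod (poly_mode T q p - c))\<^sup>2 \<partial>control_space \<omega> T)
    \<le> (1 + K) * (\<integral>p. (cmod (poly_mode T q p + cnj (poly_mode T r p)))\<^sup>2 \<partial>control_space \<omega> T)" for q r
  proof -
    have hol: "(\<lambda>z. poly s (exp (w + z))) holomorphic_on UNIV" for s
      by (intro holomorphic_intros)
    have pm: "poly s \<in> borel_measurable borel" for s :: "complex poly"
      by (intro borel_measurable_continuous_onI continuous_intros)
    note [measurable] = pm
    have sum_meas: "(\<lambda>z. ennreal ((cmod (poly q z + cnj (poly r z)))\<^sup>2)) \<in> borel_measurable borel"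
      by (intro measurable_compose[OF borel_measurable_continuous_onI measurable_ennreal] continuous_intros)
    obtain c where c: "plane_integral (\<lambda>z. indicator {z. \<bar>Re z\<bar> \<le> A \<and> \<bar>Im z\<bar> \<le> B} z * ennreal ((cmod (poly q (exp (w + z)) - c))\<^sup>2))
      \<le> ennreal (1 + K) * plane_integral (\<lambda>z. indicator {z. \<bar>Re z\<bar> \<le> A \<and> \<bar>Im z\<bar> \<le> B} z
          * ennreal ((cmod (poly q (exp (w + z)) + cnj (poly r (exp (w + z)))))\<^sup>2))"
      using friedrichs_conjugate[OF hol[of q] hol[of r] AB, folded K_def] by blast
    have sqc: "square_integrable (control_space \<omega> T) (\<lambda>p. poly_mode T q p - c)"
      using sq[of "q - [:c:]"] by (simp add: poly_mode_def[abs_def])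
    have sqs: "square_integrable (control_space \<omega> T) (\<lambda>p. poly_mode T q p + cnj (poly_mode T r p))"
      by (intro square_integrable_add square_integrable_cnj sq)
    have "ennreal (\<integral>p. (cmod (poly_mode T q p - c))\<^sup>2 \<partial>control_space \<omega> T)
        = (\<integral>\<^sup>+p. ennreal ((cmod (poly_mode T q p - c))\<^sup>2) \<partial>control_space \<omega> T)"
      by (rule nn[OF sqc, symmetric])
    also have "\<dots> = plane_integral (\<lambda>z. indicator {z. \<bar>Re z\<bar> \<le> A \<and> \<bar>Im z\<bar> \<le> B} z * ennreal ((cmod (poly q (exp (w + z)) - c))\<^sup>2)) / ennreal (2 * pi)"
      unfolding poly_mode_def by (rule transfer) measurable
    also have "\<dots> \<le> (ennreal (1 + K) * plane_integral (\<lambda>z. indicator {z. \<bar>Re z\<bar> \<le> A \<and> \<bar>Im z\<bar> \<le> B} z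
          * ennreal ((cmod (poly q (exp (w + z)) + cnj (poly r (exp (w + z)))))\<^sup>2))) / ennreal (2 * pi)"
      using c by (rule divide_right_mono_ennreal)
    also have "\<dots> = ennreal (1 + K) * (\<integral>\<^sup>+p. ennreal ((cmod (poly_mode T q p + cnj (poly_mode T r p)))\<^sup>2) \<partial>control_space \<omega> T)"
      unfolding poly_mode_def ennreal_times_divide[symmetric]
      by (subst transfer[OF sum_meas, symmetric]) simp
    also have "\<dots> = ennreal ((1 + K) * (\<integral>p. (cmod (poly_mode T q p + cnj (poly_mode T r p)))\<^sup>2 \<partial>control_space \<omega> T))"
      using K by (simp add: nn[OF sqs] ennreal_mult')
    finally show ?thesis
      using K by (auto simp: ennreal_le_iff)
  qed
  then show thesis using that[of "1 + K"] K by simp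
qed

section \<open>Moments under sums, conjugation and real pairings\<close>

lemma moment_add:
  assumes "\<omega> \<in> sets borel" "control \<omega> T u" "control \<omega> T v"
  shows "moment \<omega> T (\<lambda>p. u p + v p) n = moment \<omega> T u n + moment \<omega> T v n"
  using integrable_moment[OF assms(1)] assms(2,3) unfolding moment_def control_iff
  by (simp add: distrib_right)

lemma moment_diff:
  assumes "\<omega> \<in> sets borel" "control \<omega> T u" "control \<omega> T v"
  shows "moment \<omega> T (\<lambda>p. u p - v p) n = moment \<omega> T u n - moment \<omega> T v n"
  using integrable_moment[OF assms(1)] assms(2,3) unfolding moment_def control_iff
  by (simp add: left_diff_distrib)

lemma AE_cnj_dual_mode:
  assumes "\<omega> \<in> sets borel"
  shows "AE p in control_space \<omega> T. cnj (dual_mode T n p) = dual_mode T (- n) p"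
  using AE_control_space[OF assms]
proof eventually_elim
  case (elim p)
  then have "cnj (snd p) = inverse (snd p)"
    by (simp add: inverse_complex_def complex_eq_iff cmod_def)
  then show ?case by (simp add: dual_mode_def power_int_minus power_int_inverse)
qed

lemma moment_cnj:
  assumes \<omega>: "\<omega> \<in> sets borel" and u: "control \<omega> T u"
  shows "moment \<omega> T (\<lambda>p. cnj (u p)) n = cnj (moment \<omega> T u (- n))"
proof -
  have [measurable]: "u \<in> borel_measurable (control_space \<omega> T)"
    "(\<lambda>p. cnj (u p)) \<in> borel_measurable (control_space \<omega> T)"
    "\<And>n. dual_mode T n \<in> borel_measurable (control_space \<omega> T)"
    using square_integrable_measurable u square_integrable_cnj
    by (auto simp: control_iff intro: control_space_measurable dual_mode_measurable)
  have int: "integrable (control_space \<omega> T) (\<lambda>p. u p * dual_mode T (- n) p)"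
    using integrable_moment[OF \<omega>] u by (simp add: control_iff)
  have "moment \<omega> T (\<lambda>p. cnj (u p)) n = (\<integral>p. cnj (u p * dual_mode T (- n) p) \<partial>control_space \<omega> T)"
    unfolding moment_def
  proof (rule integral_cong_AE)
    show "AE p in control_space \<omega> T. cnj (u p) * dual_mode T n p = cnj (u p * dual_mode T (- n) p)"
      using AE_cnj_dual_mode[OF \<omega>, of T "- n"] by eventually_elim simp
    show "(\<lambda>p. cnj (u p * dual_mode T (- n) p)) \<in> borel_measurable (control_space \<omega> T)"
      by (intro borel_measurable_continuous_on[OF continuous_on_cnj[OF continuous_on_id]]) measurable
  qed measurable
  also have "\<dots> = cnj (moment \<omega> T u (- n))"
    unfolding moment_def by (rule integral_bounded_linear[OF bounded_linear_cnj int])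
  finally show ?thesis .
qed

text \<open>Moments of order n \<ge> 0 are pairings with holomorphic test functions and those of
  order n \<le> 0 with antiholomorphic ones. Since \<open>c\<close> is arbitrary, the real pairings
  determine the complex moment; the \<open>cnj c\<close> in the second form undoes the outer
  conjugation.\<close>

lemma inner_moment:
  assumes \<omega>: "\<omega> \<in> sets borel" and u: "control \<omega> T u"
  shows "0 \<le> n \<Longrightarrow> moment \<omega> T u n \<bullet> c = (\<integral>p. u p \<bullet> poly_mode T (monom c (nat n)) p \<partial>control_space \<omega> T)"
    and "n \<le> 0 \<Longrightarrow> moment \<omega> T u n \<bullet> c = (\<integral>p. u p \<bullet> cnj (poly_mode T (monom (cnj c) (nat (- n))) p) \<partial>control_space \<omega> T)"
proof -
  have [measurable]: "u \<in> borel_measurable (control_space \<omega> T)"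
    "\<And>n. dual_mode T n \<in> borel_measurable (control_space \<omega> T)"
    "\<And>q. poly_mode T q \<in> borel_measurable (control_space \<omega> T)"
    "\<And>q. (\<lambda>p. cnj (poly_mode T q p)) \<in> borel_measurable (control_space \<omega> T)"
    using square_integrable_measurable u square_integrable_cnj[OF square_integrable_poly_mode[OF \<omega>]]
    by (auto simp: control_iff intro: control_space_measurable)
  have int: "integrable (control_space \<omega> T) (\<lambda>p. u p * dual_mode T n p)"
    using integrable_moment[OF \<omega>] u by (simp add: control_iff)
  have "moment \<omega> T u n \<bullet> c = (\<integral>p. (u p * dual_mode T n p) \<bullet> c \<partial>control_space \<omega> T)"
    unfolding moment_def by (rule integral_bounded_linear[OF bounded_linear_inner_left int, symmetric])
  also have "\<dots> = (\<integral>p. u p \<bullet> (c * dual_mode T (- n) p) \<partial>control_space \<omega> T)"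
  proof (rule integral_cong_AE)
    show "AE p in control_space \<omega> T. (u p * dual_mode T n p) \<bullet> c = u p \<bullet> (c * dual_mode T (- n) p)"
      using AE_cnj_dual_mode[OF \<omega>, of T n]
    proof eventually_elim
      case (elim p)
      have "(x * y) \<bullet> c = x \<bullet> (c * cnj y)" for x y by (simp add: inner_complex_def algebra_simps)
      then show ?case by (simp only: elim)
    qed
  qed measurable
  finally have eq: "moment \<omega> T u n \<bullet> c = (\<integral>p. u p \<bullet> (c * dual_mode T (- n) p) \<partial>control_space \<omega> T)" .
  have pm: "poly_mode T (monom d (nat k)) p = d * dual_mode T (- k) p" if "0 \<le> k" for d k p
  proof -
    have "exp (fst p - T) ^ nat k = exp (of_int k * (fst p - T))"
      using that by (simp add: exp_of_nat_mult[symmetric])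
    then have "of_real (exp (fst p - T)) ^ nat k = complex_of_real (exp (of_int k * (fst p - T)))"
      by (simp flip: of_real_power)
    moreover have "snd p powi k = snd p ^ nat k" using that by (simp add: power_int_def)
    moreover have "of_int k * (fst p - T) = - \<bar>of_int (- k)\<bar> * (T - fst p)"
      using that by (simp add: algebra_simps)
    ultimately show ?thesis
      by (simp add: poly_mode_def dual_mode_def poly_monom power_mult_distrib)
  qed
  show "moment \<omega> T u n \<bullet> c = (\<integral>p. u p \<bullet> poly_mode T (monom c (nat n)) p \<partial>control_space \<omega> T)" if "0 \<le> n"
    unfolding eq using that by (simp add: pm)
  show "moment \<omega> T u n \<bullet> c = (\<integral>p. u p \<bullet> cnj (poly_mode T (monom (cnj c) (nat (- n))) p) \<partial>control_space \<omega> T)" if "n \<le> 0"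
    unfolding eq
  proof (rule integral_cong_AE)
    show "AE p in control_space \<omega> T. u p \<bullet> (c * dual_mode T (- n) p)
        = u p \<bullet> cnj (poly_mode T (monom (cnj c) (nat (- n))) p)"
      using AE_cnj_dual_mode[OF \<omega>, of T n]
      by eventually_elim (use that in \<open>simp add: pm\<close>)
  qed measurable
qed

text \<open>The functional pairs \<open>w\<close> with the holomorphic part \<open>q\<close> alone.
  Choosing \<open>r = 0\<close> reproduces the moments of \<open>w\<close>, choosing
  \<open>q = 0\<close> makes the others vanish, and at order 0 the two demands agree because
  \<open>w\<close> has moment 0 there.\<close>

lemma control_with_prescribed_positive_moments:
  assumes \<omega>: "open_strict_interval \<omega>" and T: "0 < T" and w: "control \<omega> T w" and w0: "moment \<omega> T w 0 = 0"
  obtains v where "control \<omega> T v" "\<And>n. 0 \<le> n \<Longrightarrow> moment \<omega> T v n = moment \<omega> T w n"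
    "\<And>n. n \<le> 0 \<Longrightarrow> moment \<omega> T v n = 0"
proof -
  let ?M = "control_space \<omega> T"
  note \<omega>_borel = open_strict_interval_borel[OF \<omega>]
  have sq_w: "square_integrable ?M w" using w by (simp add: control_iff)
  have sq: "square_integrable ?M (poly_mode T q)" for q
    by (rule square_integrable_poly_mode[OF \<omega>_borel])
  obtain C where C: "0 < C" and friedrichs: "\<And>q r. \<exists>c. (\<integral>p. (cmod (poly_mode T q p - c))\<^sup>2 \<partial>?M)
      \<le> C * (\<integral>p. (cmod (poly_mode T q p + cnj (poly_mode T r p)))\<^sup>2 \<partial>?M)"
    by (rule friedrichs_control_space[OF \<omega> T]) blast
  \<comment> \<open>One function may come from several pairs \<open>(q, r)\<close>; the graph keeps
    them all, and the estimate below makes their values agree.\<close>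
  define E where "E = range (\<lambda>(q, r). (\<lambda>p. poly_mode T q p + cnj (poly_mode T r p),
      \<integral>p. w p \<bullet> poly_mode T q p \<partial>?M))"
  have inner_int: "integrable ?M (\<lambda>p. w p \<bullet> poly_mode T q p)" for q
    by (rule square_integrable_inner[OF sq_w sq])
  obtain v where v: "square_integrable ?M v" and rep: "\<And>f l. (f, l) \<in> E \<Longrightarrow> (\<integral>p. v p \<bullet> f p \<partial>?M) = l"
  proof (rule bounded_functional_representation[of E ?M "C * (\<integral>p. (cmod (w p))\<^sup>2 \<partial>?M)"])
    show "square_integrable ?M f" if "(f, l) \<in> E" for f l
      using that by (auto simp: E_def intro!: square_integrable_add square_integrable_cnj sq)
    show "E \<noteq> {}" by (simp add: E_def)
    show "(\<lambda>p. f p + g p, l + m) \<in> E" if fg: "(f, l) \<in> E" "(g, m) \<in> E" for f l g m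
    proof -
      obtain q r q' r' where
        f: "f = (\<lambda>p. poly_mode T q p + cnj (poly_mode T r p))" "l = (\<integral>p. w p \<bullet> poly_mode T q p \<partial>?M)" and
        g: "g = (\<lambda>p. poly_mode T q' p + cnj (poly_mode T r' p))" "m = (\<integral>p. w p \<bullet> poly_mode T q' p \<partial>?M)"
        using fg by (auto simp: E_def)
      have "(\<lambda>p. f p + g p) = (\<lambda>p. poly_mode T (q + q') p + cnj (poly_mode T (r + r') p))"
        by (auto simp: f g poly_mode_def)
      moreover have "l + m = (\<integral>p. w p \<bullet> poly_mode T (q + q') p \<partial>?M)"
        by (simp add: f g poly_mode_def[of T "q + q'"] inner_add_right Bochner_Integration.integral_add[OF inner_int inner_int, symmetric])
          (simp add: poly_mode_def)
      ultimately show ?thesis by (auto simp: E_def intro!: image_eqI[of _ _ "(q + q', r + r')"])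
    qed
    show "(\<lambda>p. c *\<^sub>R f p, c * l) \<in> E" if f: "(f, l) \<in> E" for f l c
    proof -
      obtain q r where
        f: "f = (\<lambda>p. poly_mode T q p + cnj (poly_mode T r p))" "l = (\<integral>p. w p \<bullet> poly_mode T q p \<partial>?M)"
        using f by (auto simp: E_def)
      have "(\<lambda>p. c *\<^sub>R f p) = (\<lambda>p. poly_mode T (smult (of_real c) q) p + cnj (poly_mode T (smult (of_real c) r) p))"
        by (auto simp: f poly_mode_def scaleR_conv_of_real distrib_left)
      moreover have "w p \<bullet> poly_mode T (smult (of_real c) q) p = c * (w p \<bullet> poly_mode T q p)" for p
        by (simp add: poly_mode_def inner_complex_def algebra_simps)
      then have "c * l = (\<integral>p. w p \<bullet> poly_mode T (smult (of_real c) q) p \<partial>?M)"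
        by (simp add: f)
      ultimately show ?thesis by (auto simp: E_def intro!: image_eqI[of _ _ "(smult (of_real c) q, smult (of_real c) r)"])
    qed
    show "2 * l \<le> (\<integral>p. (cmod (f p))\<^sup>2 \<partial>?M) + C * (\<integral>p. (cmod (w p))\<^sup>2 \<partial>?M)" if f: "(f, l) \<in> E" for f l
    proof -
      obtain q r where
        f: "f = (\<lambda>p. poly_mode T q p + cnj (poly_mode T r p))" "l = (\<integral>p. w p \<bullet> poly_mode T q p \<partial>?M)"
        using f by (auto simp: E_def)
      obtain c where c: "(\<integral>p. (cmod (poly_mode T q p - c))\<^sup>2 \<partial>?M) \<le> C * (\<integral>p. (cmod (f p))\<^sup>2 \<partial>?M)"
        using friedrichs[of q r] by (auto simp: f)
      have const: "(\<lambda>p. poly_mode T q p - c) = poly_mode T (q - [:c:])"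
        by (auto simp: poly_mode_def)
      \<comment> \<open>Constants are invisible to \<open>w\<close>, so the constant
        \<open>c\<close> from Friedrichs' inequality may be subtracted before estimating.\<close>
      have "(\<integral>p. w p \<bullet> c \<partial>?M) = 0"
        using inner_moment(1)[OF \<omega>_borel w, of 0 c] w0 by (simp add: poly_mode_def poly_monom)
      moreover have "integrable ?M (\<lambda>p. w p \<bullet> c)"
        using inner_int[of "[:c:]"] by (simp add: poly_mode_def)
      ultimately have "l = (\<integral>p. w p \<bullet> (poly_mode T q p - c) \<partial>?M)"
        using inner_int[of q] by (simp add: f inner_diff_right)
      \<comment> \<open>The parameter \<open>1 / C\<close> cancels the constant of Friedrichs'
        inequality, so that the squared norm of \<open>f\<close> ends up with coefficient 1.\<close>
      then have "2 * l \<le> (\<integral>p. (cmod (w p))\<^sup>2 \<partial>?M) / (1 / C) + 1 / C * (\<integral>p. (cmod (poly_mode T q p - c))\<^sup>2 \<partial>?M)"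
        using inner_integral_le[OF sq_w sq[of "q - [:c:]", folded const], of "1 / C"] C by simp
      also have "1 / C * (\<integral>p. (cmod (poly_mode T q p - c))\<^sup>2 \<partial>?M) \<le> 1 / C * (C * (\<integral>p. (cmod (f p))\<^sup>2 \<partial>?M))"
        using c C by (intro mult_left_mono) auto
      finally show ?thesis using C by (simp add: mult.commute)
    qed
  qed blast
  have rep': "(\<integral>p. v p \<bullet> (poly_mode T q p + cnj (poly_mode T r p)) \<partial>?M) = (\<integral>p. w p \<bullet> poly_mode T q p \<partial>?M)" for q r
    by (rule rep) (auto simp: E_def)
  have ctrl: "control \<omega> T v" using v by (simp add: control_iff)
  show thesis
  proof
    show "control \<omega> T v" by (fact ctrl)
    show "moment \<omega> T v n = moment \<omega> T w n" if "0 \<le> n" for n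
    proof (rule vector_eq_rdot[THEN iffD1, rule_format])
      fix c
      show "moment \<omega> T v n \<bullet> c = moment \<omega> T w n \<bullet> c"
        using rep'[of "monom c (nat n)" 0]
        by (simp add: inner_moment(1)[OF \<omega>_borel _ that] ctrl w) (simp add: poly_mode_def)
    qed
    show "moment \<omega> T v n = 0" if "n \<le> 0" for n
    proof (rule vector_eq_rdot[THEN iffD1, rule_format])
      fix c
      show "moment \<omega> T v n \<bullet> c = 0 \<bullet> c"
        using rep'[of 0 "monom (cnj c) (nat (- n))"]
        by (simp add: inner_moment(2)[OF \<omega>_borel _ that] ctrl w) (simp add: poly_mode_def)
    qed
  qed
qed

theorem theorem1p11:
  fixes \<omega> :: "complex set" and T :: real and f\<^sub>0 :: L2
  assumes "open_strict_interval \<omega>" and "T > 0"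
  shows "f\<^sub>0 \<in> NC_L2 \<omega> T \<longleftrightarrow>
    riesz_proj f\<^sub>0 \<in> NC_H2 \<omega> T \<and> riesz_proj (conj_L2 f\<^sub>0) \<in> NC_H2 \<omega> T"
proof -
  note \<omega> = open_strict_interval_borel[OF assms(1)]
  note NC_iff = NC_L2_iff_moments[OF \<omega> less_imp_le[OF assms(2)]] NC_H2_iff_moments[OF \<omega> less_imp_le[OF assms(2)]]
  define \<mu> where "\<mu> n = - fourier_coeff f\<^sub>0 n * of_real (exp (- \<bar>of_int n\<bar> * T))" for n
  have L2: "f\<^sub>0 \<in> NC_L2 \<omega> T \<longleftrightarrow> (\<exists>u. control \<omega> T u \<and> (\<forall>n. moment \<omega> T u n = \<mu> n))"
    by (simp add: NC_iff \<mu>_def)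
  have H2: "riesz_proj f\<^sub>0 \<in> NC_H2 \<omega> T \<longleftrightarrow> (\<exists>u. control \<omega> T u \<and> (\<forall>n\<ge>0. moment \<omega> T u n = \<mu> n))"
    by (simp add: NC_iff \<mu>_def)
  have H2': "riesz_proj (conj_L2 f\<^sub>0) \<in> NC_H2 \<omega> T \<longleftrightarrow>
      (\<exists>u. control \<omega> T u \<and> (\<forall>n\<ge>0. moment \<omega> T u n = cnj (\<mu> (- n))))"
    by (simp add: NC_iff \<mu>_def fourier_coeff_conj)
  have control_cnj: "control \<omega> T (\<lambda>p. cnj (u p))" if "control \<omega> T u" for u
    using that square_integrable_cnj by (auto simp: control_iff)
  show ?thesis
    unfolding L2 H2 H2'
  proof (intro iffI)
    assume "\<exists>u. control \<omega> T u \<and> (\<forall>n. moment \<omega> T u n = \<mu> n)"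
    then obtain u where u: "control \<omega> T u" "\<And>n. moment \<omega> T u n = \<mu> n" by blast
    then show "(\<exists>u. control \<omega> T u \<and> (\<forall>n\<ge>0. moment \<omega> T u n = \<mu> n)) \<and>
        (\<exists>u. control \<omega> T u \<and> (\<forall>n\<ge>0. moment \<omega> T u n = cnj (\<mu> (- n))))"
      using control_cnj[OF u(1)] moment_cnj[OF \<omega> u(1)] by auto
  next
    assume "(\<exists>u. control \<omega> T u \<and> (\<forall>n\<ge>0. moment \<omega> T u n = \<mu> n)) \<and>
        (\<exists>u. control \<omega> T u \<and> (\<forall>n\<ge>0. moment \<omega> T u n = cnj (\<mu> (- n))))"
    then obtain u v' where u: "control \<omega> T u" "\<And>n. 0 \<le> n \<Longrightarrow> moment \<omega> T u n = \<mu> n"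
      and v': "control \<omega> T v'" "\<And>n. 0 \<le> n \<Longrightarrow> moment \<omega> T v' n = cnj (\<mu> (- n))" by blast
    define v where "v = (\<lambda>p. cnj (v' p))"
    have v: "control \<omega> T v" "\<And>n. n \<le> 0 \<Longrightarrow> moment \<omega> T v n = \<mu> n"
      using control_cnj[OF v'(1)] moment_cnj[OF \<omega> v'(1)] v'(2) by (auto simp: v_def)
    have diff: "control \<omega> T (\<lambda>p. u p - v p)"
      using u(1) v(1) square_integrable_diff by (auto simp: control_iff)
    have "moment \<omega> T (\<lambda>p. u p - v p) 0 = 0"
      by (simp add: moment_diff[OF \<omega> u(1) v(1)] u(2) v(2))
    from control_with_prescribed_positive_moments[OF assms diff this]
    obtain r where r: "control \<omega> T r"
      "\<And>n. 0 \<le> n \<Longrightarrow> moment \<omega> T r n = moment \<omega> T (\<lambda>p. u p - v p) n"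
      "\<And>n. n \<le> 0 \<Longrightarrow> moment \<omega> T r n = 0" by blast
    \<comment> \<open>\<open>v\<close> already has the right moments for n \<le> 0, where
      \<open>r\<close> adds nothing; for n \<ge> 0 the control \<open>r\<close> supplies the
      difference between the moments of \<open>u\<close> and those of \<open>v\<close>.\<close>
    have "moment \<omega> T (\<lambda>p. r p + v p) n = \<mu> n" for n
    proof (cases "0 \<le> n")
      case True
      then show ?thesis
        by (simp add: moment_add[OF \<omega> r(1) v(1)] r(2) moment_diff[OF \<omega> u(1) v(1)] u(2))
    next
      case False
      then show ?thesis by (simp add: moment_add[OF \<omega> r(1) v(1)] r(3) v(2))
    qed
    moreover have "control \<omega> T (\<lambda>p. r p + v p)"
      using r(1) v(1) square_integrable_add by (auto simp: control_iff)
    ultimately show "\<exists>u. control \<omega> T u \<and> (\<forall>n. moment \<omega> T u n = \<mu> n)" by blast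
  qed
qed

end
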